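(* Let $A$ be a continuous linear operator on $L_2([0;1])$ such that (1) $\dim\ker A<+\infty$; (2) the restriction $\tilde A$ of $A$ to $(\ker A)^\perp$ is continuously invertible. Let $\xi$ be a white noise in $L_2([0;1])$ and let $x(t)=(A\mathbf 1_{[0;t]},\xi)$, $t\in[0;1]$. Then for every $p\in\mathbb N$ and every integer $k\ge 2$ there exists the self-intersection local time of multiplicity $k$ of $x$, i.e. the limit $$T^x_k=L_p\text{-}\lim_{\varepsilon\to0}T^x_{\varepsilon,k},\qquad T^x_{\varepsilon,k}=\int_{\Delta_k}\prod_{i=1}^{k-1}p_\varepsilon\big(x(t_{i+1})-x(t_i)\big)\,d\vec t,$$ exists in $L_p(\Omega,\mathcal F,P)$.
   Context: A white noise in a separable real Hilbert space $H$ is a linear map $h\mapsto (h,\xi)$ from $H$ to random variables on a probability space $(\Omega,\mathcal F,P)$ such that $(h,\xi)\sim N(0,\|h\|^2)$ for every $h\in H$. $\Delta_k=\{(t_1,\dots,t_k):0\le t_1\le\dots\le t_k\le1\}$ and $d\vec t=dt_1\cdots dt_k$. $p_\varepsilon(z)=\frac1{\sqrt{2\pi\varepsilon}}e^{-z^2/(2\varepsilon)}$. "Continuously invertible" for $\tilde A:(\ker A)^\perp\to L_2([0;1])$ means that $\tilde A$ has a bounded inverse $\tilde A^{-1}:\tilde A\big((\ker A)^\perp\big)\to(\ker A)^\perp$. *)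

theory Defs
  imports "HOL-Probability.Probability"
begin

section \<open>The real Hilbert space \<open>L\<^sub>2([0;1])\<close>\<close>

definition square_integrable_on_unit :: "(real \<Rightarrow> real) \<Rightarrow> bool" where
  "square_integrable_on_unit f \<longleftrightarrow>
     f \<in> borel_measurable (lebesgue_on {0..1}) \<and> integrable (lebesgue_on {0..1}) (\<lambda>x. (f x)\<^sup>2)"

definition L2_unit_rel :: "(real \<Rightarrow> real) \<Rightarrow> (real \<Rightarrow> real) \<Rightarrow> bool" where
  "L2_unit_rel f g \<longleftrightarrow>
     square_integrable_on_unit f \<and> square_integrable_on_unit g \<and>
     (AE x in lebesgue_on {0..1}. f x = g x)"

lemma square_integrable_on_unit_mult:
  assumes "square_integrable_on_unit f" "square_integrable_on_unit g"
  shows "integrable (lebesgue_on {0..1}) (\<lambda>x. f x * g x)"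
proof (rule Bochner_Integration.integrable_bound)
  show "integrable (lebesgue_on {0..1}) (\<lambda>x. (f x)\<^sup>2 + (g x)\<^sup>2)"
    using assms by (auto simp: square_integrable_on_unit_def)
  show "(\<lambda>x. f x * g x) \<in> borel_measurable (lebesgue_on {0..1})"
    using assms by (auto simp: square_integrable_on_unit_def)
  have "\<bar>a * b\<bar> \<le> \<bar>a\<^sup>2 + b\<^sup>2\<bar>" for a b :: real
  proof -
    have "2 * (\<bar>a\<bar> * \<bar>b\<bar>) \<le> \<bar>a\<bar>\<^sup>2 + \<bar>b\<bar>\<^sup>2"
      using sum_squares_bound[of "\<bar>a\<bar>" "\<bar>b\<bar>"] by simp
    moreover have "0 \<le> \<bar>a\<bar> * \<bar>b\<bar>"
      by (intro mult_nonneg_nonneg abs_ge_zero)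
    ultimately have "\<bar>a\<bar> * \<bar>b\<bar> \<le> \<bar>a\<bar>\<^sup>2 + \<bar>b\<bar>\<^sup>2"
      by linarith
    then show ?thesis by (simp add: abs_mult)
  qed
  then show "AE x in lebesgue_on {0..1}. norm (f x * g x) \<le> norm ((f x)\<^sup>2 + (g x)\<^sup>2)"
    by simp
qed

lemma square_integrable_on_unit_add:
  assumes "square_integrable_on_unit f" "square_integrable_on_unit g"
  shows "square_integrable_on_unit (\<lambda>x. f x + g x)"
proof -
  have "integrable (lebesgue_on {0..1}) (\<lambda>x. (f x)\<^sup>2 + (g x)\<^sup>2 + 2 * (f x * g x))"
    using assms square_integrable_on_unit_mult[OF assms]
    by (auto simp: square_integrable_on_unit_def)
  then show ?thesis
    using assms by (auto simp: square_integrable_on_unit_def power2_sum mult.assoc)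
qed

lemma square_integrable_on_unit_scale:
  "square_integrable_on_unit f \<Longrightarrow> square_integrable_on_unit (\<lambda>x. r * f x)"
  by (auto simp: square_integrable_on_unit_def power_mult_distrib)

lemma square_integrable_on_unit_bounded:
  assumes "f \<in> borel_measurable (lebesgue_on {0..1})" "\<And>x. \<bar>f x\<bar> \<le> B"
  shows "square_integrable_on_unit f"
  unfolding square_integrable_on_unit_def
proof (intro conjI assms(1) finite_measure.integrable_const_bound[where B = "B\<^sup>2"])
  show "finite_measure (lebesgue_on {0..1::real})"
    by (rule finite_measure_lebesgue_on) simp
  show "AE x in lebesgue_on {0..1}. norm ((f x)\<^sup>2) \<le> B\<^sup>2"
    using assms(2) by (intro AE_I2) (simp add: abs_le_square_iff[symmetric] order_trans[OF assms(2)])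
  show "(\<lambda>x. (f x)\<^sup>2) \<in> borel_measurable (lebesgue_on {0..1})"
    using assms(1) by measurable
qed

quotient_type L2_unit = "real \<Rightarrow> real" / partial: L2_unit_rel
proof (rule part_equivpI)
  have "square_integrable_on_unit (\<lambda>_. 0)"
    by (rule square_integrable_on_unit_bounded[where B = 0]) auto
  then show "\<exists>f. L2_unit_rel f f"
    by (auto simp: L2_unit_rel_def)
  show "symp L2_unit_rel"
    by (auto simp: symp_def L2_unit_rel_def)
  show "transp L2_unit_rel"
    by (auto simp: transp_def L2_unit_rel_def)
qed

instantiation L2_unit :: real_inner
begin

lift_definition zero_L2_unit :: L2_unit is "\<lambda>_. 0"
  by (auto simp: L2_unit_rel_def intro!: square_integrable_on_unit_bounded[where B = 0])

lift_definition plus_L2_unit :: "L2_unit \<Rightarrow> L2_unit \<Rightarrow> L2_unit" is "\<lambda>f g x. f x + g x"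
  by (auto simp: L2_unit_rel_def intro!: square_integrable_on_unit_add)

lift_definition scaleR_L2_unit :: "real \<Rightarrow> L2_unit \<Rightarrow> L2_unit" is "\<lambda>r f x. r * f x"
  by (auto simp: L2_unit_rel_def intro!: square_integrable_on_unit_scale)

definition uminus_L2_unit :: "L2_unit \<Rightarrow> L2_unit" where
  "- f = (- 1) *\<^sub>R f" for f :: L2_unit

definition minus_L2_unit :: "L2_unit \<Rightarrow> L2_unit \<Rightarrow> L2_unit" where
  "f - g = f + - g" for f g :: L2_unit

lift_definition inner_L2_unit :: "L2_unit \<Rightarrow> L2_unit \<Rightarrow> real"
  is "\<lambda>f g. integral\<^sup>L (lebesgue_on {0..1}) (\<lambda>x. f x * g x)"
  by (rule integral_cong_AE) (auto simp: L2_unit_rel_def square_integrable_on_unit_def)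

definition norm_L2_unit :: "L2_unit \<Rightarrow> real" where
  "norm f = sqrt (inner f f)" for f :: L2_unit

definition sgn_L2_unit :: "L2_unit \<Rightarrow> L2_unit" where
  "sgn f = inverse (norm f) *\<^sub>R f" for f :: L2_unit

definition dist_L2_unit :: "L2_unit \<Rightarrow> L2_unit \<Rightarrow> real" where
  "dist f g = norm (f - g)" for f g :: L2_unit

definition uniformity_L2_unit :: "(L2_unit \<times> L2_unit) filter" where
  "uniformity_L2_unit = (INF e\<in>{0 <..}. principal {(x, y). dist x y < e})"

definition open_L2_unit :: "L2_unit set \<Rightarrow> bool" where
  "open_L2_unit U \<longleftrightarrow> (\<forall>x\<in>U. eventually (\<lambda>(x', y). x' = x \<longrightarrow> y \<in> U) uniformity)"

instance
proof
  fix f g h :: L2_unit and r s :: real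
  show "f + g + h = f + (g + h)"
    by transfer (auto simp: L2_unit_rel_def add.assoc intro!: square_integrable_on_unit_add)
  show "f + g = g + f"
    by transfer (auto simp: L2_unit_rel_def add.commute intro!: square_integrable_on_unit_add)
  show "0 + f = f"
    by transfer (auto simp: L2_unit_rel_def)
  show "- f + f = 0"
    unfolding uminus_L2_unit_def
    by transfer (auto simp: L2_unit_rel_def
        intro!: square_integrable_on_unit_bounded[where B = 0])
  show "f - g = f + - g"
    by (fact minus_L2_unit_def)
  show "r *\<^sub>R (f + g) = r *\<^sub>R f + r *\<^sub>R g"
    by transfer (auto simp: L2_unit_rel_def distrib_left
        intro!: square_integrable_on_unit_add square_integrable_on_unit_scale)
  show "(r + s) *\<^sub>R f = r *\<^sub>R f + s *\<^sub>R f"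
    by transfer (auto simp: L2_unit_rel_def distrib_right
        intro!: square_integrable_on_unit_add square_integrable_on_unit_scale)
  show "r *\<^sub>R s *\<^sub>R f = (r * s) *\<^sub>R f"
    by transfer (auto simp: L2_unit_rel_def mult.assoc
        intro!: square_integrable_on_unit_scale)
  show "1 *\<^sub>R f = f"
    by transfer (auto simp: L2_unit_rel_def)
  show "inner f g = inner g f"
    by transfer (auto simp: mult.commute)
  show "inner (f + g) h = inner f h + inner g h"
  proof transfer
    fix f g h assume "L2_unit_rel f f" "L2_unit_rel g g" "L2_unit_rel h h"
    then show "integral\<^sup>L (lebesgue_on {0..1}) (\<lambda>x. (f x + g x) * h x) =
        integral\<^sup>L (lebesgue_on {0..1}) (\<lambda>x. f x * h x) +
        integral\<^sup>L (lebesgue_on {0..1}) (\<lambda>x. g x * h x)"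
      by (simp add: distrib_right square_integrable_on_unit_mult L2_unit_rel_def)
  qed
  show "inner (r *\<^sub>R f) g = r * inner f g"
    by transfer (simp add: mult.assoc)
  show "0 \<le> inner f f"
    by transfer simp
  show "inner f f = 0 \<longleftrightarrow> f = 0"
  proof transfer
    fix f assume f: "L2_unit_rel f f"
    have "square_integrable_on_unit (\<lambda>_. 0)"
      by (rule square_integrable_on_unit_bounded[where B = 0]) auto
    moreover have "integral\<^sup>L (lebesgue_on {0..1}) (\<lambda>x. f x * f x) = 0 \<longleftrightarrow>
        (AE x in lebesgue_on {0..1}. f x * f x = 0)"
      using f by (intro integral_nonneg_eq_0_iff_AE)
        (auto simp: L2_unit_rel_def intro!: square_integrable_on_unit_mult)
    ultimately show "integral\<^sup>L (lebesgue_on {0..1}) (\<lambda>x. f x * f x) = 0 \<longleftrightarrow>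
        L2_unit_rel f (\<lambda>_. 0)"
      using f by (auto simp: L2_unit_rel_def)
  qed
  show "norm f = sqrt (inner f f)"
    by (fact norm_L2_unit_def)
  show "sgn f = inverse (norm f) *\<^sub>R f"
    by (fact sgn_L2_unit_def)
  show "dist f g = norm (f - g)"
    by (fact dist_L2_unit_def)
  show "uniformity = (INF e\<in>{0 <..}. principal {(x :: L2_unit, y). dist x y < e})"
    by (fact uniformity_L2_unit_def)
  show "open U \<longleftrightarrow> (\<forall>x\<in>U. eventually (\<lambda>(x', y). x' = x \<longrightarrow> y \<in> U) uniformity)"
    for U :: "L2_unit set"
    by (fact open_L2_unit_def)
qed

end

lift_definition L2_indicator :: "real \<Rightarrow> L2_unit" is "\<lambda>t. indicat_real {0..t}"
proof -
  fix t :: real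
  have "indicat_real {0..t} \<in> borel_measurable (lebesgue_on {0..1})"
    by (intro measurable_restrict_space1 borel_measurable_indicator) simp
  then have "square_integrable_on_unit (indicat_real {0..t})"
    by (rule square_integrable_on_unit_bounded[where B = 1]) (simp add: indicator_def)
  then show "L2_unit_rel (indicat_real {0..t}) (indicat_real {0..t})"
    by (simp add: L2_unit_rel_def)
qed


section \<open>Operators\<close>

definition op_kernel :: "('a \<Rightarrow> 'b::zero) \<Rightarrow> 'a set" where
  "op_kernel A = {f. A f = 0}"

text \<open>Stated with a finite spanning set because \<^term>\<open>dim V = 0\<close> holds by convention for
  infinite-dimensional \<open>V\<close>.\<close>

definition finite_dimensional_subspace :: "'a::real_vector set \<Rightarrow> bool" where
  "finite_dimensional_subspace V \<longleftrightarrow> (\<exists>B. finite B \<and> span B = V)"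

definition continuously_invertible_on ::
  "'a::real_normed_vector set \<Rightarrow> ('a \<Rightarrow> 'b::real_normed_vector) \<Rightarrow> bool" where
  "continuously_invertible_on S A \<longleftrightarrow>
     inj_on A S \<and> (\<exists>C. \<forall>y \<in> A ` S. norm (inv_into S A y) \<le> C * norm y)"


section \<open>White noise\<close>

text \<open>The case distinction is needed because \<open>N(0, 0)\<close> is the point mass at \<open>0\<close>.\<close>

definition centered_gaussian :: "real \<Rightarrow> real measure" where
  "centered_gaussian v =
     (if v = 0 then return borel 0 else density lborel (normal_density 0 (sqrt v)))"

text \<open>Random variables are functions here, so equality of random variables, and hence
  linearity of \<open>h \<mapsto> (h, \<xi>)\<close>, is almost sure; the exceptional set may depend on
  \<open>a, b, g, h\<close>.\<close>

definition white_noise :: "'w measure \<Rightarrow> ('h::real_inner \<Rightarrow> 'w \<Rightarrow> real) \<Rightarrow> bool" where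
  "white_noise M \<xi> \<longleftrightarrow>
     prob_space M \<and>
     (\<forall>h. \<xi> h \<in> borel_measurable M) \<and>
     (\<forall>a b g h. AE \<omega> in M. \<xi> (a *\<^sub>R g + b *\<^sub>R h) \<omega> = a * \<xi> g \<omega> + b * \<xi> h \<omega>) \<and>
     (\<forall>h. distr M borel (\<xi> h) = centered_gaussian ((norm h)\<^sup>2))"


section \<open>Self-intersection local time\<close>

text \<open>A process indexed by \<open>[0;1]\<close> whose value at each time is only determined almost surely has
  no well-defined sample paths. Pathwise integrals over time are formed from a jointly
  measurable version \<open>x\<close> of the process \<open>y\<close>.\<close>

definition measurable_version ::
  "'w measure \<Rightarrow> (real \<Rightarrow> 'w \<Rightarrow> real) \<Rightarrow> (real \<Rightarrow> 'w \<Rightarrow> real) \<Rightarrow> bool" where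
  "measurable_version M y x \<longleftrightarrow>
     (\<lambda>(t, \<omega>). x t \<omega>) \<in> borel_measurable (restrict_space borel {0..1} \<Otimes>\<^sub>M M) \<and>
     (\<forall>t\<in>{0..1}. AE \<omega> in M. x t \<omega> = y t \<omega>)"

definition heat_kernel :: "real \<Rightarrow> real \<Rightarrow> real" where
  "heat_kernel \<epsilon> z = 1 / sqrt (2 * pi * \<epsilon>) * exp (- z\<^sup>2 / (2 * \<epsilon>))"

definition time_simplex :: "nat \<Rightarrow> (nat \<Rightarrow> real) set" where
  "time_simplex k = {t \<in> {1..k} \<rightarrow>\<^sub>E {0..1}. \<forall>i\<in>{1..<k}. t i \<le> t (i + 1)}"

definition approx_self_intersection_local_time ::
  "(real \<Rightarrow> 'w \<Rightarrow> real) \<Rightarrow> nat \<Rightarrow> real \<Rightarrow> 'w \<Rightarrow> real" where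
  "approx_self_intersection_local_time x k \<epsilon> \<omega> =
     (LINT t : time_simplex k | (\<Pi>\<^sub>M i\<in>{1..k}. lborel).
        (\<Prod>i\<in>{1..<k}. heat_kernel \<epsilon> (x (t (i + 1)) \<omega> - x (t i) \<omega>)))"

definition Lp_functions :: "'w measure \<Rightarrow> nat \<Rightarrow> ('w \<Rightarrow> real) set" where
  "Lp_functions M p = {f \<in> borel_measurable M. integrable M (\<lambda>\<omega>. \<bar>f \<omega>\<bar> ^ p)}"

definition Lp_norm :: "'w measure \<Rightarrow> nat \<Rightarrow> ('w \<Rightarrow> real) \<Rightarrow> real" where
  "Lp_norm M p f = root p (integral\<^sup>L M (\<lambda>\<omega>. \<bar>f \<omega>\<bar> ^ p))"

text \<open>Membership in \<open>L\<^sub>p\<close> has to be required explicitly, since the integral of a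
  non-integrable function is \<open>0\<close> by convention.\<close>

definition Lp_limit ::
  "'w measure \<Rightarrow> nat \<Rightarrow> ('i \<Rightarrow> 'w \<Rightarrow> real) \<Rightarrow> ('w \<Rightarrow> real) \<Rightarrow> 'i filter \<Rightarrow> bool" where
  "Lp_limit M p X T F \<longleftrightarrow>
     T \<in> Lp_functions M p \<and>
     eventually (\<lambda>i. X i \<in> Lp_functions M p) F \<and>
     ((\<lambda>i. Lp_norm M p (\<lambda>\<omega>. X i \<omega> - T \<omega>)) \<longlongrightarrow> 0) F"

definition is_self_intersection_local_time ::
  "'w measure \<Rightarrow> nat \<Rightarrow> (real \<Rightarrow> 'w \<Rightarrow> real) \<Rightarrow> nat \<Rightarrow> ('w \<Rightarrow> real) \<Rightarrow> bool" where
  "is_self_intersection_local_time M p x k T \<longleftrightarrow>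
     Lp_limit M p (approx_self_intersection_local_time x k) T (at_right 0)"

end

theory Submission
  imports Defs
begin

text \<open>
  Let \<open>e t\<close> denote the indicator of \<open>[0;t]\<close> in \<open>L\<^sub>2([0;1])\<close>. Writing every heat kernel as a Fourier integral turns the
  approximation \<open>T\<^sub>\<epsilon>\<close> into an integral over times \<open>t\<close> and frequencies \<open>u\<close> of \<open>exp (- \<epsilon> \<bar>u\<bar>\<^sup>2 / 2)\<close> times
  \<open>exp (i (A g, \<xi>))\<close>, where \<open>g = (\<Sum>i. u\<^sub>i (e t\<^sub>i\<^sub>+\<^sub>1 - e t\<^sub>i))\<close>. A moment of order \<open>p\<close> of \<open>T\<^sub>\<epsilon> - T\<^sub>\<delta>\<close> is therefore an integral over \<open>p\<close>
  copies of times and frequencies, whose integrand is \<open>exp (- (norm (A (g\<^sub>1 + \<dots> + g\<^sub>p)))\<^sup>2 / 2)\<close> times differences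
  of Gaussian weights. These differences are bounded and tend to \<open>0\<close> pointwise. So all even moments of \<open>T\<^sub>\<epsilon> - T\<^sub>\<delta>\<close> tend
  to \<open>0\<close>, by dominated convergence, as soon as \<open>exp (- (norm (A (g\<^sub>1 + \<dots> + g\<^sub>p)))\<^sup>2 / 2)\<close> is integrable over \<open>p\<close>
  copies (\<open>nn_integral_operator_paths_finite\<close>), and the limit exists by completeness
  (\<open>Lp_limit_of_cauchy_moments\<close>). Working with frequencies avoids determinants of covariance matrices.

  The sum \<open>v\<close> of the \<open>g\<^sub>j\<close> is a step function with a bounded number of jumps at varying places, so that a lower
  bound for \<open>norm (A v)\<close> is needed that is uniform in these places. Away from the kernel \<open>A\<close> is bounded below, and
  the kernel is finite-dimensional, but \<open>v\<close> may come close to it. A function that is not a step has positive distance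
  from all steps with \<open>N\<close> jumps: it fails to be constant on \<open>N + 1\<close> disjoint intervals, and a step with \<open>N\<close> jumps is
  constant on one of them. By compactness of spheres this distance is uniform on the unit vectors of the kernel that are
  orthogonal to all steps in the kernel. Only the steps in the kernel can thus be approached, and their jumps lie in one finite set \<open>R\<close>. The result
  (\<open>operator_bounded_below_modulo_steps\<close>) is that \<open>norm (A v)\<close> dominates a constant times the distance of \<open>v\<close> from the
  steps on \<open>R\<close>. In probabilistic terms, the process is as nondegenerate as independent Brownian bridges between
  the points of \<open>R\<close>.

  For the bridges the integral is computed one variable at a time. If \<open>W\<close> is the grid of points treated so far and \<open>t\<close> a
  new time in the gap \<open>(p;q)\<close> of \<open>W\<close>, the integral over the corresponding frequency costs at most a constant times
  \<open>1 / sqrt (t - p) + 1 / sqrt (q - t)\<close> and adds \<open>t\<close> to the grid (\<open>nn_integral_gauss_dist_step\<close>). These singularities are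
  integrable in \<open>t\<close>, with a bound that depends only on the size of the grid, so the integration can be
  iterated over all increments of a path and over all paths.
\<close>

section \<open>Finite-dimensional subspaces of an inner product space\<close>

text \<open>
  Gram--Schmidt by one vector: a new spanning vector \<open>b\<close> is replaced by its component \<open>n\<close> orthogonal to the
  others, and the projection of \<open>v\<close> gains its component along \<open>n\<close>.
\<close>

lemma orthogonal_projection_exists:
  fixes B :: "'a::real_inner set"
  assumes "finite B"
  shows "\<exists>f\<in>span B. \<forall>g\<in>span B. inner (v - f) g = 0"
  using assms
proof (induction B arbitrary: v rule: finite_induct)
  case empty
  then show ?case by auto
next
  case (insert b B)
  obtain p where p: "p \<in> span B" "\<forall>g\<in>span B. inner (b - p) g = 0"
    using insert.IH[of b] by blast
  obtain q where q: "q \<in> span B" "\<forall>g\<in>span B. inner (v - q) g = 0"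
    using insert.IH[of v] by blast
  define n where "n = b - p"
  define f where "f = q + (inner v n / inner n n) *\<^sub>R n"
  have sub: "span B \<subseteq> span (insert b B)" by (simp add: span_mono subset_insertI)
  have n_in: "n \<in> span (insert b B)"
    unfolding n_def by (intro span_diff span_base insertI1 subsetD[OF sub] p(1))
  have orth_n: "inner n g = 0" if "g \<in> span B" for g using p(2) that n_def by auto
  show ?case
  proof (intro bexI ballI)
    show "f \<in> span (insert b B)"
      unfolding f_def by (intro span_add span_scale n_in subsetD[OF sub] q(1))
    fix g assume "g \<in> span (insert b B)"
    then obtain r where r: "g - r *\<^sub>R b \<in> span B" by (auto simp: span_insert)
    define h where "h = g - r *\<^sub>R b + r *\<^sub>R p"
    have h: "h \<in> span B" unfolding h_def by (intro span_add span_scale r p(1))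
    have g: "g = h + r *\<^sub>R n" by (simp add: h_def n_def algebra_simps)
    have 1: "inner (v - q) h = 0" using q(2) h by auto
    have 2: "inner n h = 0" "inner q n = 0" using orth_n[OF h] orth_n[OF q(1)] by (simp_all add: inner_commute)
    have "inner (v - f) n = 0"
      by (cases "n = 0") (auto simp: f_def inner_diff_left inner_add_left 2)
    moreover have "inner (v - f) h = 0"
      using 1 2 by (simp add: f_def inner_diff_left inner_add_left)
    ultimately show "inner (v - f) g = 0"
      by (simp add: g inner_add_right)
  qed
qed

text \<open>
  Induction on the spanning set. The last vector is replaced by its component \<open>n\<close> orthogonal to the
  span of the others; by Pythagoras the coefficient of \<open>n\<close> and the remaining part are both bounded, so
  the ball lies in the image of a compact product.
\<close>

lemma compact_span_Int_cball:
  fixes B :: "'a::real_inner set"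
  assumes "finite B"
  shows "compact (span B \<inter> cball 0 r)"
  using assms
proof (induction B rule: finite_induct)
  case empty
  have "finite (span {} \<inter> cball (0::'a) r)" by simp
  then show ?case by (rule finite_imp_compact)
next
  case (insert b B)
  obtain p where p: "p \<in> span B" "\<forall>g\<in>span B. inner (b - p) g = 0"
    using orthogonal_projection_exists[OF insert.hyps(1)] by blast
  define n where "n = b - p"
  have orth_n: "inner n g = 0" if "g \<in> span B" for g using p(2) that n_def by auto
  have sub: "span B \<subseteq> span (insert b B)" by (simp add: span_mono subset_insertI)
  have n_in: "n \<in> span (insert b B)"
    unfolding n_def by (intro span_diff span_base insertI1 subsetD[OF sub] p(1))
  let ?F = "\<lambda>(h, s). h + s *\<^sub>R n"
  let ?I = "?F ` ((span B \<inter> cball 0 r) \<times> {-r / norm n..r / norm n})"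
  have c: "compact (?I \<inter> cball 0 r)"
    unfolding case_prod_unfold
    by (intro compact_Int_closed compact_continuous_image compact_Times insert.IH continuous_intros
        compact_Icc closed_cball)
  have "span (insert b B) \<inter> cball 0 r = ?I \<inter> cball 0 r"
  proof (intro equalityI subsetI IntI; elim IntE)
    fix g assume g1: "g \<in> span (insert b B)" and g2: "g \<in> cball 0 r"
    obtain s where s: "g - s *\<^sub>R b \<in> span B" using g1 by (auto simp: span_insert)
    define h where "h = g - s *\<^sub>R b + s *\<^sub>R p"
    have h: "h \<in> span B" unfolding h_def by (intro span_add span_scale s p(1))
    have g: "g = h + s *\<^sub>R n" by (simp add: h_def n_def algebra_simps)
    have "inner g g = inner h h + s\<^sup>2 * inner n n"
      using orth_n[OF h] by (simp add: g inner_add_left inner_add_right inner_commute power2_eq_square)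
    then have sq: "(norm g)\<^sup>2 = (norm h)\<^sup>2 + (\<bar>s\<bar> * norm n)\<^sup>2"
      by (simp add: power2_norm_eq_inner power_mult_distrib)
    have gr: "norm g \<le> r" using g2 by simp
    have "norm h \<le> norm g" by (rule power2_le_imp_le) (use sq in simp_all)
    moreover have "\<bar>s\<bar> * norm n \<le> norm g" by (rule power2_le_imp_le) (use sq in simp_all)
    ultimately have hr: "norm h \<le> r" and sr: "\<bar>s\<bar> * norm n \<le> r" using gr by auto
    show "g \<in> ?I"
    proof (cases "n = 0")
      case True
      then have "g = ?F (h, 0)" using g by simp
      then show ?thesis using h hr True by (intro image_eqI[of _ _ "(h, 0)"]) auto
    next
      case False
      then have "\<bar>s\<bar> \<le> r / norm n" using sr by (simp add: field_simps)
      then show ?thesis using h hr g by (intro image_eqI[of _ _ "(h, s)"]) auto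
    qed
  next
    fix g assume "g \<in> ?I"
    then obtain h s where "h \<in> span B" and g: "g = h + s *\<^sub>R n" by auto
    then have "h \<in> span (insert b B)" using sub by auto
    then show "g \<in> span (insert b B)" unfolding g using n_in by (intro span_add span_scale)
  qed
  then show ?case using c by simp
qed

lemma subspace_of_finite_span:
  fixes V :: "'a::real_vector set"
  assumes "subspace V" "finite B" "V \<subseteq> span B"
  obtains C where "finite C" "span C = V"
proof -
  obtain C where C: "C \<subseteq> V" "independent C" "V \<subseteq> span C"
    using maximal_independent_subset by blast
  have "finite C" using independent_span_bound[of B C] C assms by auto
  moreover have "span C = V" using C assms(1) by (simp add: span_minimal subset_antisym)
  ultimately show ?thesis using that by blast
qed

section \<open>Step functions and bumps in \<open>L\<^sub>2([0;1])\<close>\<close>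

lemma inner_L2_indicator:
  assumes "s \<in> {0..1}" "t \<in> {0..1}"
  shows "inner (L2_indicator s) (L2_indicator t) = min s t"
proof -
  have "integral\<^sup>L (lebesgue_on {0..1}) (\<lambda>x. indicat_real {0..s} x * indicat_real {0..t} x)
      = integral\<^sup>L (lebesgue_on {0..1}) (indicat_real {0..min s t})"
    by (intro Bochner_Integration.integral_cong) (auto simp: indicator_def)
  also have "\<dots> = measure lebesgue {0..min s t}"
    using assms by (simp add: measure_restrict_space min_def)
  also have "\<dots> = min s t" using assms by simp
  finally show ?thesis by (transfer fixing: s t)
qed

text \<open>
  The indicators of \<open>[0;t]\<close> are total: if all of them are orthogonal to \<open>f\<close>, the integral of \<open>f\<close> over every
  short interval vanishes, and \<open>f\<close> is zero almost everywhere by Lebesgue differentiation.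
\<close>

lemma L2_unit_eq_0I:
  assumes "\<And>t. t \<in> {0..1} \<Longrightarrow> inner f (L2_indicator t) = 0"
  shows "f = 0"
  using assms
proof transfer
  fix f :: "real \<Rightarrow> real"
  assume rel: "L2_unit_rel f f"
    and z: "\<And>t. t \<in> {0..1} \<Longrightarrow> integral\<^sup>L (lebesgue_on {0..1}) (\<lambda>x. f x * indicat_real {0..t} x) = 0"
  have sq1: "square_integrable_on_unit (\<lambda>_. c)" for c
    by (rule square_integrable_on_unit_bounded[where B = "\<bar>c\<bar>"]) auto
  have int: "integrable (lebesgue_on {0..1}) f"
    using square_integrable_on_unit_mult[OF _ sq1, of f 1] rel by (simp add: L2_unit_rel_def)
  define F where "F x = (if x \<in> {0..1} then f x else 0)" for x
  have F: "F absolutely_integrable_on UNIV"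
    using int unfolding F_def absolutely_integrable_restrict_UNIV
    by (simp add: set_integrable_def integrable_restrict_space)
  then have FI: "F integrable_on S" if "S \<in> sets lebesgue" for S
    using that set_integrable_subset[of lebesgue UNIV F S] set_lebesgue_integral_eq_integral(1) by auto
  have z': "integral {0..t} F = 0" if "t \<in> {0..1}" for t
  proof -
    have "integral {0..t} F = set_lebesgue_integral lebesgue {0..t} F"
      using set_integrable_subset[OF F, of "{0..t}"] by (simp add: set_lebesgue_integral_eq_integral(2))
    also have "\<dots> = integral\<^sup>L lebesgue (\<lambda>x. indicator {0..1} x *\<^sub>R (f x * indicat_real {0..t} x))"
      unfolding set_lebesgue_integral_def using that
      by (intro Bochner_Integration.integral_cong) (auto simp: F_def indicator_def)
    also have "\<dots> = integral\<^sup>L (lebesgue_on {0..1}) (\<lambda>x. f x * indicat_real {0..t} x)"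
      by (simp add: integral_restrict_space)
    finally show ?thesis using z that by simp
  qed
  obtain N where N: "negligible N"
    and diff: "\<And>x e. \<lbrakk>x \<notin> N; 0 < e\<rbrakk> \<Longrightarrow> \<exists>d>0. \<forall>h. 0 < h \<and> h < d \<longrightarrow>
                norm (integral (cbox x (x + h *\<^sub>R One)) F /\<^sub>R h ^ DIM(real) - F x) < e"
    using integrable_ccontinuous_explicit[of F] FI by auto
  have "f x = 0" if "x \<in> {0..1}" "x \<notin> insert 1 N" for x
  proof (rule ccontr)
    assume "f x \<noteq> 0"
    moreover have x: "x \<in> {0..1}" "x \<notin> N" "x \<noteq> 1" using that by auto
    ultimately obtain d where d: "d > 0" and dd: "\<And>h. 0 < h \<and> h < d \<Longrightarrow>
        norm (integral {x..x + h} F / h - F x) < \<bar>f x\<bar>"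
      using diff[of x "\<bar>f x\<bar>"] by (auto simp: divide_inverse mult.commute)
    \<comment> \<open>The interval \<open>[x;x+h]\<close> must stay inside \<open>[0;1]\<close>, which excludes \<open>x = 1\<close>.\<close>
    define h where "h = min (d/2) (1 - x)"
    have h: "0 < h" "h < d" "x + h \<le> 1" using that d by (auto simp: h_def)
    have "integral {0..x} F + integral {x..x+h} F = integral {0..x+h} F"
      using that h FI by (intro Henstock_Kurzweil_Integration.integral_combine) auto
    then have "integral {x..x+h} F = 0" using z' that h by auto
    then show False using dd[of h] h that by (simp add: F_def)
  qed
  then have sub: "{x \<in> space (lebesgue_on {0..1}). \<not> f x = 0} \<subseteq> insert 1 N \<inter> {0..1}" by auto
  have neg: "negligible (insert 1 N \<inter> {0..1})" using N by (simp add: negligible_Int)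
  have "AE x in lebesgue_on {0..1}. f x = 0"
    using neg by (intro AE_I'[OF _ sub])
      (auto simp: null_sets_restrict_space negligible_iff_null_sets)
  then show "L2_unit_rel f (\<lambda>_. 0)"
    using rel sq1[of 0] by (simp add: L2_unit_rel_def)
qed

lemma norm_L2_indicator_diff:
  assumes "s \<in> {0..1}" "t \<in> {0..1}"
  shows "(norm (L2_indicator s - L2_indicator t))\<^sup>2 = \<bar>s - t\<bar>"
  using assms
  by (simp add: power2_norm_eq_inner inner_diff_left inner_diff_right inner_L2_indicator min_def)

lemma continuous_on_L2_indicator: "continuous_on {0..1} L2_indicator"
  unfolding continuous_on_iff
proof (intro ballI allI impI)
  fix x e :: real assume x: "x \<in> {0..1}" and e: "0 < e"
  show "\<exists>d>0. \<forall>x'\<in>{0..1}. dist x' x < d \<longrightarrow> dist (L2_indicator x') (L2_indicator x) < e"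
  proof (intro exI[of _ "e\<^sup>2"] conjI ballI impI)
    fix y assume y: "y \<in> {0..1}" "dist y x < e\<^sup>2"
    then have "(norm (L2_indicator y - L2_indicator x))\<^sup>2 < e\<^sup>2"
      using norm_L2_indicator_diff[OF y(1) x] by (simp add: dist_real_def)
    then show "dist (L2_indicator y) (L2_indicator x) < e"
      unfolding dist_norm using e by (simp add: power2_less_imp_less)
  qed (use e in simp)
qed

abbreviation step_span :: "real set \<Rightarrow> L2_unit set" where
  "step_span W \<equiv> span (L2_indicator ` W)"

text \<open>
  The step function with value \<open>b - t\<close> on \<open>(a;t]\<close> and \<open>-(t - a)\<close> on \<open>(t;b]\<close>. It has mean zero on \<open>[a;b]\<close>, so it is
  orthogonal to everything that is constant there. For the primitive \<open>F\<close> of \<open>f\<close>, the product \<open>(f, bump a t b)\<close>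
  measures by how much the three points of \<open>F\<close> over \<open>a < t < b\<close> fail to be collinear.
\<close>

definition bump :: "real \<Rightarrow> real \<Rightarrow> real \<Rightarrow> L2_unit" where
  "bump a t b = (b - t) *\<^sub>R (L2_indicator t - L2_indicator a)
     - (t - a) *\<^sub>R (L2_indicator b - L2_indicator t)"

lemma inner_bump:
  "inner f (bump a t b) = (b - t) * (inner f (L2_indicator t) - inner f (L2_indicator a))
     - (t - a) * (inner f (L2_indicator b) - inner f (L2_indicator t))"
  by (simp add: bump_def inner_diff_right)

lemma inner_bump_L2_indicator:
  assumes "0 \<le> a" "a < t" "t < b" "b \<le> 1" "w \<in> {0..1}" "w \<notin> {a<..<b}"
  shows "inner (L2_indicator w) (bump a t b) = 0"
proof -
  have "w \<le> a \<or> b \<le> w" using assms by auto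
  then show ?thesis using assms by (auto simp: inner_bump inner_L2_indicator min_def)
qed

lemma inner_bump_step_span:
  assumes "0 \<le> a" "a < t" "t < b" "b \<le> 1" "W \<subseteq> {0..1}" "W \<inter> {a<..<b} = {}" "g \<in> step_span W"
  shows "inner g (bump a t b) = 0"
  using assms(7)
proof (induction g rule: span_induct)
  case base
  show ?case by (simp add: subspace_def inner_add_left)
next
  case (step x)
  then obtain w where "w \<in> W" "x = L2_indicator w" by auto
  moreover have "w \<in> {0..1}" "w \<notin> {a<..<b}" using calculation assms(5,6) by auto
  ultimately show ?case using assms(1-4) by (simp add: inner_bump_L2_indicator)
qed

lemma inner_peak_bump:
  assumes "0 \<le> a" "a < t" "t < b" "b \<le> 1"
  shows "inner (L2_indicator t) (bump a t b) = (b - t) * (t - a)"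
  using assms by (simp add: inner_bump inner_L2_indicator min_def)

lemma norm_bump:
  assumes "0 \<le> a" "a < t" "t < b" "b \<le> 1"
  shows "(norm (bump a t b))\<^sup>2 = (b - t) * (t - a) * (b - a)"
proof -
  have "(norm (bump a t b))\<^sup>2 = inner (bump a t b) (bump a t b)" by (simp add: power2_norm_eq_inner)
  also have "\<dots> = (b - a) * inner (L2_indicator t) (bump a t b)"
    apply (subst (1) bump_def)
    using assms inner_bump_L2_indicator[of a t b a] inner_bump_L2_indicator[of a t b b]
    by (simp add: inner_diff_left algebra_simps)
  finally show ?thesis using assms by (simp add: inner_peak_bump)
qed

section \<open>Functions that are not steps stay away from steps\<close>

lemma norm_bump_le_1:
  assumes "0 \<le> a" "a < t" "t < b" "b \<le> 1"
  shows "norm (bump a t b) \<le> 1"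
proof (rule power2_le_imp_le)
  have l: "0 \<le> b - t" "b - t \<le> 1" "0 \<le> t - a" "t - a \<le> 1" "0 \<le> b - a" "b - a \<le> 1"
    using assms by linarith+
  have "(b - t) * (t - a) * (b - a) \<le> 1 * 1 * 1"
    by (rule mult_mono[OF mult_mono[OF l(2) l(4)] l(6)]) (use l in simp_all)
  then show "(norm (bump a t b))\<^sup>2 \<le> 1\<^sup>2"
    using norm_bump[of a t b] assms by simp
qed simp

text \<open>
  There are \<open>n\<close> non-overlapping intervals in \<open>[a;b]\<close>, listed from left to right, on each of which some bump
  detects that \<open>f\<close> is not constant.
\<close>

primrec kinks :: "L2_unit \<Rightarrow> nat \<Rightarrow> real \<Rightarrow> real \<Rightarrow> bool" where
  "kinks f 0 a b \<longleftrightarrow> a \<le> b"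
| "kinks f (Suc n) a b \<longleftrightarrow>
     (\<exists>x t y. a \<le> x \<and> x < t \<and> t < y \<and> y \<le> b \<and> inner f (bump x t y) \<noteq> 0 \<and> kinks f n y b)"

lemma kinks_mono: "kinks f n a b \<Longrightarrow> a' \<le> a \<Longrightarrow> kinks f n a' b"
  by (cases n) (auto intro: order_trans)

definition kink_free :: "L2_unit \<Rightarrow> real \<Rightarrow> real \<Rightarrow> bool" where
  "kink_free f a b \<longleftrightarrow>
     (\<forall>x t y. a \<le> x \<longrightarrow> x < t \<longrightarrow> t < y \<longrightarrow> y \<le> b \<longrightarrow> inner f (bump x t y) = 0)"

text \<open>
  \<open>f\<close> coincides on \<open>[a;b]\<close> with a step function. This is expressed through the primitive: some step function \<open>g\<close>
  has as its primitive the increment of the primitive of \<open>f\<close> after \<open>a\<close>, frozen outside \<open>[a;b]\<close>.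
\<close>

definition step_like :: "L2_unit \<Rightarrow> real \<Rightarrow> real \<Rightarrow> bool" where
  "step_like f a b \<longleftrightarrow> (\<exists>W g. finite W \<and> W \<subseteq> {0..1} \<and> g \<in> step_span W \<and>
     (\<forall>s\<in>{0..1}. inner g (L2_indicator s) =
        inner f (L2_indicator (max a (min s b))) - inner f (L2_indicator a)))"

lemma step_like_trans:
  assumes "step_like f a c" "step_like f c b" "a \<le> c" "c \<le> b"
  shows "step_like f a b"
proof -
  obtain W g where W: "finite W" "W \<subseteq> {0..1}" "g \<in> step_span W"
    and g: "\<And>s. s \<in> {0..1} \<Longrightarrow> inner g (L2_indicator s) =
        inner f (L2_indicator (max a (min s c))) - inner f (L2_indicator a)"
    using assms(1) unfolding step_like_def by blast
  obtain V h where V: "finite V" "V \<subseteq> {0..1}" "h \<in> step_span V"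
    and h: "\<And>s. s \<in> {0..1} \<Longrightarrow> inner h (L2_indicator s) =
        inner f (L2_indicator (max c (min s b))) - inner f (L2_indicator c)"
    using assms(2) unfolding step_like_def by blast
  show ?thesis unfolding step_like_def
  proof (intro exI[of _ "W \<union> V"] exI[of _ "g + h"] conjI ballI)
    show "g + h \<in> step_span (W \<union> V)"
      using W(3) V(3) span_mono[of "L2_indicator ` W" "L2_indicator ` (W \<union> V)"]
        span_mono[of "L2_indicator ` V" "L2_indicator ` (W \<union> V)"] by (intro span_add) auto
    fix s :: real assume s: "s \<in> {0..1}"
    show "inner (g + h) (L2_indicator s) =
        inner f (L2_indicator (max a (min s b))) - inner f (L2_indicator a)"
    proof (cases "s \<le> c")
      case True
      then have "max c (min s b) = c" "max a (min s b) = max a (min s c)" using assms by auto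
      then show ?thesis by (simp add: inner_add_left g[OF s] h[OF s])
    next
      case False
      then have "max a (min s c) = c" "max a (min s b) = max c (min s b)" using assms by auto
      then show ?thesis by (simp add: inner_add_left g[OF s] h[OF s])
    qed
  qed (use W V in auto)
qed

lemma kink_free_imp_step_like:
  assumes "kink_free f a b" "0 \<le> a" "a \<le> b" "b \<le> 1"
  shows "step_like f a b"
proof -
  define F where "F s = inner f (L2_indicator s)" for s
  define m where "m = (F b - F a) / (b - a)"
  have lin: "F r - F a = m * (r - a)" if "a \<le> r" "r \<le> b" for r
  proof (cases "a < r \<and> r < b")
    case True
    then have "inner f (bump a r b) = 0" using assms(1) by (auto simp: kink_free_def)
    then have "(b - r) * (F r - F a) = (r - a) * (F b - F r)" by (simp add: inner_bump F_def)
    then have "(b - a) * (F r - F a) = (F b - F a) * (r - a)" by algebra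
    then show ?thesis using True by (simp add: m_def field_simps)
  next
    case False
    then have "r = a \<or> (r = b \<and> a < b)" using that by auto
    then show ?thesis by (auto simp: m_def)
  qed
  show ?thesis unfolding step_like_def
  proof (intro exI[of _ "{a, b}"] exI[of _ "m *\<^sub>R (L2_indicator b - L2_indicator a)"] conjI ballI)
    show "m *\<^sub>R (L2_indicator b - L2_indicator a) \<in> step_span {a, b}"
      by (intro span_scale span_diff span_base) auto
    fix s :: real assume s: "s \<in> {0..1}"
    have "inner (m *\<^sub>R (L2_indicator b - L2_indicator a)) (L2_indicator s) = m * (max a (min s b) - a)"
      using s assms by (simp add: inner_diff_left inner_L2_indicator min_def max_def)
    then show "inner (m *\<^sub>R (L2_indicator b - L2_indicator a)) (L2_indicator s) =
        inner f (L2_indicator (max a (min s b))) - inner f (L2_indicator a)"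
      using lin[of "max a (min s b)"] assms by (simp add: F_def)
  qed (use assms in auto)
qed

text \<open>
  A kink can be moved slightly to the right of a prescribed point, because the product with the bump is
  continuous in the end points of the bump. The next lemma is the mirror image.
\<close>

lemma bump_perturb_left:
  assumes "0 \<le> x" "x < t" "t < y" "y \<le> 1" "inner f (bump x t y) \<noteq> 0"
  obtains x' where "x < x'" "x' < t" "inner f (bump x' t y) \<noteq> 0"
proof -
  have "continuous_on {0..1} (\<lambda>z. inner f (bump z t y))"
    unfolding inner_bump by (intro continuous_intros continuous_on_L2_indicator)
  then obtain d where d: "d > 0" "\<And>z. z \<in> {0..1} \<Longrightarrow> dist x z < d \<Longrightarrow> inner f (bump z t y) \<noteq> 0"
    using continuous_on_avoid[of "{0..1}" "\<lambda>z. inner f (bump z t y)" x 0] assms by force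
  define z where "z = x + min (d/2) ((t - x) / 2)"
  have "x < z" "z < t" "dist x z < d" using d assms by (auto simp: z_def dist_real_def min_def field_simps)
  then show ?thesis using that[of z] d(2)[of z] assms by auto
qed

lemma bump_perturb_right:
  assumes "0 \<le> x" "x < t" "t < y" "y \<le> 1" "inner f (bump x t y) \<noteq> 0"
  obtains y' where "t < y'" "y' < y" "inner f (bump x t y') \<noteq> 0"
proof -
  have "continuous_on {0..1} (\<lambda>z. inner f (bump x t z))"
    unfolding inner_bump by (intro continuous_intros continuous_on_L2_indicator)
  then obtain d where d: "d > 0" "\<And>z. z \<in> {0..1} \<Longrightarrow> dist y z < d \<Longrightarrow> inner f (bump x t z) \<noteq> 0"
    using continuous_on_avoid[of "{0..1}" "\<lambda>z. inner f (bump x t z)" y 0] assms by force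
  define z where "z = y - min (d/2) ((y - t) / 2)"
  have "t < z" "z < y" "dist y z < d" using d assms by (auto simp: z_def dist_real_def min_def field_simps)
  then show ?thesis using that[of z] d(2)[of z] assms by auto
qed

text \<open>
  Induction on the number of kinks. Let \<open>[a;c]\<close> be the longest initial interval without kinks. Kinks cannot
  accumulate at \<open>c\<close> from the right, since otherwise they could be moved apart and arbitrarily many would fit
  into \<open>[a;b]\<close>. Hence some \<open>[c;h]\<close> is free of kinks too, while \<open>[a;h]\<close> uses up one kink, and the
  induction hypothesis applies to \<open>[h;b]\<close>.
\<close>

lemma not_kinks_imp_step_like:
  assumes "0 \<le> a" "a \<le> b" "b \<le> 1" "\<not> kinks f n a b"
  shows "step_like f a b"
  using assms
proof (induction n arbitrary: a)
  case 0
  then show ?case by simp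
next
  case (Suc n)
  show ?case
  proof (cases "kink_free f a b")
    case True
    then show ?thesis using kink_free_imp_step_like Suc.prems by blast
  next
    case False
    define S where "S = {s\<in>{a..b}. kink_free f a s}"
    define c where "c = Sup S"
    have aS: "a \<in> S" using Suc.prems by (auto simp: S_def kink_free_def)
    have bdd: "bdd_above S" by (auto simp: S_def intro!: bdd_aboveI[of _ b])
    have c: "a \<le> c" "c \<le> b"
      using aS bdd unfolding c_def by (auto intro: cSup_upper intro!: cSup_least simp: S_def)
    have free_lt: "kink_free f a s" if "s < c" for s
      using less_cSupD[of S s] that aS unfolding c_def by (force simp: S_def kink_free_def)
    have free_c: "kink_free f a c"
      unfolding kink_free_def
    proof (intro allI impI, rule ccontr)
      fix x t y assume *: "a \<le> x" "x < t" "t < y" "y \<le> c" "inner f (bump x t y) \<noteq> 0"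
      then obtain y' where "t < y'" "y' < y" "inner f (bump x t y') \<noteq> 0"
        using bump_perturb_right[of x t y f] Suc.prems c by (metis order_trans)
      then show False using free_lt[of y'] * by (auto simp: kink_free_def)
    qed
    have "c < b" using free_c False c by (cases "c = b") auto
    have not_free: "\<not> kink_free f a s" if "c < s" "s \<le> b" for s
      using cSup_upper[of s S] that c bdd unfolding c_def[symmetric] by (force simp: S_def)
    have "\<exists>h. c < h \<and> h \<le> b \<and> kink_free f c h"
    proof (rule ccontr)
      assume no: "\<nexists>h. c < h \<and> h \<le> b \<and> kink_free f c h"
      \<comment> \<open>If kinks accumulate at \<open>c\<close>, each one can be placed to the left of those already found.\<close>
      have "\<exists>s. c < s \<and> s \<le> b \<and> kinks f m s b" for m
      proof (induction m)
        case 0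
        then show ?case using \<open>c < b\<close> by auto
      next
        case (Suc m)
        then obtain s where s: "c < s" "s \<le> b" "kinks f m s b" by auto
        then obtain x t y where *: "c \<le> x" "x < t" "t < y" "y \<le> s" "inner f (bump x t y) \<noteq> 0"
          using no unfolding kink_free_def by blast
        then obtain x' where x': "x < x'" "x' < t" "inner f (bump x' t y) \<noteq> 0"
          using bump_perturb_left[of x t y f] Suc.prems c s \<open>0 \<le> a\<close> \<open>b \<le> 1\<close> by (metis order_trans)
        have "kinks f (Suc m) x' b"
          using x' * s kinks_mono[OF s(3) *(4)]
          unfolding kinks.simps by (intro exI[of _ x'] exI[of _ t] exI[of _ y]) auto
        then show ?case using x' * s by (intro exI[of _ x']) auto
      qed
      then obtain s where "c < s" "kinks f (Suc n) s b" by blast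
      then show False using kinks_mono[of f "Suc n" s b a] Suc.prems c by auto
    qed
    then obtain h where h: "c < h" "h \<le> b" "kink_free f c h" by auto
    have "\<not> kinks f n h b"
    proof
      assume k: "kinks f n h b"
      obtain x t y where *: "a \<le> x" "x < t" "t < y" "y \<le> h" "inner f (bump x t y) \<noteq> 0"
        using not_free[OF h(1,2)] unfolding kink_free_def by blast
      then have "kinks f (Suc n) a b"
        using kinks_mono[OF k *(4)] h unfolding kinks.simps by (meson order_trans)
      then show False using Suc.prems by auto
    qed
    then have "step_like f h b" using Suc.IH[of h] Suc.prems h c by auto
    moreover have "step_like f a c" "step_like f c h"
      using kink_free_imp_step_like free_c h c Suc.prems by auto
    ultimately show ?thesis using step_like_trans c h by (meson order_trans less_imp_le)
  qed
qed

definition step_functions :: "L2_unit set" where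
  "step_functions = (\<Union>W\<in>{W. finite W \<and> W \<subseteq> {0..1}}. step_span W)"

lemma not_step_imp_kinks:
  assumes "f \<notin> step_functions"
  shows "kinks f n 0 1"
proof (rule ccontr)
  assume "\<not> kinks f n 0 1"
  then have "step_like f 0 1" using not_kinks_imp_step_like[of 0 1] by simp
  then obtain W g where W: "finite W" "W \<subseteq> {0..1}" "g \<in> step_span W"
    and g: "\<And>s. s \<in> {0..1} \<Longrightarrow> inner g (L2_indicator s) =
        inner f (L2_indicator (max 0 (min s 1))) - inner f (L2_indicator 0)"
    unfolding step_like_def by blast
  have "inner (L2_indicator 0) (L2_indicator 0) = 0" by (simp add: inner_L2_indicator)
  then have e0: "L2_indicator 0 = 0" by simp
  have "f - g = 0"
  proof (rule L2_unit_eq_0I)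
    fix t :: real assume t: "t \<in> {0..1}"
    then have "max 0 (min t 1) = t" by auto
    then show "inner (f - g) (L2_indicator t) = 0" using g[OF t] by (simp add: inner_diff_left e0)
  qed
  then show False using assms W by (auto simp: step_functions_def)
qed

text \<open>
  Pigeonhole: a step function with fewer than \<open>n\<close> jumps has no jump inside one of the \<open>n\<close> intervals. It is then
  orthogonal to the bump on that interval and differs from \<open>f\<close> at least by the product of \<open>f\<close> with the bump.
\<close>

lemma kinks_separated:
  assumes "kinks f n a b" "0 \<le> a" "b \<le> 1"
  shows "\<exists>\<delta>>0. \<forall>W g. finite W \<and> W \<subseteq> {0..1} \<and> card (W \<inter> {a<..<b}) < n \<and> g \<in> step_span W
            \<longrightarrow> \<delta> \<le> norm (f - g)"
  using assms
proof (induction n arbitrary: a)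
  case 0
  then show ?case by (auto intro!: exI[of _ 1])
next
  case (Suc n)
  obtain x t y where *: "a \<le> x" "x < t" "t < y" "y \<le> b" "inner f (bump x t y) \<noteq> 0" "kinks f n y b"
    using Suc.prems(1) by auto
  then obtain \<delta> where \<delta>: "\<delta> > 0" "\<And>W g. finite W \<and> W \<subseteq> {0..1} \<and> card (W \<inter> {y<..<b}) < n \<and> g \<in> step_span W
            \<Longrightarrow> \<delta> \<le> norm (f - g)"
    using Suc.IH[of y] Suc.prems by auto
  define \<beta> where "\<beta> = \<bar>inner f (bump x t y)\<bar>"
  show ?case
  proof (intro exI[of _ "min \<delta> \<beta>"] conjI allI impI)
    show "0 < min \<delta> \<beta>" using \<delta> * by (simp add: \<beta>_def)
    fix W g assume W: "finite W \<and> W \<subseteq> {0..1} \<and> card (W \<inter> {a<..<b}) < Suc n \<and> g \<in> step_span W"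
    show "min \<delta> \<beta> \<le> norm (f - g)"
    proof (cases "W \<inter> {x<..<y} = {}")
      case True
      have "inner g (bump x t y) = 0"
        using True W * Suc.prems by (intro inner_bump_step_span) auto
      then have "\<beta> = \<bar>inner (f - g) (bump x t y)\<bar>" by (simp add: \<beta>_def inner_diff_left)
      also have "\<dots> \<le> norm (f - g) * norm (bump x t y)" by (rule Cauchy_Schwarz_ineq2)
      also have "\<dots> \<le> norm (f - g) * 1"
        using norm_bump_le_1[of x t y] * Suc.prems(2,3) by (intro mult_left_mono) auto
      finally show ?thesis by simp
    next
      case False
      then obtain w where w: "w \<in> W" "x < w" "w < y" by auto
      have "W \<inter> {y<..<b} \<subset> W \<inter> {a<..<b}"
      proof
        show "W \<inter> {y<..<b} \<subseteq> W \<inter> {a<..<b}" using * by auto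
        have "w \<in> W \<inter> {a<..<b}" "w \<notin> W \<inter> {y<..<b}" using w * by auto
        then show "W \<inter> {y<..<b} \<noteq> W \<inter> {a<..<b}" by blast
      qed
      then have "card (W \<inter> {y<..<b}) < card (W \<inter> {a<..<b})" using W by (intro psubset_card_mono) auto
      then show ?thesis using \<delta>(2)[of W g] W by auto
    qed
  qed
qed

text \<open>
  The distance to the (non-convex) set of step functions with at most \<open>N\<close> jumps is continuous and, by
  \<open>kinks_separated\<close>, positive at every function that is not a step; a compact set attains the minimum.
\<close>

lemma compact_separated_from_steps:
  assumes "compact Q" "Q \<inter> step_functions = {}"
  shows "\<exists>\<delta>>0. \<forall>f\<in>Q. \<forall>W g. finite W \<longrightarrow> W \<subseteq> {0..1} \<longrightarrow> card W \<le> N \<longrightarrow> g \<in> step_span W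
            \<longrightarrow> \<delta> \<le> norm (f - g)"
proof (cases "Q = {}")
  case False
  define T where "T = (\<Union>W\<in>{W. finite W \<and> W \<subseteq> {0..1} \<and> card W \<le> N}. step_span W)"
  have "0 \<in> T" by (auto simp: T_def intro!: exI[of _ "{}"])
  then have T: "T \<noteq> {}" by auto
  have "continuous_on Q (\<lambda>f. infdist f T)" by (intro continuous_intros)
  then obtain f0 where f0: "f0 \<in> Q" "\<And>f. f \<in> Q \<Longrightarrow> infdist f0 T \<le> infdist f T"
    using continuous_attains_inf[OF assms(1) False] by blast
  have "kinks f0 (Suc N) 0 1" using not_step_imp_kinks f0 assms(2) by blast
  then obtain \<delta> where \<delta>: "\<delta> > 0" "\<And>W g. finite W \<and> W \<subseteq> {0..1} \<and> card (W \<inter> {0<..<1}) < Suc N \<and> g \<in> step_span W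
            \<Longrightarrow> \<delta> \<le> norm (f0 - g)"
    using kinks_separated[of f0 "Suc N" 0 1] by auto
  have "\<delta> \<le> dist f0 g" if g: "g \<in> T" for g
  proof -
    obtain W where W: "finite W" "W \<subseteq> {0..1}" "card W \<le> N" "g \<in> step_span W"
      using g by (auto simp: T_def)
    \<comment> \<open>At most \<open>N\<close> jumps against \<open>N + 1\<close> intervals.\<close>
    have "card (W \<inter> {0<..<1}) \<le> card W" using W by (intro card_mono) auto
    then show ?thesis using \<delta>(2)[of W g] W by (auto simp: dist_norm)
  qed
  then have "\<delta> \<le> infdist f0 T" unfolding infdist_notempty[OF T] using T by (intro cINF_greatest) auto
  moreover have "infdist f T \<le> norm (f - g)"
    if "finite W" "W \<subseteq> {0..1}" "card W \<le> N" "g \<in> step_span W" for f W g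
    using infdist_le[of g T f] that by (auto simp: T_def dist_norm)
  ultimately show ?thesis using \<delta>(1) f0(2) by (meson order_trans)
qed (auto intro: exI[of _ 1])

section \<open>The operator is bounded below modulo finitely many steps\<close>

lemma subspace_step_functions: "subspace step_functions"
  unfolding subspace_def
proof (intro conjI ballI allI)
  show "0 \<in> step_functions"
    unfolding step_functions_def by (intro UN_I[of "{}"]) auto
  fix f g assume "f \<in> step_functions" "g \<in> step_functions"
  then obtain V W where V: "finite V" "V \<subseteq> {0..1}" "f \<in> step_span V"
    and W: "finite W" "W \<subseteq> {0..1}" "g \<in> step_span W"
    unfolding step_functions_def by auto
  have "f \<in> step_span (V \<union> W)" "g \<in> step_span (V \<union> W)"
    using V(3) W(3) span_mono[of "L2_indicator ` V" "L2_indicator ` (V \<union> W)"]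
      span_mono[of "L2_indicator ` W" "L2_indicator ` (V \<union> W)"] by auto
  then have "f + g \<in> step_span (V \<union> W)" by (rule span_add)
  then show "f + g \<in> step_functions"
    unfolding step_functions_def using V W by (intro UN_I[of "V \<union> W"]) auto
next
  fix c :: real and f assume "f \<in> step_functions"
  then show "c *\<^sub>R f \<in> step_functions" unfolding step_functions_def by (auto intro: span_scale)
qed

lemma finite_span_steps:
  assumes "finite C" "C \<subseteq> step_functions"
  obtains R where "finite R" "R \<subseteq> {0..1}" "span C \<subseteq> step_span R"
proof -
  have "\<forall>c\<in>C. \<exists>W. finite W \<and> W \<subseteq> {0..1} \<and> c \<in> step_span W"
    using assms(2) unfolding step_functions_def by auto
  then obtain W where W: "\<And>c. c \<in> C \<Longrightarrow> finite (W c) \<and> W c \<subseteq> {0..1} \<and> c \<in> step_span (W c)"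
    by metis
  show ?thesis
  proof (rule that[of "\<Union>(W ` C)"])
    have "c \<in> step_span (\<Union>(W ` C))" if "c \<in> C" for c
      using W[OF that] that span_mono[of "L2_indicator ` W c" "L2_indicator ` \<Union>(W ` C)"] by auto
    then show "span C \<subseteq> step_span (\<Union>(W ` C))" by (intro span_minimal) auto
  qed (use W assms(1) in auto)
qed

text \<open>
  Subtracting the projection onto the kernel does not change \<open>A v\<close> and moves \<open>v\<close> into the orthogonal
  complement, where \<open>A\<close> has a bounded inverse.
\<close>

lemma kernel_distance_le:
  fixes A :: "'a::real_inner \<Rightarrow> 'b::real_normed_vector"
  assumes "linear A" "finite_dimensional_subspace (op_kernel A)"
    and "continuously_invertible_on (orthogonal_comp (op_kernel A)) A"
  obtains C where "C > 0" "\<And>v. \<exists>f\<in>op_kernel A. norm (v - f) \<le> C * norm (A v)"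
proof -
  obtain B where B: "finite B" "span B = op_kernel A"
    using assms(2) unfolding finite_dimensional_subspace_def by auto
  obtain C where inj: "inj_on A (orthogonal_comp (op_kernel A))"
    and C: "\<And>y. y \<in> A ` orthogonal_comp (op_kernel A) \<Longrightarrow>
       norm (inv_into (orthogonal_comp (op_kernel A)) A y) \<le> C * norm y"
    using assms(3) unfolding continuously_invertible_on_def by auto
  show ?thesis
  proof (rule that[of "max C 1"])
    fix v
    obtain f where f: "f \<in> op_kernel A" "\<forall>g\<in>op_kernel A. inner (v - f) g = 0"
      using orthogonal_projection_exists[OF B(1), of v] B(2) by auto
    have w: "v - f \<in> orthogonal_comp (op_kernel A)"
      using f(2) by (auto simp: orthogonal_comp_def orthogonal_def inner_commute)
    have Aw: "A (v - f) = A v" using f(1) by (simp add: linear_diff[OF assms(1)] op_kernel_def)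
    have "norm (v - f) \<le> C * norm (A v)"
      using C[OF imageI[OF w]] inv_into_f_f[OF inj w] Aw by simp
    also have "\<dots> \<le> max C 1 * norm (A v)" by (intro mult_right_mono) auto
    finally show "\<exists>f\<in>op_kernel A. norm (v - f) \<le> max C 1 * norm (A v)" using f(1) by auto
  qed simp
qed

text \<open>
  The key geometric fact. The kernel may contain step functions; they span a finite-dimensional space and have
  jumps only in a finite set \<open>R\<close>. Kernel elements orthogonal to that space are not steps, so on their unit sphere,
  which is compact, the distance to steps with \<open>N + card R\<close> jumps is at least some \<open>\<delta>\<close>. Hence, for a step function \<open>v\<close>
  with \<open>N\<close> jumps, the part of the kernel without steps can reduce its distance to the kernel only by a constant
  factor, and what is left is comparable to the distance of \<open>v\<close> from the steps on the fixed grid \<open>R\<close>.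
  The set \<open>R\<close> and the constant are independent of where the jumps of \<open>v\<close> are.
\<close>

lemma operator_bounded_below_modulo_steps:
  fixes A :: "L2_unit \<Rightarrow> L2_unit"
  assumes "linear A" "finite_dimensional_subspace (op_kernel A)"
    and "continuously_invertible_on (orthogonal_comp (op_kernel A)) A"
  obtains R \<kappa> where "finite R" "R \<subseteq> {0..1}" "{0, 1} \<subseteq> R" "\<kappa> > 0"
    "\<And>W v. finite W \<Longrightarrow> W \<subseteq> {0..1} \<Longrightarrow> card W \<le> N \<Longrightarrow> v \<in> step_span W \<Longrightarrow>
       \<kappa> * infdist v (step_span R) \<le> norm (A v)"
proof -
  define K where "K = op_kernel A"
  define Ks where "Ks = K \<inter> step_functions"
  obtain B where B: "finite B" "span B = K"
    using assms(2) unfolding finite_dimensional_subspace_def K_def by auto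
  have subK: "subspace K" using B(2) by (metis subspace_span)
  obtain C where C: "C > 0" "\<And>v. \<exists>f\<in>K. norm (v - f) \<le> C * norm (A v)"
    using kernel_distance_le[OF assms] unfolding K_def by blast
  have "subspace Ks" unfolding Ks_def by (intro subspace_inter subK subspace_step_functions)
  then obtain D where D: "finite D" "span D = Ks"
    using subspace_of_finite_span[of Ks B] B unfolding Ks_def by blast
  have "D \<subseteq> step_functions" using span_superset[of D] D(2) by (auto simp: Ks_def)
  then obtain R0 where R0: "finite R0" "R0 \<subseteq> {0..1}" "Ks \<subseteq> step_span R0"
    using finite_span_steps[OF D(1)] D(2) by metis
  define R where "R = {0, 1} \<union> R0"
  have R: "finite R" "R \<subseteq> {0..1}" "{0, 1} \<subseteq> R" using R0 by (auto simp: R_def)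
  have KsR: "Ks \<subseteq> step_span R"
    using R0(3) span_mono[of "L2_indicator ` R0" "L2_indicator ` R"] by (auto simp: R_def)
  define Q where "Q = (span B \<inter> cball 0 1) \<inter> ({f. norm f = 1} \<inter> (\<Inter>g\<in>Ks. {f. inner f g = 0}))"
  have "compact Q" unfolding Q_def
    by (rule compact_Int_closed[OF compact_span_Int_cball[OF B(1)]])
      (intro closed_Int closed_INT ballI closed_Collect_eq continuous_intros)
  moreover have "Q \<inter> step_functions = {}"
  proof (rule ccontr)
    assume "Q \<inter> step_functions \<noteq> {}"
    then obtain f where f: "f \<in> Q" "f \<in> step_functions" by auto
    then have "f \<in> Ks" using B(2) by (auto simp: Q_def Ks_def)
    then have "inner f f = 0" using f(1) unfolding Q_def by blast
    then show False using f(1) by (simp add: Q_def)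
  qed
  ultimately have "\<exists>\<delta>>0. \<forall>f\<in>Q. \<forall>W g. finite W \<longrightarrow> W \<subseteq> {0..1} \<longrightarrow>
      card W \<le> N + card R \<longrightarrow> g \<in> step_span W \<longrightarrow> \<delta> \<le> norm (f - g)"
    by (rule compact_separated_from_steps)
  then obtain \<delta> where \<delta>: "\<delta> > 0" "\<forall>f\<in>Q. \<forall>W g. finite W \<longrightarrow> W \<subseteq> {0..1} \<longrightarrow>
      card W \<le> N + card R \<longrightarrow> g \<in> step_span W \<longrightarrow> \<delta> \<le> norm (f - g)"
    by (elim exE conjE) (rule that)
  have sep: "\<delta> * norm f \<le> norm (f - g)"
    if "f \<in> K" "\<And>h. h \<in> Ks \<Longrightarrow> inner f h = 0" "finite W" "W \<subseteq> {0..1}" "card W \<le> N + card R"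
      "g \<in> step_span W" for f g W
  proof (cases "f = 0")
    case False
    define r where "r = inverse (norm f)"
    have "r *\<^sub>R f \<in> Q" using that(1,2) False subspace_scale[OF subK] B(2)
      by (auto simp: Q_def r_def)
    then have "\<delta> \<le> norm (r *\<^sub>R f - r *\<^sub>R g)"
      using that(3-5) span_scale[OF that(6)] by (intro \<delta>(2)[rule_format, of _ W])
    also have "\<dots> = r * norm (f - g)"
      using False by (simp add: r_def scaleR_diff_right[symmetric] del: scaleR_diff_right)
    finally show ?thesis using False by (simp add: r_def field_simps)
  qed simp
  define \<kappa> where "\<kappa> = 1 / ((1 + 1 / \<delta>) * C)"
  show ?thesis
  proof (rule that[of R \<kappa>])
    show "\<kappa> > 0" using \<delta>(1) C(1) by (simp add: \<kappa>_def add_pos_pos)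
    fix W v assume W: "finite W" "W \<subseteq> {0..1}" "card W \<le> N" "v \<in> step_span W"
    obtain f where f: "f \<in> K" "norm (v - f) \<le> C * norm (A v)" using C(2) by blast
    \<comment> \<open>Split \<open>f\<close> into its step part \<open>fs\<close> and the rest; \<open>v - fs\<close> has at most \<open>N + card R\<close> jumps.\<close>
    obtain fs where fs: "fs \<in> Ks" "\<forall>g\<in>Ks. inner (f - fs) g = 0"
      using orthogonal_projection_exists[OF D(1), of f] D(2) by auto
    have "v \<in> step_span (W \<union> R)" "fs \<in> step_span (W \<union> R)"
      using W(4) fs(1) KsR span_mono[of "L2_indicator ` W" "L2_indicator ` (W \<union> R)"]
        span_mono[of "L2_indicator ` R" "L2_indicator ` (W \<union> R)"] by auto
    then have z: "v - fs \<in> step_span (W \<union> R)" by (rule span_diff)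
    have fn: "f - fs \<in> K" using f(1) fs(1) subK by (auto simp: Ks_def subspace_diff)
    have card: "card (W \<union> R) \<le> N + card R" using W(3) card_Un_le[of W R] by linarith
    have "\<delta> * norm (f - fs) \<le> norm ((f - fs) - (v - fs))"
      by (rule sep[OF fn _ _ _ card z]) (use fs W R in auto)
    also have "\<dots> = norm (v - f)" by (simp add: norm_minus_commute)
    finally have "norm (f - fs) \<le> norm (v - f) / \<delta>" using \<delta>(1) by (simp add: field_simps)
    moreover have "norm (v - fs) \<le> norm (v - f) + norm (f - fs)"
      using norm_triangle_ineq[of "v - f" "f - fs"] by simp
    ultimately have "norm (v - fs) \<le> (1 + 1 / \<delta>) * norm (v - f)" by (simp add: algebra_simps)
    also have "\<dots> \<le> (1 + 1 / \<delta>) * (C * norm (A v))"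
      using f(2) \<delta>(1) by (intro mult_left_mono) auto
    finally have "norm (v - fs) \<le> (1 + 1 / \<delta>) * C * norm (A v)" by (simp add: mult.assoc)
    moreover have "infdist v (step_span R) \<le> norm (v - fs)"
      using infdist_le[of fs "step_span R" v] fs(1) KsR by (auto simp: dist_norm)
    ultimately have "infdist v (step_span R) \<le> (1 + 1 / \<delta>) * C * norm (A v)" by linarith
    moreover have "(1 + 1 / \<delta>) * C > 0" using \<delta>(1) C(1) by (simp add: add_pos_pos)
    ultimately show "\<kappa> * infdist v (step_span R) \<le> norm (A v)"
      unfolding \<kappa>_def by (simp add: pos_divide_le_eq mult.commute)
  qed (use R in auto)
qed

section \<open>Integrating out one increment\<close>

text \<open>
  Pythagoras for one direction \<open>n\<close> orthogonal to \<open>S\<close>: the distance to \<open>S\<close> contains the component along \<open>n\<close> and, after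
  that component is removed, at least the distance to any larger space that contains \<open>n\<close>.
\<close>

lemma infdist_orthogonal_split:
  fixes v :: "'a::real_inner"
  assumes "subspace S'" "S \<subseteq> S'" "S \<noteq> {}" "n \<in> S'" "norm n = 1" "\<And>s. s \<in> S \<Longrightarrow> inner s n = 0" "x \<in> S'"
  shows "(infdist v S')\<^sup>2 + (inner (v + x) n)\<^sup>2 \<le> (infdist (v + x) S)\<^sup>2"
proof -
  let ?r = "sqrt ((infdist v S')\<^sup>2 + (inner (v + x) n)\<^sup>2)"
  have "?r \<le> dist (v + x) s" if s: "s \<in> S" for s
  proof (rule real_le_lsqrt)
    define c where "c = inner (v + x) n"
    have nn: "inner n n = 1" using assms(5) by (simp add: norm_eq_1)
    have zn: "inner (v + x - s) n = c" using assms(6)[OF s] by (simp add: c_def inner_diff_left)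
    have norm_sq: "inner (z - c *\<^sub>R n) (z - c *\<^sub>R n) = inner z z - 2 * c * inner z n + c * c * inner n n"
      for z by (simp add: inner_diff_left inner_diff_right inner_commute algebra_simps)
    have "s - x + c *\<^sub>R n \<in> S'"
      using assms(1,2,4,7) s by (intro subspace_add subspace_diff subspace_scale) auto
    then have "infdist v S' \<le> norm (v - (s - x + c *\<^sub>R n))"
      using infdist_le[of "s - x + c *\<^sub>R n" S' v] by (simp add: dist_norm)
    then have "(infdist v S')\<^sup>2 \<le> (norm (v + x - s - c *\<^sub>R n))\<^sup>2"
      by (intro power_mono) (simp_all add: infdist_nonneg algebra_simps)
    also have "\<dots> = (norm (v + x - s))\<^sup>2 - c\<^sup>2"
      unfolding power2_norm_eq_inner norm_sq zn nn by (simp add: power2_eq_square)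
    finally show "(infdist v S')\<^sup>2 + (inner (v + x) n)\<^sup>2 \<le> (dist (v + x) s)\<^sup>2"
      by (simp add: c_def dist_norm)
  qed auto
  then have "?r \<le> infdist (v + x) S"
    unfolding infdist_notempty[OF assms(3)] using assms(3) by (intro cINF_greatest) auto
  then have "?r\<^sup>2 \<le> (infdist (v + x) S)\<^sup>2" by (intro power_mono) auto
  then show ?thesis by simp
qed

text \<open>
  The value at \<open>0\<close> is infinite, so that bounds by \<open>inv_sqrt\<close> remain true when time points coincide.
\<close>

definition inv_sqrt :: "real \<Rightarrow> ennreal" where
  "inv_sqrt x = (if x = 0 then \<infinity> else ennreal (1 / sqrt \<bar>x\<bar>))"

lemma inv_sqrt_measurable [measurable]: "inv_sqrt \<in> borel_measurable borel"
  unfolding inv_sqrt_def by measurable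

lemma nn_integral_inv_sqrt_le:
  assumes w: "w \<in> {0..1}"
  shows "(\<integral>\<^sup>+t. indicator {0..1} t * inv_sqrt (t - w) \<partial>lborel) \<le> 4"
proof -
  let ?f = "\<lambda>t. 1 / sqrt \<bar>t - w\<bar>"
  have 1: "(?f has_integral (- 2 * sqrt (w - w) - (- 2 * sqrt (w - 0)))) {0..w}"
  proof (rule fundamental_theorem_of_calculus_interior)
    fix x assume x: "x \<in> {0<..<w}"
    then have "((\<lambda>t. - 2 * sqrt (w - t)) has_real_derivative ?f x) (at x)"
      by (auto intro!: derivative_eq_intros simp: field_simps)
    then show "((\<lambda>t. - 2 * sqrt (w - t)) has_vector_derivative ?f x) (at x)"
      by (simp add: has_real_derivative_iff_has_vector_derivative)
  qed (use w in \<open>auto intro!: continuous_intros\<close>)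
  have 2: "(?f has_integral (2 * sqrt (1 - w) - 2 * sqrt (w - w))) {w..1}"
  proof (rule fundamental_theorem_of_calculus_interior)
    fix x assume x: "x \<in> {w<..<1}"
    then have "((\<lambda>t. 2 * sqrt (t - w)) has_real_derivative ?f x) (at x)"
      by (auto intro!: derivative_eq_intros simp: field_simps)
    then show "((\<lambda>t. 2 * sqrt (t - w)) has_vector_derivative ?f x) (at x)"
      by (simp add: has_real_derivative_iff_has_vector_derivative)
  qed (use w in \<open>auto intro!: continuous_intros\<close>)
  have 3: "(?f has_integral (2 * sqrt w + 2 * sqrt (1 - w))) {0..1}"
    using has_integral_combine[OF _ _ 1 2] w by simp
  have "AE t in lborel. t \<noteq> w" by (rule AE_lborel_singleton)
  then have "(\<integral>\<^sup>+t. indicator {0..1} t * inv_sqrt (t - w) \<partial>lborel) =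
      (\<integral>\<^sup>+t. ennreal (indicator {0..1} t * ?f t) \<partial>lborel)"
    by (intro nn_integral_cong_AE, eventually_elim) (auto simp: inv_sqrt_def indicator_def)
  also have "\<dots> = ennreal (2 * sqrt w + 2 * sqrt (1 - w))"
    by (intro nn_integral_has_integral_lebesgue 3) auto
  also have "\<dots> \<le> ennreal 4"
  proof (intro ennreal_leI)
    have "sqrt w \<le> 1" "sqrt (1 - w) \<le> 1" using w by auto
    then show "2 * sqrt w + 2 * sqrt (1 - w) \<le> 4" by linarith
  qed
  finally show ?thesis by simp
qed

lemma nn_integral_gauss_affine:
  fixes d \<beta> \<kappa> :: real
  assumes "\<kappa> > 0" "d > 0"
  shows "(\<integral>\<^sup>+u. ennreal (exp (- \<kappa> * (u * d + \<beta>)\<^sup>2)) \<partial>lborel) = ennreal (sqrt (pi / \<kappa>) / d)"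
proof -
  \<comment> \<open>The integrand is proportional to the normal density with this deviation.\<close>
  define \<sigma> where "\<sigma> = 1 / (sqrt (2 * \<kappa>) * d)"
  have \<sigma>: "\<sigma> > 0" "\<sigma>\<^sup>2 = 1 / (2 * \<kappa> * d\<^sup>2)"
    using assms by (auto simp: \<sigma>_def power_divide power_mult_distrib)
  have c: "sqrt (2 * pi * \<sigma>\<^sup>2) = sqrt (pi / \<kappa>) / d"
    using assms by (simp add: \<sigma>(2) real_sqrt_divide real_sqrt_mult)
  have "exp (- \<kappa> * (u * d + \<beta>)\<^sup>2) = (sqrt (pi / \<kappa>) / d) * normal_density (- \<beta> / d) \<sigma> u" for u
  proof -
    have "(u * d + \<beta>)\<^sup>2 = d\<^sup>2 * (u - - \<beta> / d)\<^sup>2"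
      using assms(2) by (simp add: power_mult_distrib[symmetric] field_simps)
    then have "- \<kappa> * (u * d + \<beta>)\<^sup>2 = - (u - - \<beta> / d)\<^sup>2 / (2 * \<sigma>\<^sup>2)"
      using assms by (simp add: \<sigma>(2) field_simps)
    then show ?thesis
      using assms by (simp add: normal_density_def c)
  qed
  then have "(\<integral>\<^sup>+u. ennreal (exp (- \<kappa> * (u * d + \<beta>)\<^sup>2)) \<partial>lborel) =
      (\<integral>\<^sup>+u. ennreal (sqrt (pi / \<kappa>) / d) * ennreal (normal_density (- \<beta> / d) \<sigma> u) \<partial>lborel)"
    using assms by (intro nn_integral_cong) (simp add: ennreal_mult'[symmetric])
  also have "\<dots> = ennreal (sqrt (pi / \<kappa>) / d) * (\<integral>\<^sup>+u. ennreal (normal_density (- \<beta> / d) \<sigma> u) \<partial>lborel)"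
    by (rule nn_integral_cmult) simp
  also have "(\<integral>\<^sup>+u. ennreal (normal_density (- \<beta> / d) \<sigma> u) \<partial>lborel) = 1"
  proof -
    interpret prob_space "density lborel (normal_density (- \<beta> / d) \<sigma>)"
      by (rule prob_space_normal_density[OF \<sigma>(1)])
    show ?thesis using emeasure_space_1 by (simp add: emeasure_density)
  qed
  finally show ?thesis by simp
qed

text \<open>
  A substitute for a Gaussian density on the quotient by the steps with jumps in \<open>W\<close>.
\<close>

definition gauss_dist :: "real \<Rightarrow> real set \<Rightarrow> L2_unit \<Rightarrow> ennreal" where
  "gauss_dist \<kappa> W v = ennreal (exp (- \<kappa> * (infdist v (step_span W))\<^sup>2))"

lemma gauss_dist_mono:
  assumes "W \<subseteq> V" "\<kappa> > 0"
  shows "gauss_dist \<kappa> W v \<le> gauss_dist \<kappa> V v"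
proof -
  have "step_span W \<subseteq> step_span V" using assms by (intro span_mono) auto
  then have "infdist v (step_span V) \<le> infdist v (step_span W)"
    using span_zero by (intro infdist_mono) auto
  then have "(infdist v (step_span V))\<^sup>2 \<le> (infdist v (step_span W))\<^sup>2"
    by (intro power_mono) (auto simp: infdist_nonneg)
  then show ?thesis unfolding gauss_dist_def using assms by (auto intro!: ennreal_leI)
qed

lemma gauss_dist_le_1: "\<kappa> > 0 \<Longrightarrow> gauss_dist \<kappa> W v \<le> 1"
  unfolding gauss_dist_def by (simp add: mult_nonneg_nonneg)

text \<open>
  If \<open>t\<close> lies in the gap \<open>(p;q)\<close> of \<open>W\<close>, the normalised bump on \<open>p < t < q\<close> is orthogonal to the steps on \<open>W\<close>, and its
  product with the new increment is \<open>d = sqrt ((q - t) (t - p) / (q - p))\<close>, the standard deviation at time \<open>t\<close> of a Brownian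
  bridge on \<open>[p;q]\<close>. Integrating the coefficient of the increment costs a factor \<open>1 / d\<close>, and afterwards \<open>t\<close> counts
  as a grid point. Since \<open>1 / d\<^sup>2 = 1 / (t - p) + 1 / (q - t)\<close>, the factor is bounded by a sum over all of \<open>W\<close>, which is
  measurable in \<open>t\<close> and in \<open>W\<close> without any reference to the order of the points.
\<close>

lemma nn_integral_gauss_dist_step:
  assumes \<kappa>: "\<kappa> > 0" and W: "finite W" "W \<subseteq> {0..1}" "{0, 1} \<subseteq> W" "a \<in> W" and t: "t \<in> {0..1}"
  shows "(\<integral>\<^sup>+u. gauss_dist \<kappa> W (v + u *\<^sub>R (L2_indicator t - L2_indicator a)) \<partial>lborel)
     \<le> ennreal (sqrt (pi / \<kappa>)) * (\<Sum>w\<in>W. inv_sqrt (t - w)) * gauss_dist \<kappa> (insert t W) v"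
proof (cases "t \<in> W")
  case True
  have "inv_sqrt (t - t) \<le> (\<Sum>w\<in>W. inv_sqrt (t - w))"
    using W(1) True by (intro member_le_sum) auto
  then have "(\<Sum>w\<in>W. inv_sqrt (t - w)) = \<infinity>" by (simp add: inv_sqrt_def top_unique)
  moreover have "ennreal (sqrt (pi / \<kappa>)) \<noteq> 0" "gauss_dist \<kappa> (insert t W) v \<noteq> 0"
    using \<kappa> by (auto simp: gauss_dist_def)
  ultimately show ?thesis by (simp add: ennreal_mult_top ennreal_top_mult)
next
  case False
  \<comment> \<open>Neighbours of \<open>t\<close> in \<open>W\<close>; they exist because \<open>0\<close> and \<open>1\<close> belong to \<open>W\<close>.\<close>
  define p where "p = Max {w\<in>W. w < t}"
  define q where "q = Min {w\<in>W. t < w}"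
  have tne: "t \<noteq> 0" "t \<noteq> 1" using False W by auto
  then have ne: "{w\<in>W. w < t} \<noteq> {}" "{w\<in>W. t < w} \<noteq> {}" using W(3) t by auto
  have "p \<in> {w\<in>W. w < t}" unfolding p_def using ne W(1) by (intro Max_in) auto
  then have p: "p \<in> W" "p < t" by auto
  have "q \<in> {w\<in>W. t < w}" unfolding q_def using ne W(1) by (intro Min_in) auto
  then have q: "q \<in> W" "t < q" by auto
  have pmax: "w \<le> p" if "w \<in> W" "w < t" for w unfolding p_def using that W(1) by (intro Max_ge) auto
  have qmin: "q \<le> w" if "w \<in> W" "t < w" for w unfolding q_def using that W(1) by (intro Min_le) auto
  have gap: "W \<inter> {p<..<q} = {}"
  proof (rule ccontr)
    assume "W \<inter> {p<..<q} \<noteq> {}"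
    then obtain w where w: "w \<in> W" "p < w" "w < q" by auto
    then have "w \<noteq> t" using False by auto
    then show False using pmax[of w] qmin[of w] w by linarith
  qed
  have pq: "0 \<le> p" "q \<le> 1" using p q W by auto
  define L where "L = (q - t) * (t - p) * (q - p)"
  have L: "L > 0" using p q by (simp add: L_def)
  have nb: "norm (bump p t q) = sqrt L"
    using norm_bump[of p t q] pq p q by (simp add: L_def real_sqrt_unique)
  define n where "n = inverse (sqrt L) *\<^sub>R bump p t q"
  define d where "d = (q - t) * (t - p) / sqrt L"
  have d: "d > 0" using L p q by (simp add: d_def)
  have norm_n: "norm n = 1" using L by (simp add: n_def nb)
  have et: "inner (L2_indicator t) n = d"
    using inner_peak_bump[of p t q] pq p q by (simp add: n_def d_def divide_inverse mult_ac)
  have orth: "inner s n = 0" if "s \<in> step_span W" for s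
    using inner_bump_step_span[of p t q W s] pq p q W gap that by (simp add: n_def)
  have sub: "step_span W \<subseteq> step_span (insert t W)" by (intro span_mono) auto
  have base: "L2_indicator w \<in> step_span (insert t W)" if "w \<in> insert t W" for w
    using that by (intro span_base) auto
  have n_in: "n \<in> step_span (insert t W)" unfolding n_def bump_def
    by (intro span_scale span_diff base) (use p q in auto)
  have split: "(infdist v (step_span (insert t W)))\<^sup>2 + (u * d + inner v n)\<^sup>2
      \<le> (infdist (v + u *\<^sub>R (L2_indicator t - L2_indicator a)) (step_span W))\<^sup>2" for u
  proof -
    have "inner (L2_indicator a) n = 0" using W(4) by (intro orth span_base) auto
    then have "inner (v + u *\<^sub>R (L2_indicator t - L2_indicator a)) n = u * d + inner v n"
      by (simp add: inner_add_left inner_diff_left et)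
    moreover have x_in: "u *\<^sub>R (L2_indicator t - L2_indicator a) \<in> step_span (insert t W)"
      by (intro span_scale span_diff base) (use W(4) in auto)
    moreover have "step_span W \<noteq> {}" using span_zero by blast
    ultimately show ?thesis
      using infdist_orthogonal_split[OF subspace_span sub _ n_in norm_n orth x_in, of v] by simp
  qed
  have "(\<integral>\<^sup>+u. gauss_dist \<kappa> W (v + u *\<^sub>R (L2_indicator t - L2_indicator a)) \<partial>lborel)
      \<le> (\<integral>\<^sup>+u. gauss_dist \<kappa> (insert t W) v * ennreal (exp (- \<kappa> * (u * d + inner v n)\<^sup>2)) \<partial>lborel)"
  proof (intro nn_integral_mono)
    fix u
    have "exp (- \<kappa> * (infdist (v + u *\<^sub>R (L2_indicator t - L2_indicator a)) (step_span W))\<^sup>2)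
       \<le> exp (- \<kappa> * (infdist v (step_span (insert t W)))\<^sup>2 + - \<kappa> * (u * d + inner v n)\<^sup>2)"
      using mult_left_mono[OF split[of u], of \<kappa>] \<kappa> by (simp add: algebra_simps)
    then show "gauss_dist \<kappa> W (v + u *\<^sub>R (L2_indicator t - L2_indicator a))
       \<le> gauss_dist \<kappa> (insert t W) v * ennreal (exp (- \<kappa> * (u * d + inner v n)\<^sup>2))"
      unfolding gauss_dist_def exp_add by (subst ennreal_mult[symmetric]) (auto intro: ennreal_leI)
  qed
  also have "\<dots> = gauss_dist \<kappa> (insert t W) v * ennreal (sqrt (pi / \<kappa>) / d)"
    by (subst nn_integral_cmult) (simp_all only: nn_integral_gauss_affine[OF \<kappa> d], measurable)
  also have "\<dots> = ennreal (sqrt (pi / \<kappa>)) * ennreal (1 / d) * gauss_dist \<kappa> (insert t W) v"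
    using \<kappa> d by (subst ennreal_mult[symmetric]) (auto simp: mult_ac)
  also have "\<dots> \<le> ennreal (sqrt (pi / \<kappa>)) * (\<Sum>w\<in>W. inv_sqrt (t - w)) * gauss_dist \<kappa> (insert t W) v"
  proof (intro mult_right_mono mult_left_mono)
    have "1 / d \<le> 1 / sqrt (t - p) + 1 / sqrt (q - t)"
    proof (rule power2_le_imp_le)
      have "(1 / d)\<^sup>2 = L / ((q - t) * (t - p))\<^sup>2"
        using L by (simp add: d_def power_divide)
      also have "\<dots> = 1 / (t - p) + 1 / (q - t)"
      proof -
        have "\<beta> * \<alpha> * (\<alpha> + \<beta>) / (\<beta> * \<alpha>)\<^sup>2 = 1 / \<alpha> + 1 / \<beta>" if "\<alpha> > 0" "\<beta> > 0" for \<alpha> \<beta> :: real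
          using that by (simp add: field_simps power2_eq_square)
        from this[of "t - p" "q - t"] show ?thesis using p q by (simp add: L_def)
      qed
      also have "\<dots> \<le> (1 / sqrt (t - p) + 1 / sqrt (q - t))\<^sup>2"
        using p q by (simp add: power2_sum power_divide)
      finally show "(1 / d)\<^sup>2 \<le> (1 / sqrt (t - p) + 1 / sqrt (q - t))\<^sup>2" .
    qed (use p q in auto)
    then have "ennreal (1 / d) \<le> ennreal (1 / sqrt (t - p) + 1 / sqrt (q - t))"
      by (rule ennreal_leI)
    also have "\<dots> = inv_sqrt (t - p) + inv_sqrt (t - q)"
      using p q by (simp add: inv_sqrt_def ennreal_plus[symmetric] del: ennreal_plus)
    also have "\<dots> = (\<Sum>w\<in>{p, q}. inv_sqrt (t - w))" using p q by simp
    also have "\<dots> \<le> (\<Sum>w\<in>W. inv_sqrt (t - w))"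
      using p q W(1) by (intro sum_mono2) auto
    finally show "ennreal (1 / d) \<le> (\<Sum>w\<in>W. inv_sqrt (t - w))" .
  qed auto
  finally show ?thesis .
qed

section \<open>Integrating out one path\<close>

text \<open>
  Pointwise limits of simple functions. This notion is stable under sums and products in every normed space,
  whereas sums of Borel measurable functions are problematic in nonseparable ones.
\<close>

definition strongly_measurable :: "'x measure \<Rightarrow> ('x \<Rightarrow> 'h::real_normed_vector) \<Rightarrow> bool" where
  "strongly_measurable M f \<longleftrightarrow>
     (\<exists>s. (\<forall>n. simple_function M (s n)) \<and> (\<forall>x\<in>space M. (\<lambda>n. s n x) \<longlonglongrightarrow> f x))"

lemma strongly_measurableI:
  "(\<And>n. simple_function M (s n)) \<Longrightarrow> (\<And>x. x \<in> space M \<Longrightarrow> (\<lambda>n. s n x) \<longlonglongrightarrow> f x)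
     \<Longrightarrow> strongly_measurable M f"
  unfolding strongly_measurable_def by blast

lemma strongly_measurable_const: "strongly_measurable M (\<lambda>_. c)"
  by (rule strongly_measurableI[where s = "\<lambda>_ _. c"]) auto

lemma strongly_measurable_add:
  assumes "strongly_measurable M f" "strongly_measurable M g"
  shows "strongly_measurable M (\<lambda>x. f x + g x)"
proof -
  obtain r s where "\<And>n. simple_function M (r n)" "\<And>x. x \<in> space M \<Longrightarrow> (\<lambda>n. r n x) \<longlonglongrightarrow> f x"
    and "\<And>n. simple_function M (s n)" "\<And>x. x \<in> space M \<Longrightarrow> (\<lambda>n. s n x) \<longlonglongrightarrow> g x"
    using assms unfolding strongly_measurable_def by blast
  then show ?thesis
    by (intro strongly_measurableI[where s = "\<lambda>n x. r n x + s n x"])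
      (auto intro: simple_function_compose2 tendsto_add)
qed

lemma strongly_measurable_scaleR:
  assumes c: "c \<in> borel_measurable M" and "strongly_measurable M f"
  shows "strongly_measurable M (\<lambda>x. c x *\<^sub>R f x)"
proof -
  obtain r where "\<And>n. simple_function M (r n)" "\<And>x. x \<in> space M \<Longrightarrow> (\<lambda>n. r n x) \<longlonglongrightarrow> c x"
    using borel_measurable_implies_sequence_metric[OF c, of 0] by blast
  moreover obtain s where "\<And>n. simple_function M (s n)" "\<And>x. x \<in> space M \<Longrightarrow> (\<lambda>n. s n x) \<longlonglongrightarrow> f x"
    using assms unfolding strongly_measurable_def by blast
  ultimately show ?thesis
    by (intro strongly_measurableI[where s = "\<lambda>n x. r n x *\<^sub>R s n x"])
      (auto intro: simple_function_compose2 tendsto_scaleR)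
qed

lemma strongly_measurable_diff:
  assumes "strongly_measurable M f" "strongly_measurable M g"
  shows "strongly_measurable M (\<lambda>x. f x - g x)"
  using strongly_measurable_add[OF assms(1) strongly_measurable_scaleR[OF _ assms(2), of "\<lambda>_. -1"]]
  by simp

lemma strongly_measurable_sum:
  assumes "\<And>i. i \<in> I \<Longrightarrow> strongly_measurable M (f i)"
  shows "strongly_measurable M (\<lambda>x. \<Sum>i\<in>I. f i x)"
proof (cases "finite I")
  case True
  then show ?thesis using assms
    by (induction I rule: finite_induct) (auto intro: strongly_measurable_const strongly_measurable_add)
next
  case False
  then show ?thesis by (simp add: strongly_measurable_const)
qed

lemma strongly_measurable_continuous:
  fixes h :: "'h::real_normed_vector \<Rightarrow> 'b::metric_space"
  assumes "strongly_measurable M f" "continuous_on UNIV h"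
  shows "(\<lambda>x. h (f x)) \<in> borel_measurable M"
proof -
  obtain s where s: "\<And>n. simple_function M (s n)" "\<And>x. x \<in> space M \<Longrightarrow> (\<lambda>n. s n x) \<longlonglongrightarrow> f x"
    using assms(1) unfolding strongly_measurable_def by blast
  show ?thesis
  proof (rule borel_measurable_LIMSEQ_metric)
    show "(\<lambda>x. h (s n x)) \<in> borel_measurable M" for n
      by (rule borel_measurable_simple_function[OF simple_function_compose1[OF s(1)]])
    show "(\<lambda>n. h (s n x)) \<longlonglongrightarrow> h (f x)" if "x \<in> space M" for x
      using continuous_on_tendsto_compose[OF assms(2) s(2)[OF that]] by simp
  qed
qed

text \<open>
  Times range over the whole line in the product measures below; clamping makes every function of time
  meaningful there and does nothing on \<open>[0;1]\<close>.
\<close>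

definition unit_clamp :: "real \<Rightarrow> real" where "unit_clamp t = max 0 (min 1 t)"

lemma unit_clamp_in [simp]: "unit_clamp t \<in> {0..1}" "0 \<le> unit_clamp t" "unit_clamp t \<le> 1"
  by (auto simp: unit_clamp_def)

lemma unit_clamp_id: "t \<in> {0..1} \<Longrightarrow> unit_clamp t = t"
  by (auto simp: unit_clamp_def)

lemma unit_clamp_measurable [measurable]: "unit_clamp \<in> borel_measurable borel"
  unfolding unit_clamp_def by measurable

lemma strongly_measurable_L2_indicator:
  assumes c: "c \<in> borel_measurable M"
  shows "strongly_measurable M (\<lambda>x. L2_indicator (unit_clamp (c x)))"
proof -
  obtain r where r: "\<And>n. simple_function M (r n)" "\<And>x. x \<in> space M \<Longrightarrow> (\<lambda>n. r n x) \<longlonglongrightarrow> c x"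
    using borel_measurable_implies_sequence_metric[OF c, of 0] by blast
  show ?thesis
  proof (rule strongly_measurableI[where s = "\<lambda>n x. L2_indicator (unit_clamp (r n x))"])
    show "simple_function M (\<lambda>x. L2_indicator (unit_clamp (r n x)))" for n
      by (rule simple_function_compose1[OF r(1)])
    fix x assume "x \<in> space M"
    then have "(\<lambda>n. unit_clamp (r n x)) \<longlonglongrightarrow> unit_clamp (c x)"
      unfolding unit_clamp_def by (intro tendsto_intros r)
    then show "(\<lambda>n. L2_indicator (unit_clamp (r n x))) \<longlonglongrightarrow> L2_indicator (unit_clamp (c x))"
      by (intro continuous_on_tendsto_compose[OF continuous_on_L2_indicator]) auto
  qed
qed

lemma gauss_dist_measurable:
  assumes "strongly_measurable M f"
  shows "(\<lambda>x. gauss_dist \<kappa> W (f x)) \<in> borel_measurable M"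
proof -
  have "(\<lambda>x. infdist (f x) (step_span W)) \<in> borel_measurable M"
    by (intro strongly_measurable_continuous[OF assms] continuous_intros)
  then show ?thesis unfolding gauss_dist_def by measurable
qed

interpretation lborel_index: product_sigma_finite "\<lambda>_::nat. lborel :: real measure"
  by standard

lemma prod_Suc_ivl: "(\<Prod>i\<in>{1..Suc n}. f i) = (\<Prod>i\<in>{1..n}. f i) * f (Suc n)"
  by simp

text \<open>
  The factors collected by integrating out the coefficients of the \<open>n\<close> increments of one path, when the grid
  is \<open>W\<close> together with the earlier times of the path.
\<close>

definition path_weight :: "real \<Rightarrow> real set \<Rightarrow> nat \<Rightarrow> (nat \<Rightarrow> real) \<Rightarrow> ennreal" where
  "path_weight \<kappa> W n t = (\<Prod>i\<in>{1..n}. ennreal (sqrt (pi / \<kappa>)) *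
     ((\<Sum>w\<in>W. inv_sqrt (t (Suc i) - w)) + (\<Sum>j\<in>{1..i}. inv_sqrt (t (Suc i) - t j))))"

lemma path_weight_measurable:
  "path_weight \<kappa> W n \<in> borel_measurable (\<Pi>\<^sub>M i\<in>{1..Suc n}. lborel)"
  unfolding path_weight_def by (intro borel_measurable_prod_ennreal borel_measurable_times_ennreal borel_measurable_add
      borel_measurable_sum) measurable

text \<open>
  The coefficients are integrated in the order of the increments. When the \<open>i\<close>-th one is integrated, \<open>t i\<close> is
  already a grid point, and afterwards \<open>t (Suc i)\<close> becomes one, so that the later increments, which involve
  \<open>t (Suc i)\<close>, are only shifts that the induction over arbitrary \<open>v\<close> absorbs.
\<close>

lemma nn_integral_path_increments:
  assumes \<kappa>: "\<kappa> > 0" and W: "finite W" "W \<subseteq> {0..1}" "{0, 1} \<subseteq> W"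
    and "\<And>i. i \<in> {1..Suc n} \<Longrightarrow> t i \<in> {0..1}"
  shows "(\<integral>\<^sup>+u. gauss_dist \<kappa> (insert (t 1) W)
        (v + (\<Sum>i\<in>{1..n}. u i *\<^sub>R (L2_indicator (t (Suc i)) - L2_indicator (t i)))) \<partial>(\<Pi>\<^sub>M i\<in>{1..n}. lborel))
    \<le> path_weight \<kappa> W n t * gauss_dist \<kappa> (W \<union> t ` {1..Suc n}) v"
  using assms(5)
proof (induction n arbitrary: v)
  case 0
  then show ?case by (simp add: PiM_empty nn_integral_count_space_finite path_weight_def)
next
  case (Suc n)
  let ?e = "\<lambda>i. L2_indicator (t (Suc i)) - L2_indicator (t i)"
  let ?V = "W \<union> t ` {1..Suc n}"
  have I: "{1..Suc n} = insert (Suc n) {1..n}" by auto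
  have "(\<integral>\<^sup>+u. gauss_dist \<kappa> (insert (t 1) W) (v + (\<Sum>i\<in>{1..Suc n}. u i *\<^sub>R ?e i))
          \<partial>(\<Pi>\<^sub>M i\<in>{1..Suc n}. lborel))
     = (\<integral>\<^sup>+y. \<integral>\<^sup>+u. gauss_dist \<kappa> (insert (t 1) W)
          (v + (\<Sum>i\<in>{1..Suc n}. (u(Suc n := y)) i *\<^sub>R ?e i)) \<partial>(\<Pi>\<^sub>M i\<in>{1..n}. lborel) \<partial>lborel)"
    unfolding I
  proof (rule lborel_index.product_nn_integral_insert_rev)
    show "(\<lambda>u. gauss_dist \<kappa> (insert (t 1) W) (v + (\<Sum>i\<in>insert (Suc n) {1..n}. u i *\<^sub>R ?e i)))
        \<in> borel_measurable (\<Pi>\<^sub>M i\<in>insert (Suc n) {1..n}. lborel)"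
      by (intro gauss_dist_measurable strongly_measurable_add strongly_measurable_const
          strongly_measurable_sum strongly_measurable_scaleR) measurable
  qed auto
  also have "\<dots> = (\<integral>\<^sup>+y. \<integral>\<^sup>+u. gauss_dist \<kappa> (insert (t 1) W)
          ((v + y *\<^sub>R ?e (Suc n)) + (\<Sum>i\<in>{1..n}. u i *\<^sub>R ?e i)) \<partial>(\<Pi>\<^sub>M i\<in>{1..n}. lborel) \<partial>lborel)"
  proof -
    have "(\<Sum>i\<in>{1..Suc n}. (u(Suc n := y)) i *\<^sub>R ?e i) = y *\<^sub>R ?e (Suc n) + (\<Sum>i\<in>{1..n}. u i *\<^sub>R ?e i)"
      for u :: "nat \<Rightarrow> real" and y
      unfolding I by (subst sum.insert) (auto intro!: sum.cong)
    then show ?thesis by (simp only: add.assoc)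
  qed
  also have "\<dots> \<le> (\<integral>\<^sup>+y. path_weight \<kappa> W n t * gauss_dist \<kappa> ?V (v + y *\<^sub>R ?e (Suc n)) \<partial>lborel)"
    using Suc.prems by (intro nn_integral_mono Suc.IH) auto
  also have "\<dots> = path_weight \<kappa> W n t * (\<integral>\<^sup>+y. gauss_dist \<kappa> ?V (v + y *\<^sub>R ?e (Suc n)) \<partial>lborel)"
    by (intro nn_integral_cmult gauss_dist_measurable strongly_measurable_add strongly_measurable_const
        strongly_measurable_scaleR) measurable
  also have "\<dots> \<le> path_weight \<kappa> W n t * (ennreal (sqrt (pi / \<kappa>)) *
      (\<Sum>w\<in>?V. inv_sqrt (t (Suc (Suc n)) - w)) * gauss_dist \<kappa> (insert (t (Suc (Suc n))) ?V) v)"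
  proof (intro mult_left_mono nn_integral_gauss_dist_step \<kappa>)
    show "?V \<subseteq> {0..1}" "t (Suc (Suc n)) \<in> {0..1}" using W Suc.prems by auto
  qed (use W in auto)
  also have "\<dots> \<le> path_weight \<kappa> W n t * (ennreal (sqrt (pi / \<kappa>)) *
      ((\<Sum>w\<in>W. inv_sqrt (t (Suc (Suc n)) - w)) + (\<Sum>j\<in>{1..Suc n}. inv_sqrt (t (Suc (Suc n)) - t j)))
      * gauss_dist \<kappa> (insert (t (Suc (Suc n))) ?V) v)"
  proof (intro mult_left_mono mult_right_mono)
    let ?s = "\<lambda>w. inv_sqrt (t (Suc (Suc n)) - w)"
    have "sum ?s ?V = sum ?s W + sum ?s (t ` {1..Suc n} - W)"
      using W(1) by (subst sum.union_disjoint[symmetric]) (auto intro!: arg_cong[where f = "sum ?s"])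
    also have "\<dots> \<le> sum ?s W + sum ?s (t ` {1..Suc n})"
      by (intro add_left_mono sum_mono2) auto
    also have "\<dots> \<le> sum ?s W + sum (?s \<circ> t) {1..Suc n}"
      by (intro add_left_mono sum_image_le) auto
    finally show "sum ?s ?V \<le> sum ?s W + (\<Sum>j\<in>{1..Suc n}. ?s (t j))" by (simp only: o_def)
  qed auto
  also have "\<dots> = path_weight \<kappa> W (Suc n) t * gauss_dist \<kappa> (W \<union> t ` {1..Suc (Suc n)}) v"
  proof -
    have "insert (t (Suc (Suc n))) ?V = W \<union> t ` {1..Suc (Suc n)}"
      by (subst (2) atLeastAtMostSuc_conv) auto
    moreover have "path_weight \<kappa> W (Suc n) t = path_weight \<kappa> W n t * (ennreal (sqrt (pi / \<kappa>)) *
      ((\<Sum>w\<in>W. inv_sqrt (t (Suc (Suc n)) - w)) + (\<Sum>j\<in>{1..Suc n}. inv_sqrt (t (Suc (Suc n)) - t j))))"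
      unfolding path_weight_def by (rule prod_Suc_ivl)
    ultimately show ?thesis by (simp only: mult.assoc)
  qed
  finally show ?case .
qed

definition unit_box :: "nat \<Rightarrow> (nat \<Rightarrow> real) \<Rightarrow> ennreal" where
  "unit_box n t = (\<Prod>i\<in>{1..n}. indicator {0..1} (t i))"

lemma unit_box_eq: "unit_box n t = (if \<forall>i\<in>{1..n}. t i \<in> {0..1} then 1 else 0)"
  unfolding unit_box_def by (auto simp: indicator_def intro!: prod.neutral)

lemma unit_box_measurable [measurable]:
  "unit_box n \<in> borel_measurable (\<Pi>\<^sub>M i\<in>{1..n}. lborel)"
  unfolding unit_box_def by (intro borel_measurable_prod_ennreal) measurable

text \<open>
  Every factor of the weight is a sum of translates of \<open>inv_sqrt\<close> in the last time. Integrating the times from the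
  last to the first therefore gives finite constants that depend on \<open>W\<close> only through its cardinality.
\<close>

lemma nn_integral_path_weight_le:
  assumes W: "finite W" "W \<subseteq> {0..1}"
  shows "(\<integral>\<^sup>+t. unit_box (Suc n) t * path_weight \<kappa> W n t \<partial>(\<Pi>\<^sub>M i\<in>{1..Suc n}. lborel))
    \<le> (\<Prod>i\<in>{1..n}. ennreal (sqrt (pi / \<kappa>)) * (4 * (of_nat (card W) + of_nat i)))"
proof (induction n)
  case 0
  have "(\<integral>\<^sup>+t. unit_box (Suc 0) t \<partial>(\<Pi>\<^sub>M i\<in>{1..Suc 0}. lborel))
      = (\<Prod>i\<in>{1..Suc 0}. \<integral>\<^sup>+t. indicator {0..1} (t::real) \<partial>lborel)"
    unfolding unit_box_def
    by (rule lborel_index.product_nn_integral_prod[where f = "\<lambda>_. indicator {0..1}"]) auto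
  then show ?case by (simp add: path_weight_def)
next
  case (Suc n)
  let ?N = "Suc (Suc n)" and ?C = "ennreal (sqrt (pi / \<kappa>))"
  let ?s = "\<lambda>x y. (\<Sum>w\<in>W. inv_sqrt (y - w)) + (\<Sum>j\<in>{1..Suc n}. inv_sqrt (y - x j))"
  have I: "{1..?N} = insert ?N {1..Suc n}" by auto
  have "(\<integral>\<^sup>+t. unit_box ?N t * path_weight \<kappa> W (Suc n) t \<partial>(\<Pi>\<^sub>M i\<in>{1..?N}. lborel))
     = (\<integral>\<^sup>+x. \<integral>\<^sup>+y. unit_box ?N (x(?N := y)) * path_weight \<kappa> W (Suc n) (x(?N := y)) \<partial>lborel
          \<partial>(\<Pi>\<^sub>M i\<in>{1..Suc n}. lborel))"
    unfolding I
  proof (rule lborel_index.product_nn_integral_insert)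
    show "(\<lambda>t. unit_box ?N t * path_weight \<kappa> W (Suc n) t)
        \<in> borel_measurable (\<Pi>\<^sub>M i\<in>insert ?N {1..Suc n}. lborel)"
      unfolding I[symmetric] by (intro borel_measurable_times_ennreal unit_box_measurable path_weight_measurable)
  qed auto
  also have "\<dots> = (\<integral>\<^sup>+x. \<integral>\<^sup>+y. (unit_box (Suc n) x * path_weight \<kappa> W n x) *
        (indicator {0..1} y * (?C * ?s x y)) \<partial>lborel \<partial>(\<Pi>\<^sub>M i\<in>{1..Suc n}. lborel))"
  proof (intro nn_integral_cong)
    fix x :: "nat \<Rightarrow> real" and y :: real
    have "unit_box ?N (x(?N := y)) = unit_box (Suc n) x * indicator {0..1} y"
      unfolding unit_box_def I by (subst prod.insert) (auto simp: mult.commute intro!: prod.cong)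
    moreover have "path_weight \<kappa> W (Suc n) (x(?N := y)) = path_weight \<kappa> W n x * (?C * ?s x y)"
    proof -
      have "path_weight \<kappa> W (Suc n) (x(?N := y)) = path_weight \<kappa> W n (x(?N := y)) *
          (?C * ?s (x(?N := y)) y)"
        unfolding path_weight_def by (subst prod_Suc_ivl) simp
      also have "path_weight \<kappa> W n (x(?N := y)) = path_weight \<kappa> W n x"
        unfolding path_weight_def by (intro prod.cong refl arg_cong2[where f = "(*)"] arg_cong2[where f = "(+)"] sum.cong) auto
      also have "?s (x(?N := y)) y = ?s x y"
        by (intro arg_cong2[where f = "(+)"] sum.cong) auto
      finally show ?thesis .
    qed
    ultimately show "unit_box ?N (x(?N := y)) * path_weight \<kappa> W (Suc n) (x(?N := y)) =
       (unit_box (Suc n) x * path_weight \<kappa> W n x) * (indicator {0..1} y * (?C * ?s x y))"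
      by (simp only: mult_ac)
  qed
  also have "\<dots> \<le> (\<integral>\<^sup>+x. (unit_box (Suc n) x * path_weight \<kappa> W n x) *
        (?C * (4 * (of_nat (card W) + of_nat (Suc n)))) \<partial>(\<Pi>\<^sub>M i\<in>{1..Suc n}. lborel))"
  proof (intro nn_integral_mono)
    fix x :: "nat \<Rightarrow> real"
    let ?w = "unit_box (Suc n) x * path_weight \<kappa> W n x"
    show "(\<integral>\<^sup>+y. ?w * (indicator {0..1} y * (?C * ?s x y)) \<partial>lborel)
       \<le> ?w * (?C * (4 * (of_nat (card W) + of_nat (Suc n))))"
    proof (cases "\<forall>i\<in>{1..Suc n}. x i \<in> {0..1}")
      case True
      have "(\<integral>\<^sup>+y. ?w * (indicator {0..1} y * (?C * ?s x y)) \<partial>lborel)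
          = (\<integral>\<^sup>+y. (?w * ?C) * ((\<Sum>w\<in>W. indicator {0..1} y * inv_sqrt (y - w))
               + (\<Sum>j\<in>{1..Suc n}. indicator {0..1} y * inv_sqrt (y - x j))) \<partial>lborel)"
        by (intro nn_integral_cong) (simp only: sum_distrib_left[symmetric] distrib_left[symmetric], simp only: mult_ac)
      also have "\<dots> = (?w * ?C) * (\<integral>\<^sup>+y. ((\<Sum>w\<in>W. indicator {0..1} y * inv_sqrt (y - w))
               + (\<Sum>j\<in>{1..Suc n}. indicator {0..1} y * inv_sqrt (y - x j))) \<partial>lborel)"
        by (intro nn_integral_cmult) measurable
      also have "\<dots> = (?w * ?C) * ((\<Sum>w\<in>W. \<integral>\<^sup>+y. indicator {0..1} y * inv_sqrt (y - w) \<partial>lborel)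
               + (\<Sum>j\<in>{1..Suc n}. \<integral>\<^sup>+y. indicator {0..1} y * inv_sqrt (y - x j) \<partial>lborel))"
        by (subst nn_integral_add, measurable, subst (1 2) nn_integral_sum) measurable
      also have "\<dots> \<le> (?w * ?C) * ((\<Sum>w\<in>W. 4) + (\<Sum>j\<in>{1..Suc n}. 4))"
        using W True by (intro mult_left_mono add_mono sum_mono nn_integral_inv_sqrt_le) auto
      also have "\<dots> = ?w * (?C * (4 * (of_nat (card W) + of_nat (Suc n))))"
        by (simp only: sum_constant card_atLeastAtMost diff_Suc_1 distrib_left mult_ac)
      finally show ?thesis .
    next
      case False
      then have "unit_box (Suc n) x = 0" unfolding unit_box_eq by auto
      then show ?thesis by simp
    qed
  qed
  also have "\<dots> = (\<integral>\<^sup>+x. unit_box (Suc n) x * path_weight \<kappa> W n x \<partial>(\<Pi>\<^sub>M i\<in>{1..Suc n}. lborel)) *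
        (?C * (4 * (of_nat (card W) + of_nat (Suc n))))"
    by (intro nn_integral_multc borel_measurable_times_ennreal unit_box_measurable path_weight_measurable)
  also have "\<dots> \<le> (\<Prod>i\<in>{1..n}. ?C * (4 * (of_nat (card W) + of_nat i))) *
        (?C * (4 * (of_nat (card W) + of_nat (Suc n))))"
    by (intro mult_right_mono Suc.IH) auto
  also have "\<dots> = (\<Prod>i\<in>{1..Suc n}. ?C * (4 * (of_nat (card W) + of_nat i)))"
    by (rule prod_Suc_ivl[symmetric])
  finally show ?case .
qed

section \<open>Integrating out several paths\<close>

text \<open>
  A point consists of \<open>n + 1\<close> times and of \<open>n\<close> Fourier variables, one for each increment.
\<close>

abbreviation path_space :: "nat \<Rightarrow> ((nat \<Rightarrow> real) \<times> (nat \<Rightarrow> real)) measure" where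
  "path_space n \<equiv> (\<Pi>\<^sub>M i\<in>{1..Suc n}. lborel) \<Otimes>\<^sub>M (\<Pi>\<^sub>M i\<in>{1..n}. lborel)"

lemma sigma_finite_lborel_PiM: "finite I \<Longrightarrow> sigma_finite_measure (\<Pi>\<^sub>M i\<in>I. lborel :: (nat \<Rightarrow> real) measure)"
  by (rule lborel_index.sigma_finite)

lemma sigma_finite_path_space: "sigma_finite_measure (path_space n)"
proof -
  interpret pair_sigma_finite "\<Pi>\<^sub>M i\<in>{1..Suc n}. lborel :: real measure" "\<Pi>\<^sub>M i\<in>{1..n}. lborel :: real measure"
    by (intro pair_sigma_finite.intro sigma_finite_lborel_PiM) auto
  show ?thesis by unfold_locales
qed

interpretation path_index: product_sigma_finite "\<lambda>_::nat. path_space n" for n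
  by (intro product_sigma_finite.intro sigma_finite_path_space)

definition path_vec :: "nat \<Rightarrow> (nat \<Rightarrow> real) \<times> (nat \<Rightarrow> real) \<Rightarrow> L2_unit" where
  "path_vec n y = (\<Sum>i\<in>{1..n}. snd y i *\<^sub>R
     (L2_indicator (unit_clamp (fst y (Suc i))) - L2_indicator (unit_clamp (fst y i))))"

lemma strongly_measurable_path_vec:
  assumes g: "g \<in> measurable N (path_space n)"
  shows "strongly_measurable N (\<lambda>x. path_vec n (g x))"
  unfolding path_vec_def
proof (intro strongly_measurable_sum strongly_measurable_scaleR strongly_measurable_diff
    strongly_measurable_L2_indicator)
  fix i assume i: "i \<in> {1..n}"
  have 1: "(\<lambda>x. fst (g x) j) \<in> borel_measurable N" if "j \<in> {1..Suc n}" for j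
    using measurable_compose[OF g measurable_compose[OF measurable_fst measurable_component_singleton[OF that]]]
    by simp
  show "(\<lambda>x. snd (g x) i) \<in> borel_measurable N"
    using measurable_compose[OF g measurable_compose[OF measurable_snd measurable_component_singleton[OF i]]]
    by simp
  show "(\<lambda>x. fst (g x) (Suc i)) \<in> borel_measurable N" "(\<lambda>x. fst (g x) i) \<in> borel_measurable N"
    using i by (auto intro!: 1)
qed

lemma unit_box_fst_measurable:
  assumes g: "g \<in> measurable N (path_space n)"
  shows "(\<lambda>x. unit_box (Suc n) (fst (g x))) \<in> borel_measurable N"
  by (rule measurable_compose[OF g measurable_compose[OF measurable_fst unit_box_measurable]])

text \<open>
  Induction on the number \<open>p\<close> of paths. For fixed times of the last path its Fourier variables are integrated first,
  which adds its times to the grid; then the other paths are integrated with respect to the larger grid, and the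
  times of the last path come at the end. The bound must hold uniformly in the grid, as a function of its
  cardinality, because the enlarged grid depends on the times.
\<close>

lemma nn_integral_paths_bounded:
  fixes p :: nat
  assumes \<kappa>: "\<kappa> > 0"
  shows "\<exists>B<\<infinity>. \<forall>W. finite W \<longrightarrow> W \<subseteq> {0..1} \<longrightarrow> {0, 1} \<subseteq> W \<longrightarrow> card W \<le> m \<longrightarrow>
     (\<integral>\<^sup>+y. (\<Prod>j\<in>{..<p}. unit_box (Suc n) (fst (y j))) *
        gauss_dist \<kappa> W (\<Sum>j\<in>{..<p}. path_vec n (y j)) \<partial>(\<Pi>\<^sub>M j\<in>{..<p}. path_space n)) \<le> B"
proof (induction p arbitrary: m)
  case 0
  show ?case
    by (rule exI[of _ 1]) (use gauss_dist_le_1[OF \<kappa>] in \<open>simp add: PiM_empty nn_integral_count_space_finite\<close>)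
next
  case (Suc p)
  let ?T = "\<Pi>\<^sub>M i\<in>{1..Suc n}. lborel :: real measure" and ?U = "\<Pi>\<^sub>M i\<in>{1..n}. lborel :: real measure"
  let ?Z = "\<Pi>\<^sub>M j\<in>{..<p}. path_space n"
  let ?P = "\<lambda>z. \<Prod>j\<in>{..<p}. unit_box (Suc n) (fst (z j))"
  let ?S = "\<lambda>z. \<Sum>j\<in>{..<p}. path_vec n (z j)"
  let ?box = "unit_box (Suc n)"
  obtain B where B: "B < \<infinity>" "\<And>W. finite W \<Longrightarrow> W \<subseteq> {0..1} \<Longrightarrow> {0, 1} \<subseteq> W \<Longrightarrow> card W \<le> m + Suc n \<Longrightarrow>
     (\<integral>\<^sup>+z. ?P z * gauss_dist \<kappa> W (?S z) \<partial>?Z) \<le> B"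
    using Suc.IH[of "m + Suc n"] by (elim exE conjE) (rule that, auto)
  define C where "C = (\<Prod>i\<in>{1..n}. ennreal (sqrt (pi / \<kappa>)) * (4 * (of_nat m + of_nat i)))"
  have C: "C < \<infinity>" unfolding C_def
    by (auto simp: ennreal_prod_eq_top ennreal_mult_eq_top_iff less_top[symmetric])
  interpret T: sigma_finite_measure ?T by (rule sigma_finite_lborel_PiM) simp
  interpret U: sigma_finite_measure ?U by (rule sigma_finite_lborel_PiM) simp
  interpret Z: sigma_finite_measure ?Z by (rule path_index.sigma_finite) simp
  interpret UZ: pair_sigma_finite ?U ?Z ..
  have I: "{..<Suc p} = insert p {..<p}" by auto
  show ?case
  proof (intro exI[of _ "C * B"] conjI allI impI)
    show "C * B < \<infinity>" using C B(1) by (simp add: ennreal_mult_less_top)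
    fix W :: "real set" assume W: "finite W" "W \<subseteq> {0..1}" "{0, 1} \<subseteq> W" "card W \<le> m"
    have Smeas: "strongly_measurable N (\<lambda>x. ?S (h x))" if "h \<in> measurable N ?Z" for N :: "'n measure" and h
      by (intro strongly_measurable_sum strongly_measurable_path_vec
          measurable_compose[OF that measurable_component_singleton])
    have Pmeas: "(\<lambda>x. ?P (h x)) \<in> borel_measurable N" if "h \<in> measurable N ?Z" for N :: "'n measure" and h
      by (intro borel_measurable_prod_ennreal unit_box_fst_measurable
          measurable_compose[OF that measurable_component_singleton])
    let ?G = "\<lambda>y z. ?box (fst y) * ?P z * gauss_dist \<kappa> W (?S z + path_vec n y)"
    have Gmeas: "(\<lambda>x. ?G (g x) (h x)) \<in> borel_measurable N"
      if "g \<in> measurable N (path_space n)" "h \<in> measurable N ?Z" for N :: "'n measure" and g h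
      by (intro borel_measurable_times_ennreal gauss_dist_measurable strongly_measurable_add Smeas Pmeas
          strongly_measurable_path_vec unit_box_fst_measurable that)
    have "(\<integral>\<^sup>+y. (\<Prod>j\<in>{..<Suc p}. ?box (fst (y j))) *
        gauss_dist \<kappa> W (\<Sum>j\<in>{..<Suc p}. path_vec n (y j)) \<partial>(\<Pi>\<^sub>M j\<in>{..<Suc p}. path_space n))
      = (\<integral>\<^sup>+y. \<integral>\<^sup>+z. (\<Prod>j\<in>{..<Suc p}. ?box (fst ((z(p := y)) j))) *
        gauss_dist \<kappa> W (\<Sum>j\<in>{..<Suc p}. path_vec n ((z(p := y)) j)) \<partial>?Z \<partial>path_space n)"
      unfolding I
    proof (rule path_index.product_nn_integral_insert_rev)
      show "(\<lambda>y. (\<Prod>j\<in>insert p {..<p}. ?box (fst (y j))) *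
          gauss_dist \<kappa> W (\<Sum>j\<in>insert p {..<p}. path_vec n (y j)))
        \<in> borel_measurable (\<Pi>\<^sub>M j\<in>insert p {..<p}. path_space n)"
        by (intro borel_measurable_times_ennreal borel_measurable_prod_ennreal gauss_dist_measurable
            strongly_measurable_sum strongly_measurable_path_vec unit_box_fst_measurable
            measurable_component_singleton)
    qed auto
    also have "\<dots> = (\<integral>\<^sup>+y. \<integral>\<^sup>+z. ?G y z \<partial>?Z \<partial>path_space n)"
    proof (intro nn_integral_cong)
      fix y :: "(nat \<Rightarrow> real) \<times> (nat \<Rightarrow> real)" and z :: "nat \<Rightarrow> (nat \<Rightarrow> real) \<times> (nat \<Rightarrow> real)"
      have "(\<Prod>j\<in>{..<Suc p}. ?box (fst ((z(p := y)) j))) = ?box (fst y) * ?P z"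
        unfolding I by (subst prod.insert) (auto intro!: prod.cong)
      moreover have "(\<Sum>j\<in>{..<Suc p}. path_vec n ((z(p := y)) j)) = ?S z + path_vec n y"
        unfolding I by (subst sum.insert) (auto simp: add.commute intro!: sum.cong)
      ultimately show "(\<Prod>j\<in>{..<Suc p}. ?box (fst ((z(p := y)) j))) *
        gauss_dist \<kappa> W (\<Sum>j\<in>{..<Suc p}. path_vec n ((z(p := y)) j)) = ?G y z" by (simp only:)
    qed
    also have "\<dots> = (\<integral>\<^sup>+t. \<integral>\<^sup>+u. \<integral>\<^sup>+z. ?G (t, u) z \<partial>?Z \<partial>?U \<partial>?T)"
    proof (rule U.nn_integral_fst[symmetric])
      have "(\<lambda>x. ?G (fst x) (snd x)) \<in> borel_measurable (path_space n \<Otimes>\<^sub>M ?Z)"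
        by (rule Gmeas) auto
      then show "(\<lambda>y. \<integral>\<^sup>+z. ?G y z \<partial>?Z) \<in> borel_measurable (path_space n)"
        by (intro Z.borel_measurable_nn_integral) (simp add: case_prod_unfold)
    qed
    also have "\<dots> \<le> (\<integral>\<^sup>+t. ?box t * path_weight \<kappa> W n t * B \<partial>?T)"
    proof (intro nn_integral_mono)
      fix t assume t: "t \<in> space ?T"
      have tu: "(\<lambda>x. (t, fst x)) \<in> measurable (?U \<Otimes>\<^sub>M ?Z) (path_space n)"
        using t by (intro measurable_Pair measurable_const measurable_fst)
      have "(\<integral>\<^sup>+u. \<integral>\<^sup>+z. ?G (t, u) z \<partial>?Z \<partial>?U) = (\<integral>\<^sup>+z. \<integral>\<^sup>+u. ?G (t, u) z \<partial>?U \<partial>?Z)"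
        by (rule UZ.Fubini'[symmetric])
          (use Gmeas[OF tu measurable_snd] in \<open>simp add: case_prod_unfold\<close>)
      also have "\<dots> \<le> ?box t * path_weight \<kappa> W n t * B"
      proof (cases "\<forall>i\<in>{1..Suc n}. t i \<in> {0..1}")
        case False
        then have "?box t = 0" unfolding unit_box_eq by auto
        then show ?thesis by simp
      next
        case True
        then have box: "?box t = 1" unfolding unit_box_eq by auto
        let ?V = "W \<union> t ` {1..Suc n}"
        have pv: "path_vec n (t, u) = (\<Sum>i\<in>{1..n}. u i *\<^sub>R (L2_indicator (t (Suc i)) - L2_indicator (t i)))" for u
          unfolding path_vec_def using True by (intro sum.cong) (auto simp: unit_clamp_id)
        have tu': "(\<lambda>u. (t, u)) \<in> measurable ?U (path_space n)"
          using t by (intro measurable_Pair measurable_const measurable_ident_sets) auto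
        have "(\<integral>\<^sup>+z. \<integral>\<^sup>+u. ?G (t, u) z \<partial>?U \<partial>?Z)
           = (\<integral>\<^sup>+z. ?P z * (\<integral>\<^sup>+u. gauss_dist \<kappa> W (?S z + path_vec n (t, u)) \<partial>?U) \<partial>?Z)"
          unfolding fst_conv box mult_1
          by (intro nn_integral_cong nn_integral_cmult gauss_dist_measurable strongly_measurable_add
              strongly_measurable_const strongly_measurable_path_vec tu')
        also have "\<dots> \<le> (\<integral>\<^sup>+z. ?P z * (path_weight \<kappa> W n t * gauss_dist \<kappa> ?V (?S z)) \<partial>?Z)"
        proof (intro nn_integral_mono mult_left_mono)
          fix z
          \<comment> \<open>The first time of a path joins the grid without any integration.\<close>
          have "(\<integral>\<^sup>+u. gauss_dist \<kappa> W (?S z + path_vec n (t, u)) \<partial>?U)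
            \<le> (\<integral>\<^sup>+u. gauss_dist \<kappa> (insert (t 1) W) (?S z + path_vec n (t, u)) \<partial>?U)"
            by (intro nn_integral_mono gauss_dist_mono \<kappa>) auto
          also have "\<dots> \<le> path_weight \<kappa> W n t * gauss_dist \<kappa> ?V (?S z)"
            unfolding pv by (intro nn_integral_path_increments \<kappa> W(1-3)) (use True in blast)
          finally show "(\<integral>\<^sup>+u. gauss_dist \<kappa> W (?S z + path_vec n (t, u)) \<partial>?U)
            \<le> path_weight \<kappa> W n t * gauss_dist \<kappa> ?V (?S z)" .
        qed auto
        also have "\<dots> = (\<integral>\<^sup>+z. path_weight \<kappa> W n t * (?P z * gauss_dist \<kappa> ?V (?S z)) \<partial>?Z)"
          by (simp only: mult_ac)
        also have "\<dots> = path_weight \<kappa> W n t * (\<integral>\<^sup>+z. ?P z * gauss_dist \<kappa> ?V (?S z) \<partial>?Z)"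
          by (intro nn_integral_cmult borel_measurable_times_ennreal gauss_dist_measurable Smeas Pmeas) auto
        also have "\<dots> \<le> path_weight \<kappa> W n t * B"
        proof (intro mult_left_mono B(2))
          have "card ?V \<le> card W + card (t ` {1..Suc n})" by (rule card_Un_le)
          also have "\<dots> \<le> m + Suc n"
            using W(4) card_image_le[of "{1..Suc n}" t] by simp
          finally show "card ?V \<le> m + Suc n" .
          show "?V \<subseteq> {0..1}" using W True by auto
        qed (use W in auto)
        finally show ?thesis unfolding box mult_1 .
      qed
      finally show "(\<integral>\<^sup>+u. \<integral>\<^sup>+z. ?G (t, u) z \<partial>?Z \<partial>?U) \<le> ?box t * path_weight \<kappa> W n t * B" .
    qed
    also have "\<dots> = (\<integral>\<^sup>+t. ?box t * path_weight \<kappa> W n t \<partial>?T) * B"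
      by (intro nn_integral_multc borel_measurable_times_ennreal unit_box_measurable path_weight_measurable)
    also have "\<dots> \<le> (\<Prod>i\<in>{1..n}. ennreal (sqrt (pi / \<kappa>)) * (4 * (of_nat (card W) + of_nat i))) * B"
      by (intro mult_right_mono nn_integral_path_weight_le W) auto
    also have "\<dots> \<le> C * B"
      unfolding C_def using W(4) by (intro mult_right_mono prod_mono_ennreal mult_left_mono add_right_mono) auto
    finally show "(\<integral>\<^sup>+y. (\<Prod>j\<in>{..<Suc p}. ?box (fst (y j))) *
        gauss_dist \<kappa> W (\<Sum>j\<in>{..<Suc p}. path_vec n (y j)) \<partial>(\<Pi>\<^sub>M j\<in>{..<Suc p}. path_space n)) \<le> C * B" .
  qed
qed

lemma path_vec_in_step_span:
  "path_vec n y \<in> step_span ((\<lambda>i. unit_clamp (fst y i)) ` {1..Suc n})"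
  unfolding path_vec_def
  by (intro span_sum span_scale span_diff span_base imageI) auto

text \<open>
  The integral of the joint characteristic function of all increments, in \<open>p\<close> copies, over times and frequencies.
  Its finiteness is what makes all moments of the approximations converge.
\<close>

lemma nn_integral_operator_paths_finite:
  fixes A :: "L2_unit \<Rightarrow> L2_unit" and p :: nat
  assumes "linear A" "finite_dimensional_subspace (op_kernel A)"
    and "continuously_invertible_on (orthogonal_comp (op_kernel A)) A"
  shows "(\<integral>\<^sup>+y. (\<Prod>j\<in>{..<p}. unit_box (Suc n) (fst (y j))) *
        ennreal (exp (- (norm (A (\<Sum>j\<in>{..<p}. path_vec n (y j))))\<^sup>2 / 2))
          \<partial>(\<Pi>\<^sub>M j\<in>{..<p}. path_space n)) < \<infinity>"
proof -
  \<comment> \<open>The \<open>p\<close> paths have at most \<open>p * Suc n\<close> jumps altogether.\<close>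
  obtain R c where R: "finite R" "R \<subseteq> {0..1}" "{0, 1} \<subseteq> R" and c: "c > 0"
    "\<And>W v. finite W \<Longrightarrow> W \<subseteq> {0..1} \<Longrightarrow> card W \<le> p * Suc n \<Longrightarrow> v \<in> step_span W \<Longrightarrow>
       c * infdist v (step_span R) \<le> norm (A v)"
    using operator_bounded_below_modulo_steps[OF assms, of "p * Suc n"] by blast
  define \<kappa> where "\<kappa> = c\<^sup>2 / 2"
  have \<kappa>: "\<kappa> > 0" using c(1) by (simp add: \<kappa>_def)
  obtain B where B: "B < \<infinity>" "\<And>W. finite W \<Longrightarrow> W \<subseteq> {0..1} \<Longrightarrow> {0, 1} \<subseteq> W \<Longrightarrow> card W \<le> card R \<Longrightarrow>
     (\<integral>\<^sup>+y. (\<Prod>j\<in>{..<p}. unit_box (Suc n) (fst (y j))) *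
        gauss_dist \<kappa> W (\<Sum>j\<in>{..<p}. path_vec n (y j)) \<partial>(\<Pi>\<^sub>M j\<in>{..<p}. path_space n)) \<le> B"
    using nn_integral_paths_bounded[OF \<kappa>, of "card R" p n] by (elim exE conjE) (rule that, auto)
  have "ennreal (exp (- (norm (A (\<Sum>j\<in>{..<p}. path_vec n (y j))))\<^sup>2 / 2))
      \<le> gauss_dist \<kappa> R (\<Sum>j\<in>{..<p}. path_vec n (y j))" for y
  proof -
    let ?v = "\<Sum>j\<in>{..<p}. path_vec n (y j)"
    define W where "W = (\<Union>j\<in>{..<p}. (\<lambda>i. unit_clamp (fst (y j) i)) ` {1..Suc n})"
    have "?v \<in> step_span W"
    proof (intro span_sum)
      fix j assume j: "j \<in> {..<p}"
      then have "step_span ((\<lambda>i. unit_clamp (fst (y j) i)) ` {1..Suc n}) \<subseteq> step_span W"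
        unfolding W_def by (intro span_mono image_mono) auto
      then show "path_vec n (y j) \<in> step_span W" using path_vec_in_step_span by blast
    qed
    moreover have "card W \<le> p * Suc n"
    proof -
      have "card W \<le> (\<Sum>j\<in>{..<p}. card ((\<lambda>i. unit_clamp (fst (y j) i)) ` {1..Suc n}))"
        unfolding W_def by (rule card_UN_le) simp
      also have "\<dots> \<le> (\<Sum>j\<in>{..<p}. Suc n)"
        by (intro sum_mono order_trans[OF card_image_le]) auto
      finally show ?thesis by simp
    qed
    ultimately have "c * infdist ?v (step_span R) \<le> norm (A ?v)"
      by (intro c(2)[of W]) (auto simp: W_def)
    then have "(c * infdist ?v (step_span R))\<^sup>2 \<le> (norm (A ?v))\<^sup>2"
      using c(1) by (intro power_mono) (auto simp: infdist_nonneg)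
    then show ?thesis
      unfolding gauss_dist_def \<kappa>_def by (intro ennreal_leI) (simp add: power_mult_distrib)
  qed
  then have "(\<integral>\<^sup>+y. (\<Prod>j\<in>{..<p}. unit_box (Suc n) (fst (y j))) *
        ennreal (exp (- (norm (A (\<Sum>j\<in>{..<p}. path_vec n (y j))))\<^sup>2 / 2))
          \<partial>(\<Pi>\<^sub>M j\<in>{..<p}. path_space n)) \<le> B"
    by (intro order_trans[OF nn_integral_mono B(2)] mult_left_mono) (use R in auto)
  then show ?thesis using B(1) by (rule le_less_trans)
qed

section \<open>Limits in \<open>L\<^sub>p\<close> from even moments\<close>

lemma abs_le_add_square_div: "\<bar>a\<bar> \<le> e + a\<^sup>2 / e" if "e > 0" for a e :: real
proof (cases "\<bar>a\<bar> \<le> e")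
  case True
  have "0 \<le> a\<^sup>2 / e" using that by simp
  then show ?thesis using True by linarith
next
  case False
  then have "e * \<bar>a\<bar> \<le> \<bar>a\<bar> * \<bar>a\<bar>" by (intro mult_right_mono) auto
  then have "\<bar>a\<bar> \<le> a\<^sup>2 / e" using that by (simp add: field_simps power2_eq_square)
  then show ?thesis using that by linarith
qed

text \<open>
  A convenient replacement for the Jensen inequality, based on \<open>\<bar>a\<bar> \<le> e + a\<^sup>2 / e\<close>.
\<close>

lemma (in prob_space) integral_abs_power_le:
  fixes f :: "'a \<Rightarrow> real"
  assumes [measurable]: "f \<in> borel_measurable M" and int: "integrable M (\<lambda>\<omega>. f \<omega> ^ (2 * p))"
    and le: "(\<integral>\<omega>. f \<omega> ^ (2 * p) \<partial>M) \<le> e\<^sup>2" and e: "e > 0"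
  shows "integrable M (\<lambda>\<omega>. \<bar>f \<omega>\<bar> ^ p)" "(\<integral>\<omega>. \<bar>f \<omega>\<bar> ^ p \<partial>M) \<le> 2 * e"
proof -
  have bound: "\<bar>f \<omega>\<bar> ^ p \<le> e + f \<omega> ^ (2 * p) / e" for \<omega>
    using abs_le_add_square_div[OF e, of "\<bar>f \<omega>\<bar> ^ p"]
    by (simp add: power_mult[symmetric] mult.commute[of p 2] power_even_abs)
  have i: "integrable M (\<lambda>\<omega>. e + f \<omega> ^ (2 * p) / e)" using int by auto
  show "integrable M (\<lambda>\<omega>. \<bar>f \<omega>\<bar> ^ p)"
    by (rule Bochner_Integration.integrable_bound[OF i])
      (use bound in \<open>auto intro!: AE_I2 order_trans[OF _ abs_ge_self]\<close>)
  then have "(\<integral>\<omega>. \<bar>f \<omega>\<bar> ^ p \<partial>M) \<le> (\<integral>\<omega>. e + f \<omega> ^ (2 * p) / e \<partial>M)"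
    using i bound by (intro integral_mono) auto
  also have "\<dots> = e + (\<integral>\<omega>. f \<omega> ^ (2 * p) \<partial>M) / e"
    using int by (simp add: prob_space)
  also have "\<dots> \<le> e + e\<^sup>2 / e" using le e by (intro add_left_mono divide_right_mono) auto
  finally show "(\<integral>\<omega>. \<bar>f \<omega>\<bar> ^ p \<partial>M) \<le> 2 * e" using e by (simp add: power2_eq_square)
qed

text \<open>
  A sequence that is Cauchy in \<open>L\<^sub>1\<close> has an almost surely convergent subsequence; Fatou's lemma along it shows that
  its limit is approached in all even moments, and these control all absolute moments. One limit serves every \<open>p\<close>.
\<close>

lemma (in prob_space) Lp_limit_of_cauchy_moments:
  fixes T :: "real \<Rightarrow> 'a \<Rightarrow> real"
  assumes meas: "\<And>\<epsilon>. \<epsilon> > 0 \<Longrightarrow> T \<epsilon> \<in> borel_measurable M"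
    and bdd: "\<And>\<epsilon>. \<epsilon> > 0 \<Longrightarrow> \<exists>C. \<forall>\<omega>\<in>space M. \<bar>T \<epsilon> \<omega>\<bar> \<le> C"
    and cauchy: "\<And>q e. q \<ge> 1 \<Longrightarrow> e > 0 \<Longrightarrow> \<exists>\<eta>>0. \<forall>\<epsilon> \<delta>. 0 < \<epsilon> \<longrightarrow> \<epsilon> \<le> \<eta> \<longrightarrow> 0 < \<delta> \<longrightarrow> \<delta> \<le> \<eta> \<longrightarrow>
        (\<integral>\<omega>. (T \<epsilon> \<omega> - T \<delta> \<omega>) ^ (2 * q) \<partial>M) \<le> e"
  shows "\<exists>L. \<forall>p\<ge>1. Lp_limit M p T L (at_right 0)"
proof -
  have int_bdd: "integrable M g" if "g \<in> borel_measurable M" "\<And>\<omega>. \<omega> \<in> space M \<Longrightarrow> \<bar>g \<omega>\<bar> \<le> C" for g :: "'a \<Rightarrow> real" and C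
    using that by (intro integrable_const_bound[where B = C] AE_I2) auto
  have int_diff: "integrable M (\<lambda>\<omega>. (T \<epsilon> \<omega> - T \<delta> \<omega>) ^ m)" if pos: "\<epsilon> > 0" "\<delta> > 0" for \<epsilon> \<delta> m
  proof -
    obtain C D where C: "\<And>\<omega>. \<omega> \<in> space M \<Longrightarrow> \<bar>T \<epsilon> \<omega>\<bar> \<le> C"
        "\<And>\<omega>. \<omega> \<in> space M \<Longrightarrow> \<bar>T \<delta> \<omega>\<bar> \<le> D" using bdd pos by metis
    have "\<bar>T \<epsilon> \<omega> - T \<delta> \<omega>\<bar> \<le> C + D" if "\<omega> \<in> space M" for \<omega> using C[OF that] by linarith
    then have "\<bar>(T \<epsilon> \<omega> - T \<delta> \<omega>) ^ m\<bar> \<le> (C + D) ^ m" if "\<omega> \<in> space M" for \<omega>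
      unfolding power_abs using that by (intro power_mono) auto
    then show ?thesis using meas pos by (intro int_bdd) auto
  qed
  define s where "s m = T (1 / real (Suc m))" for m
  have s_pos: "1 / real (Suc m) > 0" for m by simp
  have s_meas [measurable]: "s m \<in> borel_measurable M" for m unfolding s_def by (intro meas s_pos)
  have s_int: "integrable M (s m)" for m
    using bdd[OF s_pos[of m]] s_meas[of m] by (auto simp: s_def intro: int_bdd)
  have ev_small: "\<exists>N. \<forall>m\<ge>N. 1 / real (Suc m) \<le> \<eta>" if "\<eta> > 0" for \<eta>
  proof -
    obtain N where N: "inverse (of_nat (Suc N)) < \<eta>" using reals_Archimedean[OF \<open>\<eta> > 0\<close>] by blast
    have "1 / real (Suc m) \<le> \<eta>" if "m \<ge> N" for m
    proof -
      have "1 / real (Suc m) \<le> 1 / real (Suc N)" using that by (intro divide_left_mono) auto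
      then show ?thesis using N by (simp add: inverse_eq_divide)
    qed
    then show ?thesis by blast
  qed
  have L1: "\<exists>N. \<forall>i\<ge>N. \<forall>j\<ge>N. (\<integral>\<omega>. norm (s i \<omega> - s j \<omega>) \<partial>M) < e" if "e > 0" for e
  proof -
    have e3: "e / 3 > 0" "(e / 3)\<^sup>2 > 0" using that by auto
    obtain \<eta> where "\<eta> > 0" and \<eta>: "\<And>\<epsilon> \<delta>. 0 < \<epsilon> \<Longrightarrow> \<epsilon> \<le> \<eta> \<Longrightarrow> 0 < \<delta> \<Longrightarrow> \<delta> \<le> \<eta> \<Longrightarrow>
        (\<integral>\<omega>. (T \<epsilon> \<omega> - T \<delta> \<omega>) ^ (2 * 1) \<partial>M) \<le> (e / 3)\<^sup>2"
      using cauchy[of 1 "(e / 3)\<^sup>2"] e3(2) by blast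
    obtain N where N: "\<And>m. m \<ge> N \<Longrightarrow> 1 / real (Suc m) \<le> \<eta>" using ev_small[OF \<open>\<eta> > 0\<close>] by blast
    have "(\<integral>\<omega>. norm (s i \<omega> - s j \<omega>) \<partial>M) < e" if "i \<ge> N" "j \<ge> N" for i j
    proof -
      have "(\<integral>\<omega>. \<bar>s i \<omega> - s j \<omega>\<bar> ^ 1 \<partial>M) \<le> 2 * (e / 3)"
        unfolding s_def using \<eta>[OF s_pos N s_pos N] that
        by (intro integral_abs_power_le(2) int_diff s_pos e3 borel_measurable_diff meas)
      then show ?thesis using \<open>e > 0\<close> by simp
    qed
    then show ?thesis by blast
  qed
  obtain r where r: "strict_mono r" "AE \<omega> in M. Cauchy (\<lambda>i. s (r i) \<omega>)"
    using cauchy_L1_AE_cauchy_subseq[of M s, OF s_int L1] by blast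
  define L where "L \<omega> = lim (\<lambda>i. s (r i) \<omega>)" for \<omega>
  have L_meas [measurable]: "L \<in> borel_measurable M" unfolding L_def by measurable
  have L_lim: "AE \<omega> in M. (\<lambda>i. s (r i) \<omega>) \<longlonglongrightarrow> L \<omega>"
    using r(2) by eventually_elim (simp add: L_def Cauchy_convergent convergent_LIMSEQ_iff[symmetric])
  have moment: "\<exists>\<eta>>0. \<forall>\<epsilon>. 0 < \<epsilon> \<longrightarrow> \<epsilon> \<le> \<eta> \<longrightarrow> integrable M (\<lambda>\<omega>. (T \<epsilon> \<omega> - L \<omega>) ^ (2 * q)) \<and>
        (\<integral>\<omega>. (T \<epsilon> \<omega> - L \<omega>) ^ (2 * q) \<partial>M) \<le> e" if qe: "q \<ge> 1" "e > 0" for q e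
  proof -
    obtain \<eta> where "\<eta> > 0" and \<eta>: "\<And>\<epsilon> \<delta>. 0 < \<epsilon> \<Longrightarrow> \<epsilon> \<le> \<eta> \<Longrightarrow> 0 < \<delta> \<Longrightarrow> \<delta> \<le> \<eta> \<Longrightarrow>
        (\<integral>\<omega>. (T \<epsilon> \<omega> - T \<delta> \<omega>) ^ (2 * q) \<partial>M) \<le> e"
      using cauchy[OF qe] by blast
    obtain N where N: "\<And>m. m \<ge> N \<Longrightarrow> 1 / real (Suc m) \<le> \<eta>" using ev_small[OF \<open>\<eta> > 0\<close>] by blast
    have "integrable M (\<lambda>\<omega>. (T \<epsilon> \<omega> - L \<omega>) ^ (2 * q)) \<and> (\<integral>\<omega>. (T \<epsilon> \<omega> - L \<omega>) ^ (2 * q) \<partial>M) \<le> e"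
      if \<epsilon>: "0 < \<epsilon>" "\<epsilon> \<le> \<eta>" for \<epsilon>
    proof -
      note [measurable] = meas[OF \<epsilon>(1)]
      let ?u = "\<lambda>i \<omega>. ennreal ((T \<epsilon> \<omega> - s (r i) \<omega>) ^ (2 * q))"
      \<comment> \<open>Fatou along the almost surely convergent subsequence.\<close>
      have "(\<integral>\<^sup>+\<omega>. ennreal ((T \<epsilon> \<omega> - L \<omega>) ^ (2 * q)) \<partial>M) = (\<integral>\<^sup>+\<omega>. liminf (\<lambda>i. ?u i \<omega>) \<partial>M)"
      proof (rule nn_integral_cong_AE)
        show "AE \<omega> in M. ennreal ((T \<epsilon> \<omega> - L \<omega>) ^ (2 * q)) = liminf (\<lambda>i. ?u i \<omega>)"
          using L_lim
        proof eventually_elim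
          case (elim \<omega>)
          then have "(\<lambda>i. ?u i \<omega>) \<longlonglongrightarrow> ennreal ((T \<epsilon> \<omega> - L \<omega>) ^ (2 * q))"
            by (intro tendsto_intros)
          then show ?case by (intro lim_imp_Liminf[symmetric]) auto
        qed
      qed
      also have "\<dots> \<le> liminf (\<lambda>i. \<integral>\<^sup>+\<omega>. ?u i \<omega> \<partial>M)"
        by (rule nn_integral_liminf) measurable
      also have "\<dots> \<le> ennreal e"
      proof (rule Liminf_le)
        show "\<forall>\<^sub>F i in sequentially. (\<integral>\<^sup>+\<omega>. ?u i \<omega> \<partial>M) \<le> ennreal e"
          unfolding eventually_sequentially
        proof (intro exI[of _ N] allI impI)
          fix i assume "N \<le> i"
          then have "N \<le> r i" using seq_suble[OF r(1), of i] by linarith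
          then have "(\<integral>\<omega>. (T \<epsilon> \<omega> - s (r i) \<omega>) ^ (2 * q) \<partial>M) \<le> e"
            unfolding s_def using \<epsilon> N by (intro \<eta> s_pos)
          moreover have "(\<integral>\<^sup>+\<omega>. ?u i \<omega> \<partial>M) = ennreal (\<integral>\<omega>. (T \<epsilon> \<omega> - s (r i) \<omega>) ^ (2 * q) \<partial>M)"
            unfolding s_def by (intro nn_integral_eq_integral int_diff s_pos \<epsilon>) auto
          ultimately show "(\<integral>\<^sup>+\<omega>. ?u i \<omega> \<partial>M) \<le> ennreal e" by (simp add: ennreal_leI)
        qed
      qed simp
      finally have fin: "(\<integral>\<^sup>+\<omega>. ennreal ((T \<epsilon> \<omega> - L \<omega>) ^ (2 * q)) \<partial>M) \<le> ennreal e" .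
      then have "(\<integral>\<^sup>+\<omega>. ennreal ((T \<epsilon> \<omega> - L \<omega>) ^ (2 * q)) \<partial>M) < \<infinity>"
        by (rule le_less_trans) simp
      then have i: "integrable M (\<lambda>\<omega>. (T \<epsilon> \<omega> - L \<omega>) ^ (2 * q))"
        by (intro integrableI_nonneg) auto
      then show ?thesis using fin qe(2) by (simp add: nn_integral_eq_integral)
    qed
    then show ?thesis using \<open>\<eta> > 0\<close> by blast
  qed
  show ?thesis
  proof (intro exI[of _ L] allI impI)
    fix p :: nat assume p: "p \<ge> 1"
    have small: "\<exists>\<eta>>0. \<forall>\<epsilon>. 0 < \<epsilon> \<longrightarrow> \<epsilon> \<le> \<eta> \<longrightarrow> integrable M (\<lambda>\<omega>. \<bar>T \<epsilon> \<omega> - L \<omega>\<bar> ^ p) \<and>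
        (\<integral>\<omega>. \<bar>T \<epsilon> \<omega> - L \<omega>\<bar> ^ p \<partial>M) \<le> 2 * e" if e: "e > 0" for e
    proof -
      have "e\<^sup>2 > 0" using e by simp
      then obtain \<eta> where "\<eta> > 0" and \<eta>: "\<And>\<epsilon>. 0 < \<epsilon> \<Longrightarrow> \<epsilon> \<le> \<eta> \<Longrightarrow> integrable M (\<lambda>\<omega>. (T \<epsilon> \<omega> - L \<omega>) ^ (2 * p))"
        "\<And>\<epsilon>. 0 < \<epsilon> \<Longrightarrow> \<epsilon> \<le> \<eta> \<Longrightarrow> (\<integral>\<omega>. (T \<epsilon> \<omega> - L \<omega>) ^ (2 * p) \<partial>M) \<le> e\<^sup>2"
        using moment[OF p \<open>e\<^sup>2 > 0\<close>] by (elim exE conjE) (rule that, auto)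
      then show ?thesis
        using integral_abs_power_le[OF borel_measurable_diff[OF meas L_meas] \<eta>(1) \<eta>(2) e] by blast
    qed
    have Tp: "T \<epsilon> \<in> Lp_functions M p" if pos: "\<epsilon> > 0" for \<epsilon>
    proof -
      obtain C where C: "\<And>\<omega>. \<omega> \<in> space M \<Longrightarrow> \<bar>T \<epsilon> \<omega>\<bar> \<le> C" using bdd[OF pos] by blast
      then have "\<bar>\<bar>T \<epsilon> \<omega>\<bar> ^ p\<bar> \<le> C ^ p" if "\<omega> \<in> space M" for \<omega> using that by (simp add: power_mono)
      then show ?thesis using meas[OF pos] unfolding Lp_functions_def by (auto intro!: int_bdd)
    qed
    show "Lp_limit M p T L (at_right 0)"
      unfolding Lp_limit_def
    proof (intro conjI)
      obtain \<epsilon> where \<epsilon>: "\<epsilon> > 0" and i: "integrable M (\<lambda>\<omega>. \<bar>T \<epsilon> \<omega> - L \<omega>\<bar> ^ p)"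
        using small[of 1] by force
      obtain C where C: "\<And>\<omega>. \<omega> \<in> space M \<Longrightarrow> \<bar>T \<epsilon> \<omega>\<bar> \<le> C" using bdd[OF \<epsilon>] by blast
      have "integrable M (\<lambda>\<omega>. \<bar>L \<omega>\<bar> ^ p)"
      proof (rule Bochner_Integration.integrable_bound)
        show "integrable M (\<lambda>\<omega>. 2 ^ p * (C ^ p + \<bar>T \<epsilon> \<omega> - L \<omega>\<bar> ^ p))" using i by auto
        show "AE \<omega> in M. norm (\<bar>L \<omega>\<bar> ^ p) \<le> norm (2 ^ p * (C ^ p + \<bar>T \<epsilon> \<omega> - L \<omega>\<bar> ^ p))"
        proof (rule AE_I2)
          fix \<omega> assume \<omega>: "\<omega> \<in> space M"
          let ?m = "max C \<bar>T \<epsilon> \<omega> - L \<omega>\<bar>"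
          have C0: "0 \<le> C" using C[OF \<omega>] by linarith
          have "\<bar>L \<omega>\<bar> \<le> \<bar>T \<epsilon> \<omega>\<bar> + \<bar>T \<epsilon> \<omega> - L \<omega>\<bar>" by linarith
          also have "\<dots> \<le> ?m + ?m" using C[OF \<omega>] by (intro add_mono) auto
          finally have "\<bar>L \<omega>\<bar> \<le> 2 * ?m" by simp
          then have "\<bar>L \<omega>\<bar> ^ p \<le> 2 ^ p * ?m ^ p"
            using power_mono[of "\<bar>L \<omega>\<bar>" "2 * ?m" p] by (simp add: power_mult_distrib)
          also have "?m ^ p \<le> C ^ p + \<bar>T \<epsilon> \<omega> - L \<omega>\<bar> ^ p" using C0 by (auto simp: max_def)
          finally show "norm (\<bar>L \<omega>\<bar> ^ p) \<le> norm (2 ^ p * (C ^ p + \<bar>T \<epsilon> \<omega> - L \<omega>\<bar> ^ p))"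
            using C0 by simp
        qed
      qed measurable
      then show "L \<in> Lp_functions M p" by (simp add: Lp_functions_def)
      show "\<forall>\<^sub>F \<epsilon> in at_right 0. T \<epsilon> \<in> Lp_functions M p"
        using Tp by (auto simp: eventually_at_right_field intro: exI[of _ 1])
      have "((\<lambda>\<epsilon>. \<integral>\<omega>. \<bar>T \<epsilon> \<omega> - L \<omega>\<bar> ^ p \<partial>M) \<longlongrightarrow> 0) (at_right 0)"
      proof (rule tendstoI)
        fix e :: real assume "e > 0"
        then obtain \<eta> where "\<eta> > 0" and \<eta>: "\<And>\<epsilon>. 0 < \<epsilon> \<Longrightarrow> \<epsilon> \<le> \<eta> \<Longrightarrow>
            (\<integral>\<omega>. \<bar>T \<epsilon> \<omega> - L \<omega>\<bar> ^ p \<partial>M) \<le> 2 * (e / 3)"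
          using small[of "e / 3"] by auto
        have "dist (\<integral>\<omega>. \<bar>T \<epsilon> \<omega> - L \<omega>\<bar> ^ p \<partial>M) 0 < e" if "0 < \<epsilon>" "\<epsilon> < \<eta>" for \<epsilon>
        proof -
          have "0 \<le> (\<integral>\<omega>. \<bar>T \<epsilon> \<omega> - L \<omega>\<bar> ^ p \<partial>M)" by simp
          then show ?thesis using \<eta>[of \<epsilon>] that \<open>e > 0\<close> by (simp add: dist_real_def)
        qed
        then show "\<forall>\<^sub>F \<epsilon> in at_right 0. dist (\<integral>\<omega>. \<bar>T \<epsilon> \<omega> - L \<omega>\<bar> ^ p \<partial>M) 0 < e"
          using \<open>\<eta> > 0\<close> by (auto simp: eventually_at_right_field intro!: exI[of _ \<eta>])
      qed
      then have "((\<lambda>\<epsilon>. root p (\<integral>\<omega>. \<bar>T \<epsilon> \<omega> - L \<omega>\<bar> ^ p \<partial>M)) \<longlongrightarrow> root p 0) (at_right 0)"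
        by (rule tendsto_real_root)
      then show "((\<lambda>\<epsilon>. Lp_norm M p (\<lambda>\<omega>. T \<epsilon> \<omega> - L \<omega>)) \<longlongrightarrow> 0) (at_right 0)"
        by (simp add: Lp_norm_def)
    qed
  qed
qed

section \<open>White noise\<close>

lemma white_noise_prob_space: "white_noise M \<xi> \<Longrightarrow> prob_space M"
  by (simp add: white_noise_def)

lemma white_noise_measurable: "white_noise M \<xi> \<Longrightarrow> \<xi> h \<in> borel_measurable M"
  by (simp add: white_noise_def)

lemma white_noise_scaleR: "white_noise M \<xi> \<Longrightarrow> AE \<omega> in M. \<xi> (a *\<^sub>R g) \<omega> = a * \<xi> g \<omega>"
proof -
  assume "white_noise M \<xi>"
  then have "AE \<omega> in M. \<xi> (a *\<^sub>R g + 0 *\<^sub>R g) \<omega> = a * \<xi> g \<omega> + 0 * \<xi> g \<omega>"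
    unfolding white_noise_def by blast
  then show ?thesis by simp
qed

lemma white_noise_add: "white_noise M \<xi> \<Longrightarrow> AE \<omega> in M. \<xi> (g + h) \<omega> = \<xi> g \<omega> + \<xi> h \<omega>"
proof -
  assume "white_noise M \<xi>"
  then have "AE \<omega> in M. \<xi> (1 *\<^sub>R g + 1 *\<^sub>R h) \<omega> = 1 * \<xi> g \<omega> + 1 * \<xi> h \<omega>"
    unfolding white_noise_def by blast
  then show ?thesis by simp
qed

lemma white_noise_diff: "white_noise M \<xi> \<Longrightarrow> AE \<omega> in M. \<xi> (g - h) \<omega> = \<xi> g \<omega> - \<xi> h \<omega>"
proof -
  assume "white_noise M \<xi>"
  then have "AE \<omega> in M. \<xi> (1 *\<^sub>R g + (-1) *\<^sub>R h) \<omega> = 1 * \<xi> g \<omega> + (-1) * \<xi> h \<omega>"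
    unfolding white_noise_def by blast
  then show ?thesis by simp
qed

lemma white_noise_sum:
  assumes w: "white_noise M \<xi>" and "finite I"
  shows "AE \<omega> in M. \<xi> (\<Sum>i\<in>I. h i) \<omega> = (\<Sum>i\<in>I. \<xi> (h i) \<omega>)"
  using assms(2)
proof (induction I rule: finite_induct)
  case empty
  then show ?case using white_noise_scaleR[OF w, of 0 0] by simp
next
  case (insert i I)
  from white_noise_add[OF w, of "h i" "\<Sum>i\<in>I. h i"] insert.IH show ?case
    by eventually_elim (simp add: insert.hyps)
qed

lemma white_noise_distr_unit:
  assumes w: "white_noise M \<xi>" and h: "norm h = 1"
  shows "distr M borel (\<xi> h) = std_normal_distribution"
proof -
  have "distr M borel (\<xi> h) = centered_gaussian ((norm h)\<^sup>2)"
    using w unfolding white_noise_def by blast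
  then show ?thesis using h by (simp add: centered_gaussian_def)
qed

text \<open>
  By linearity, the general case reduces to unit vectors, where the distribution is standard normal.
\<close>

lemma white_noise_char:
  assumes w: "white_noise M \<xi>"
  shows "(\<integral>\<omega>. cis (\<xi> h \<omega>) \<partial>M) = complex_of_real (exp (- (norm h)\<^sup>2 / 2))"
proof (cases "h = 0")
  case True
  interpret prob_space M by (rule white_noise_prob_space[OF w])
  note [measurable] = white_noise_measurable[OF w]
  have "AE \<omega> in M. \<xi> h \<omega> = 0" using white_noise_scaleR[OF w, of 0 0] True by simp
  then have "(\<integral>\<omega>. cis (\<xi> h \<omega>) \<partial>M) = (\<integral>\<omega>. 1 \<partial>M)"
    unfolding cis_conv_exp by (intro integral_cong_AE) (auto elim: eventually_mono)
  then show ?thesis using True by (simp add: prob_space)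
next
  case False
  note [measurable] = white_noise_measurable[OF w]
  define g where "g = inverse (norm h) *\<^sub>R h"
  have g: "norm g = 1" "h = norm h *\<^sub>R g" using False by (auto simp: g_def)
  have "AE \<omega> in M. \<xi> h \<omega> = norm h * \<xi> g \<omega>"
    using white_noise_scaleR[OF w, of "norm h" g] g(2) by simp
  then have "(\<integral>\<omega>. cis (\<xi> h \<omega>) \<partial>M) = (\<integral>\<omega>. iexp (norm h * \<xi> g \<omega>) \<partial>M)"
    unfolding cis_conv_exp by (intro integral_cong_AE) (auto elim: eventually_mono)
  also have "\<dots> = (\<integral>x. iexp (norm h * x) \<partial>distr M borel (\<xi> g))"
    by (subst integral_distr) auto
  also have "\<dots> = char std_normal_distribution (norm h)"
    unfolding white_noise_distr_unit[OF w g(1)] char_def ..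
  also have "\<dots> = complex_of_real (exp (- (norm h)\<^sup>2 / 2))"
    by (simp add: char_std_normal_distribution)
  finally show ?thesis .
qed

lemma white_noise_second_moment:
  assumes w: "white_noise M \<xi>"
  shows "(\<integral>\<^sup>+\<omega>. ennreal ((\<xi> h \<omega>)\<^sup>2) \<partial>M) = ennreal ((norm h)\<^sup>2)"
proof (cases "h = 0")
  case True
  have "AE \<omega> in M. \<xi> h \<omega> = 0" using white_noise_scaleR[OF w, of 0 0] True by simp
  then have "(\<integral>\<^sup>+\<omega>. ennreal ((\<xi> h \<omega>)\<^sup>2) \<partial>M) = (\<integral>\<^sup>+\<omega>. 0 \<partial>M)"
    by (intro nn_integral_cong_AE) (auto elim: eventually_mono)
  then show ?thesis using True by simp
next
  case False
  note [measurable] = white_noise_measurable[OF w]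
  define g where "g = inverse (norm h) *\<^sub>R h"
  have g: "norm g = 1" "h = norm h *\<^sub>R g" using False by (auto simp: g_def)
  have "AE \<omega> in M. \<xi> h \<omega> = norm h * \<xi> g \<omega>"
    using white_noise_scaleR[OF w, of "norm h" g] g(2) by simp
  then have "(\<integral>\<^sup>+\<omega>. ennreal ((\<xi> h \<omega>)\<^sup>2) \<partial>M) = (\<integral>\<^sup>+\<omega>. ennreal ((norm h)\<^sup>2) * ennreal ((\<xi> g \<omega>)\<^sup>2) \<partial>M)"
    by (intro nn_integral_cong_AE) (auto elim!: eventually_mono simp: power_mult_distrib ennreal_mult)
  also have "\<dots> = ennreal ((norm h)\<^sup>2) * (\<integral>\<^sup>+\<omega>. ennreal ((\<xi> g \<omega>)\<^sup>2) \<partial>M)"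
    by (rule nn_integral_cmult) measurable
  also have "(\<integral>\<^sup>+\<omega>. ennreal ((\<xi> g \<omega>)\<^sup>2) \<partial>M) = (\<integral>\<^sup>+x. ennreal (x\<^sup>2) \<partial>distr M borel (\<xi> g))"
    by (subst nn_integral_distr) auto
  also have "\<dots> = 1"
  proof -
    have m: "has_bochner_integral lborel (\<lambda>x. std_normal_density x * x ^ (2 * 1)) (fact (2 * 1) / (2 ^ 1 * fact 1))"
      by (rule std_normal_moment_even)
    have "(\<integral>\<^sup>+x. ennreal (x\<^sup>2) \<partial>std_normal_distribution)
        = (\<integral>\<^sup>+x. ennreal (std_normal_density x * x\<^sup>2) \<partial>lborel)"
      by (subst nn_integral_density) (auto simp: ennreal_mult)
    also have "\<dots> = ennreal (\<integral>x. std_normal_density x * x\<^sup>2 \<partial>lborel)"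
      using m by (intro nn_integral_eq_integral) (auto simp: has_bochner_integral_iff)
    also have "(\<integral>x. std_normal_density x * x\<^sup>2 \<partial>lborel) = 1"
      using m by (auto simp: has_bochner_integral_iff)
    finally show ?thesis unfolding white_noise_distr_unit[OF w g(1)] by simp
  qed
  finally show ?thesis by simp
qed

text \<open>
  The process is \<open>1/2\<close>-Hoelder in mean square, so its values at the dyadic points to the left of \<open>t\<close> converge to
  its value at \<open>t\<close> with summable mean square errors, hence almost surely. The approximations depend on \<open>t\<close> through
  countably many values and are therefore jointly measurable, and so is their limit.
\<close>

lemma measurable_version_exists:
  fixes A :: "L2_unit \<Rightarrow> L2_unit"
  assumes A: "bounded_linear A" and w: "white_noise M \<xi>"
  shows "\<exists>x. measurable_version M (\<lambda>t. \<xi> (A (L2_indicator t))) x"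
proof -
  note [measurable] = white_noise_measurable[OF w]
  \<comment> \<open>The dyadic point of level \<open>n\<close> to the left of \<open>t\<close>.\<close>
  define d where "d n t = \<lfloor>t * 2 ^ n\<rfloor> / 2 ^ n" for n :: nat and t :: real
  have d_in: "d n t \<in> {0..1}" if "t \<in> {0..1}" for n t
  proof -
    have "\<lfloor>t * 2 ^ n\<rfloor> \<le> t * 2 ^ n" by linarith
    also have "\<dots> \<le> 1 * 2 ^ n" using that by (intro mult_right_mono) auto
    finally have "\<lfloor>t * 2 ^ n\<rfloor> \<le> (2::real) ^ n" by simp
    then show ?thesis using that by (auto simp: d_def field_simps)
  qed
  have d_close: "\<bar>d n t - t\<bar> \<le> (1 / 2) ^ n" for n t
  proof -
    have "\<bar>real_of_int \<lfloor>t * 2 ^ n\<rfloor> - t * 2 ^ n\<bar> \<le> 1" by linarith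
    moreover have "d n t - t = (real_of_int \<lfloor>t * 2 ^ n\<rfloor> - t * 2 ^ n) / 2 ^ n"
      by (simp add: d_def field_simps)
    ultimately show ?thesis by (simp add: abs_divide power_divide divide_right_mono)
  qed
  define y where "y t = \<xi> (A (L2_indicator t))" for t
  have [measurable]: "y t \<in> borel_measurable M" for t unfolding y_def by measurable
  define X where "X n t \<omega> = y (d n t) \<omega>" for n t \<omega>
  define x where "x t \<omega> = lim (\<lambda>n. X n t \<omega>)" for t \<omega>
  have X_meas: "(\<lambda>(t, \<omega>). X n t \<omega>) \<in> borel_measurable (borel \<Otimes>\<^sub>M M)" for n
  proof -
    have "(\<lambda>p. y (real_of_int \<lfloor>fst p * (2::real) ^ n\<rfloor> / 2 ^ n) (snd p)) \<in> borel_measurable (borel \<Otimes>\<^sub>M M)"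
      by (rule measurable_compose_countable[where f = "\<lambda>k p. y (real_of_int k / 2 ^ n) (snd p)"
          and g = "\<lambda>p. \<lfloor>fst p * (2::real) ^ n\<rfloor>"]) measurable
    then show ?thesis by (simp add: X_def d_def case_prod_unfold)
  qed
  have "measurable_version M y x"
    unfolding measurable_version_def
  proof (intro conjI ballI)
    have [measurable]: "(\<lambda>p. X n (fst p) (snd p)) \<in> borel_measurable (restrict_space borel {0..1} \<Otimes>\<^sub>M M)" for n
    proof -
      have "(\<lambda>p. fst p) \<in> borel_measurable (restrict_space borel {0..1::real} \<Otimes>\<^sub>M M)"
        by (rule measurable_compose[OF measurable_fst measurable_restrict_space1]) simp
      then have "(\<lambda>p. (fst p, snd p)) \<in> measurable (restrict_space borel {0..1::real} \<Otimes>\<^sub>M M) (borel \<Otimes>\<^sub>M M)"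
        by (intro measurable_Pair) simp_all
      from measurable_compose[OF this X_meas[of n]] show ?thesis by simp
    qed
    show "(\<lambda>(t, \<omega>). x t \<omega>) \<in> borel_measurable (restrict_space borel {0..1} \<Otimes>\<^sub>M M)"
      unfolding x_def case_prod_unfold by measurable
  next
    fix t :: real assume t: "t \<in> {0..1}"
    obtain K where K: "K > 0" "\<And>v. norm (A v) \<le> norm v * K"
      using bounded_linear.pos_bounded[OF A] by blast
    have lin: "linear A" using A by (rule bounded_linear.linear)
    have moment: "(\<integral>\<^sup>+\<omega>. ennreal ((X n t \<omega> - y t \<omega>)\<^sup>2) \<partial>M) \<le> ennreal (K\<^sup>2 * (1 / 2) ^ n)" for n
    proof -
      let ?v = "L2_indicator (d n t) - L2_indicator t"
      have "(\<integral>\<^sup>+\<omega>. ennreal ((X n t \<omega> - y t \<omega>)\<^sup>2) \<partial>M) = (\<integral>\<^sup>+\<omega>. ennreal ((\<xi> (A ?v) \<omega>)\<^sup>2) \<partial>M)"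
        using white_noise_diff[OF w, of "A (L2_indicator (d n t))" "A (L2_indicator t)"]
        by (intro nn_integral_cong_AE) (auto elim!: eventually_mono simp: X_def y_def linear_diff[OF lin])
      also have "\<dots> = ennreal ((norm (A ?v))\<^sup>2)" by (rule white_noise_second_moment[OF w])
      also have "\<dots> \<le> ennreal (K\<^sup>2 * (1 / 2) ^ n)"
      proof (rule ennreal_leI)
        have "(norm (A ?v))\<^sup>2 \<le> (norm ?v * K)\<^sup>2" by (intro power_mono K) auto
        also have "\<dots> = K\<^sup>2 * \<bar>d n t - t\<bar>"
          using norm_L2_indicator_diff[OF d_in[OF t] t, of n] by (simp add: power_mult_distrib mult.commute)
        also have "\<dots> \<le> K\<^sup>2 * (1 / 2) ^ n" by (intro mult_left_mono d_close) auto
        finally show "(norm (A ?v))\<^sup>2 \<le> K\<^sup>2 * (1 / 2) ^ n" .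
      qed
      finally show ?thesis .
    qed
    have [measurable]: "X n t \<in> borel_measurable M" for n unfolding X_def by measurable
    have "(\<integral>\<^sup>+\<omega>. (\<Sum>n. ennreal ((X n t \<omega> - y t \<omega>)\<^sup>2)) \<partial>M)
        = (\<Sum>n. \<integral>\<^sup>+\<omega>. ennreal ((X n t \<omega> - y t \<omega>)\<^sup>2) \<partial>M)"
      by (rule nn_integral_suminf) measurable
    also have "\<dots> \<le> (\<Sum>n. ennreal (K\<^sup>2 * (1 / 2) ^ n))" by (intro suminf_le moment) auto
    also have "\<dots> < \<infinity>"
    proof -
      have "summable (\<lambda>n. K\<^sup>2 * (1 / 2 :: real) ^ n)" by (intro summable_mult summable_geometric) auto
      then have "(\<Sum>n. ennreal (K\<^sup>2 * (1 / 2) ^ n)) \<noteq> top" by (intro ennreal_suminf_neq_top) auto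
      then show ?thesis by (simp add: less_top)
    qed
    finally have "AE \<omega> in M. (\<Sum>n. ennreal ((X n t \<omega> - y t \<omega>)\<^sup>2)) \<noteq> \<infinity>"
      by (intro nn_integral_PInf_AE) auto
    then show "AE \<omega> in M. x t \<omega> = y t \<omega>"
    proof eventually_elim
      case (elim \<omega>)
      then have "summable (\<lambda>n. (X n t \<omega> - y t \<omega>)\<^sup>2)"
        by (intro summable_suminf_not_top) auto
      then have "(\<lambda>n. (X n t \<omega> - y t \<omega>)\<^sup>2) \<longlonglongrightarrow> 0" by (rule summable_LIMSEQ_zero)
      then have "(\<lambda>n. sqrt ((X n t \<omega> - y t \<omega>)\<^sup>2)) \<longlonglongrightarrow> sqrt 0" by (rule tendsto_real_sqrt)
      then have "(\<lambda>n. X n t \<omega> - y t \<omega>) \<longlonglongrightarrow> 0"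
        by (simp add: tendsto_rabs_zero_iff)
      then have "(\<lambda>n. X n t \<omega>) \<longlonglongrightarrow> y t \<omega>" by (simp add: LIM_zero_iff)
      then show ?case unfolding x_def by (rule limI)
    qed
  qed
  then show ?thesis unfolding y_def by blast
qed

section \<open>Fourier representation of the approximations\<close>

lemma (in pair_sigma_finite) integrable_mult_fst_snd:
  fixes f :: "'a \<Rightarrow> real" and g :: "'b \<Rightarrow> real"
  assumes f: "integrable M1 f" and g: "integrable M2 g"
  shows "integrable (M1 \<Otimes>\<^sub>M M2) (\<lambda>z. f (fst z) * g (snd z))"
proof (rule Fubini_integrable)
  have [measurable]: "f \<in> borel_measurable M1" "g \<in> borel_measurable M2" using f g by auto
  show "(\<lambda>z. f (fst z) * g (snd z)) \<in> borel_measurable (M1 \<Otimes>\<^sub>M M2)" by measurable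
  show "integrable M1 (\<lambda>x. \<integral>y. norm (f (fst (x, y)) * g (snd (x, y))) \<partial>M2)"
    using f g by (simp add: abs_mult)
  show "AE x in M1. integrable M2 (\<lambda>y. f (fst (x, y)) * g (snd (x, y)))"
    using g by simp
qed

lemma integrable_gauss_factor: "\<epsilon> > 0 \<Longrightarrow> integrable lborel (\<lambda>u::real. exp (- \<epsilon> * u\<^sup>2 / 2))"
proof -
  assume e: "\<epsilon> > 0"
  have "integrable lborel (\<lambda>u. sqrt (2 * pi / \<epsilon>) * normal_density 0 (1 / sqrt \<epsilon>) u)"
    by (intro integrable_mult_right integrable_normal_density) (use e in auto)
  also have "(\<lambda>u. sqrt (2 * pi / \<epsilon>) * normal_density 0 (1 / sqrt \<epsilon>) u) = (\<lambda>u. exp (- \<epsilon> * u\<^sup>2 / 2))"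
    using e by (auto simp: normal_density_def power_divide fun_eq_iff mult.commute)
  finally show ?thesis .
qed

text \<open>
  The substitution \<open>u = x / sqrt \<epsilon>\<close> reduces the integral to the characteristic function of the standard normal
  distribution.
\<close>

lemma heat_kernel_fourier:
  assumes e: "\<epsilon> > 0"
  shows "(\<integral>u. complex_of_real (exp (- \<epsilon> * u\<^sup>2 / 2)) * cis (u * z) \<partial>lborel)
     = complex_of_real (2 * pi * heat_kernel \<epsilon> z)"
proof -
  define c where "c = 1 / sqrt \<epsilon>"
  have c: "c > 0" "\<epsilon> * c\<^sup>2 = 1" using e by (auto simp: c_def power_divide)
  have std: "(\<integral>x. std_normal_density x *\<^sub>R cis (t * x) \<partial>lborel) = complex_of_real (exp (- t\<^sup>2 / 2))" for t
  proof -
    have "char std_normal_distribution t = (\<integral>x. std_normal_density x *\<^sub>R cis (t * x) \<partial>lborel)"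
      unfolding char_def cis_conv_exp by (subst integral_density) auto
    then show ?thesis by (simp add: char_std_normal_distribution)
  qed
  have "(\<integral>u. complex_of_real (exp (- \<epsilon> * u\<^sup>2 / 2)) * cis (u * z) \<partial>lborel)
      = \<bar>c\<bar> *\<^sub>R (\<integral>x. complex_of_real (exp (- \<epsilon> * (0 + c * x)\<^sup>2 / 2)) * cis ((0 + c * x) * z) \<partial>lborel)"
    using c by (intro lborel_integral_real_affine) auto
  also have "\<dots> = \<bar>c\<bar> *\<^sub>R (\<integral>x. complex_of_real (sqrt (2 * pi)) * (std_normal_density x *\<^sub>R cis ((c * z) * x)) \<partial>lborel)"
  proof -
    have "complex_of_real (exp (- \<epsilon> * (0 + c * x)\<^sup>2 / 2)) * cis ((0 + c * x) * z)
        = complex_of_real (sqrt (2 * pi)) * (std_normal_density x *\<^sub>R cis ((c * z) * x))" for x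
    proof -
      have "\<epsilon> * (0 + c * x)\<^sup>2 = x\<^sup>2" using c(2) by (simp add: power_mult_distrib mult.assoc[symmetric])
      then have "exp (- \<epsilon> * (0 + c * x)\<^sup>2 / 2) = sqrt (2 * pi) * std_normal_density x"
        by (simp add: std_normal_density_def)
      then show ?thesis by (simp only: scaleR_conv_of_real of_real_mult mult_ac add_0)
    qed
    then show ?thesis by (simp only:)
  qed
  also have "\<dots> = complex_of_real (c * sqrt (2 * pi) * exp (- (c * z)\<^sup>2 / 2))"
    using c(1) by (simp only: integral_mult_right_zero std) (simp add: scaleR_conv_of_real)
  also have "c * sqrt (2 * pi) * exp (- (c * z)\<^sup>2 / 2) = 2 * pi * heat_kernel \<epsilon> z"
  proof -
    have "c * sqrt (2 * pi) = 2 * pi / sqrt (2 * pi * \<epsilon>)"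
    proof -
      have "sqrt (2 * pi) * sqrt (2 * pi) = 2 * pi" by simp
      then show ?thesis using e by (simp add: c_def real_sqrt_mult field_simps)
    qed
    moreover have "(c * z)\<^sup>2 / 2 = z\<^sup>2 / (2 * \<epsilon>)"
      using e by (simp add: c_def power_mult_distrib power_divide)
    ultimately show ?thesis by (simp add: heat_kernel_def)
  qed
  finally show ?thesis .
qed

definition gauss_weight :: "nat \<Rightarrow> real \<Rightarrow> (nat \<Rightarrow> real) \<Rightarrow> real" where
  "gauss_weight n \<epsilon> u = (\<Prod>i\<in>{1..n}. exp (- \<epsilon> * (u i)\<^sup>2 / 2))"

lemma gauss_weight_measurable [measurable]:
  "gauss_weight n \<epsilon> \<in> borel_measurable (\<Pi>\<^sub>M i\<in>{1..n}. lborel)"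
  unfolding gauss_weight_def by measurable

lemma gauss_weight_bounds: "\<epsilon> \<ge> 0 \<Longrightarrow> 0 \<le> gauss_weight n \<epsilon> u" "\<epsilon> \<ge> 0 \<Longrightarrow> gauss_weight n \<epsilon> u \<le> 1"
  unfolding gauss_weight_def by (auto intro!: prod_nonneg prod_le_1)

lemma gauss_weight_antimono: "\<epsilon> \<le> \<eta> \<Longrightarrow> gauss_weight n \<eta> u \<le> gauss_weight n \<epsilon> u"
  unfolding gauss_weight_def by (auto intro!: prod_mono mult_right_mono)

lemma gauss_weight_tendsto:
  assumes "\<epsilon> \<longlonglongrightarrow> 0"
  shows "(\<lambda>m. gauss_weight n (\<epsilon> m) u) \<longlonglongrightarrow> 1"
proof -
  have "(\<lambda>m. gauss_weight n (\<epsilon> m) u) \<longlonglongrightarrow> (\<Prod>i\<in>{1..n}. exp (- 0 * (u i)\<^sup>2 / 2))"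
    unfolding gauss_weight_def by (intro tendsto_intros assms) auto
  then show ?thesis by simp
qed

lemma time_simplex_measurable [measurable]:
  "time_simplex k \<in> sets (\<Pi>\<^sub>M i\<in>{1..k}. lborel)"
proof -
  have "time_simplex k = {t \<in> space (\<Pi>\<^sub>M i\<in>{1..k}. lborel :: real measure).
      (\<forall>i\<in>{1..k}. t i \<in> {0..1}) \<and> (\<forall>i\<in>{1..<k}. t i \<le> t (i + 1))}"
    by (auto simp: time_simplex_def space_PiM PiE_iff)
  also have "\<dots> \<in> sets (\<Pi>\<^sub>M i\<in>{1..k}. lborel)"
    unfolding pred_def[symmetric]
  proof (intro pred_intros_logic pred_intros_finite)
    fix i assume i: "i \<in> {1..<k}"
    have m: "(\<lambda>t. t i) \<in> borel_measurable (\<Pi>\<^sub>M i\<in>{1..k}. lborel :: real measure)"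
      "(\<lambda>t. t (i + 1)) \<in> borel_measurable (\<Pi>\<^sub>M i\<in>{1..k}. lborel :: real measure)"
      using i measurable_component_singleton[of i "{1..k}" "\<lambda>_. lborel :: real measure"]
        measurable_component_singleton[of "i + 1" "{1..k}" "\<lambda>_. lborel :: real measure"] by auto
    show "Measurable.pred (\<Pi>\<^sub>M i\<in>{1..k}. lborel :: real measure) (\<lambda>t. t i \<le> t (i + 1))"
      unfolding pred_def using m by (rule borel_measurable_le)
  qed measurable
  finally show ?thesis .
qed

lemma indicator_time_simplex_le: "indicator (time_simplex k) t \<le> enn2real (unit_box k t)"
  unfolding unit_box_eq by (auto simp: time_simplex_def indicator_def PiE_iff)

lemma integrable_time_simplex:
  "integrable (\<Pi>\<^sub>M i\<in>{1..k}. lborel) (indicator (time_simplex k) :: (nat \<Rightarrow> real) \<Rightarrow> real)"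
proof (rule Bochner_Integration.integrable_bound)
  show "integrable (\<Pi>\<^sub>M i\<in>{1..k}. lborel) (\<lambda>t. \<Prod>i\<in>{1..k}. indicat_real {0..1::real} (t i))"
    by (rule lborel_index.product_integrable_prod[where f = "\<lambda>_. indicat_real {0..1}"]) auto
  show "AE t in \<Pi>\<^sub>M i\<in>{1..k}. lborel. norm (indicat_real (time_simplex k) t)
      \<le> norm (\<Prod>i\<in>{1..k}. indicat_real {0..1::real} (t i))"
    by (rule AE_I2) (auto simp: time_simplex_def indicator_def PiE_iff intro!: prod.neutral)
qed measurable

lemma integrable_gauss_weight:
  assumes "\<epsilon> > 0"
  shows "integrable (\<Pi>\<^sub>M i\<in>{1..n}. lborel) (gauss_weight n \<epsilon>)"
  unfolding gauss_weight_def
  by (rule lborel_index.product_integrable_prod) (use integrable_gauss_factor[OF assms] in auto)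

text \<open>
  The dependence on \<open>\<epsilon>\<close> of the Fourier representation is confined to this weight, which increases to the indicator of
  the simplex as \<open>\<epsilon>\<close> decreases to \<open>0\<close>.
\<close>

definition fourier_weight :: "nat \<Rightarrow> real \<Rightarrow> (nat \<Rightarrow> real) \<times> (nat \<Rightarrow> real) \<Rightarrow> real" where
  "fourier_weight n \<epsilon> y = indicator (time_simplex (Suc n)) (fst y) * gauss_weight n \<epsilon> (snd y)"

lemma integrable_fourier_weight:
  assumes "\<epsilon> > 0"
  shows "integrable (path_space n) (fourier_weight n \<epsilon>)"
proof -
  interpret pair_sigma_finite "\<Pi>\<^sub>M i\<in>{1..Suc n}. lborel :: real measure" "\<Pi>\<^sub>M i\<in>{1..n}. lborel :: real measure"
    by (intro pair_sigma_finite.intro sigma_finite_lborel_PiM) auto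
  show ?thesis unfolding fourier_weight_def
    by (intro integrable_mult_fst_snd integrable_time_simplex integrable_gauss_weight assms)
qed

definition path_phase :: "(real \<Rightarrow> 'w \<Rightarrow> real) \<Rightarrow> nat \<Rightarrow> (nat \<Rightarrow> real) \<times> (nat \<Rightarrow> real) \<Rightarrow> 'w \<Rightarrow> real" where
  "path_phase X n y \<omega> = (\<Sum>i\<in>{1..n}. snd y i * (X (fst y (Suc i)) \<omega> - X (fst y i) \<omega>))"

lemma path_phase_measurable:
  assumes X: "(\<lambda>(t, \<omega>). X t \<omega>) \<in> borel_measurable (borel \<Otimes>\<^sub>M M)"
    and g: "g \<in> measurable N (path_space n)" and h: "h \<in> measurable N M"
  shows "(\<lambda>x. path_phase X n (g x) (h x)) \<in> borel_measurable N"
  unfolding path_phase_def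
proof (intro borel_measurable_sum borel_measurable_times borel_measurable_diff)
  have 1: "(\<lambda>x. X (fst (g x) j) (h x)) \<in> borel_measurable N" if j: "j \<in> {1..Suc n}" for j
  proof -
    have "(\<lambda>x. fst (g x) j) \<in> borel_measurable N"
      using measurable_compose[OF g measurable_compose[OF measurable_fst measurable_component_singleton[OF j]]]
      by simp
    then have "(\<lambda>x. (fst (g x) j, h x)) \<in> measurable N (borel \<Otimes>\<^sub>M M)"
      using h by (intro measurable_Pair)
    from measurable_compose[OF this X] show ?thesis by simp
  qed
  fix i assume i: "i \<in> {1..n}"
  show "(\<lambda>x. snd (g x) i) \<in> borel_measurable N"
    using measurable_compose[OF g measurable_compose[OF measurable_snd measurable_component_singleton[OF i]]]
    by simp
  show "(\<lambda>x. X (fst (g x) (Suc i)) (h x)) \<in> borel_measurable N" "(\<lambda>x. X (fst (g x) i) (h x)) \<in> borel_measurable N"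
    using i by (auto intro!: 1)
qed

lemma cis_measurable [measurable]: "cis \<in> borel_measurable borel"
  by (intro borel_measurable_continuous_onI continuous_intros)

lemma integrable_weight_cis:
  assumes f: "integrable N f" and g: "g \<in> borel_measurable N"
  shows "integrable N (\<lambda>x. complex_of_real (f x) * cis (g x))"
proof (rule Bochner_Integration.integrable_bound[OF f])
  note [measurable] = borel_measurable_integrable[OF f] g
  show "(\<lambda>x. complex_of_real (f x) * cis (g x)) \<in> borel_measurable N" by measurable
qed (simp add: norm_mult)

text \<open>
  Each heat kernel is written as the Fourier integral of a Gaussian; by Fubini, the approximation is the integral of a
  unimodular function of the process over times and frequencies.
\<close>

lemma approx_fourier:
  assumes X: "(\<lambda>(t, \<omega>). X t \<omega>) \<in> borel_measurable (borel \<Otimes>\<^sub>M M)"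
    and x: "\<And>t. t \<in> {0..1} \<Longrightarrow> X t \<omega> = x t \<omega>" and e: "\<epsilon> > 0" and \<omega>: "\<omega> \<in> space M"
  shows "complex_of_real (approx_self_intersection_local_time x (Suc n) \<epsilon> \<omega>) =
    complex_of_real ((1 / (2 * pi)) ^ n) *
      (\<integral>y. complex_of_real (fourier_weight n \<epsilon> y) * cis (path_phase X n y \<omega>) \<partial>path_space n)"
proof -
  let ?T = "\<Pi>\<^sub>M i\<in>{1..Suc n}. lborel :: real measure" and ?U = "\<Pi>\<^sub>M i\<in>{1..n}. lborel :: real measure"
  interpret pair_sigma_finite ?T ?U
    by (intro pair_sigma_finite.intro sigma_finite_lborel_PiM) auto
  let ?z = "\<lambda>t i. X (t (Suc i)) \<omega> - X (t i) \<omega>"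
  let ?h = "\<lambda>t. \<Prod>i\<in>{1..n}. heat_kernel \<epsilon> (?z t i)"
  have "(\<lambda>y. path_phase X n y \<omega>) \<in> borel_measurable (path_space n)"
    using \<omega> by (intro path_phase_measurable[OF X]) auto
  then have int: "integrable (path_space n) (\<lambda>y. complex_of_real (fourier_weight n \<epsilon> y) * cis (path_phase X n y \<omega>))"
    by (rule integrable_weight_cis[OF integrable_fourier_weight[OF e]])
  have "(\<integral>y. complex_of_real (fourier_weight n \<epsilon> y) * cis (path_phase X n y \<omega>) \<partial>path_space n)
     = (\<integral>t. \<integral>u. complex_of_real (fourier_weight n \<epsilon> (t, u)) * cis (path_phase X n (t, u) \<omega>) \<partial>?U \<partial>?T)"
    by (rule integral_fst'[OF int, symmetric])
  also have "\<dots> = (\<integral>t. complex_of_real ((2 * pi) ^ n * (indicator (time_simplex (Suc n)) t * ?h t)) \<partial>?T)"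
  proof (rule Bochner_Integration.integral_cong[OF refl])
    fix t
    have "complex_of_real (fourier_weight n \<epsilon> (t, u)) * cis (path_phase X n (t, u) \<omega>) =
        complex_of_real (indicator (time_simplex (Suc n)) t) *
          (\<Prod>i\<in>{1..n}. complex_of_real (exp (- \<epsilon> * (u i)\<^sup>2 / 2)) * cis (u i * ?z t i))" for u
      by (simp add: fourier_weight_def gauss_weight_def path_phase_def prod.distrib cis_conv_exp
          exp_sum sum_distrib_left of_real_prod)
    then have "(\<integral>u. complex_of_real (fourier_weight n \<epsilon> (t, u)) * cis (path_phase X n (t, u) \<omega>) \<partial>?U)
      = complex_of_real (indicator (time_simplex (Suc n)) t) *
        (\<integral>u. (\<Prod>i\<in>{1..n}. complex_of_real (exp (- \<epsilon> * (u i)\<^sup>2 / 2)) * cis (u i * ?z t i)) \<partial>?U)"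
      by (simp only: integral_mult_right_zero)
    also have "(\<integral>u. (\<Prod>i\<in>{1..n}. complex_of_real (exp (- \<epsilon> * (u i)\<^sup>2 / 2)) * cis (u i * ?z t i)) \<partial>?U)
      = (\<Prod>i\<in>{1..n}. \<integral>v. complex_of_real (exp (- \<epsilon> * v\<^sup>2 / 2)) * cis (v * ?z t i) \<partial>lborel)"
    proof (rule lborel_index.product_integral_prod[where f = "\<lambda>i v. complex_of_real (exp (- \<epsilon> * v\<^sup>2 / 2)) * cis (v * ?z t i)"])
      show "integrable lborel (\<lambda>v. complex_of_real (exp (- \<epsilon> * v\<^sup>2 / 2)) * cis (v * ?z t i))" for i
        by (intro integrable_weight_cis integrable_gauss_factor e) measurable
    qed simp
    also have "\<dots> = (\<Prod>i\<in>{1..n}. complex_of_real (2 * pi * heat_kernel \<epsilon> (?z t i)))"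
      by (simp only: heat_kernel_fourier[OF e])
    finally show "(\<integral>u. complex_of_real (fourier_weight n \<epsilon> (t, u)) * cis (path_phase X n (t, u) \<omega>) \<partial>?U)
      = complex_of_real ((2 * pi) ^ n * (indicator (time_simplex (Suc n)) t * ?h t))"
      by (simp add: prod.distrib of_real_prod mult_ac)
  qed
  also have "\<dots> = complex_of_real ((2 * pi) ^ n * (\<integral>t. indicator (time_simplex (Suc n)) t * ?h t \<partial>?T))"
    by (simp only: integral_complex_of_real integral_mult_right_zero)
  also have "(\<integral>t. indicator (time_simplex (Suc n)) t * ?h t \<partial>?T) =
      approx_self_intersection_local_time x (Suc n) \<epsilon> \<omega>"
    unfolding approx_self_intersection_local_time_def set_lebesgue_integral_def
  proof (rule Bochner_Integration.integral_cong[OF refl])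
    fix t
    show "indicator (time_simplex (Suc n)) t * ?h t = indicat_real (time_simplex (Suc n)) t *\<^sub>R
        (\<Prod>i\<in>{1..<Suc n}. heat_kernel \<epsilon> (x (t (i + 1)) \<omega> - x (t i) \<omega>))"
    proof (cases "t \<in> time_simplex (Suc n)")
      case True
      then have "t i \<in> {0..1}" if "i \<in> {1..Suc n}" for i using that by (auto simp: time_simplex_def PiE_iff)
      then have "?z t i = x (t (i + 1)) \<omega> - x (t i) \<omega>" if "i \<in> {1..n}" for i
        using that by (simp add: x)
      then show ?thesis by (simp add: atLeastLessThanSuc_atLeastAtMost)
    qed simp
  qed
  finally show ?thesis by (simp add: power_divide)
qed

section \<open>Moments of differences and the local time\<close>

text \<open>
  The exceptional sets in the linearity of the noise depend on the vectors. Here times and frequencies are fixed,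
  so that only finitely many of them have to be discarded.
\<close>

lemma phase_sum_eq:
  fixes A :: "L2_unit \<Rightarrow> L2_unit"
  assumes A: "linear A" and w: "white_noise M \<xi>"
    and X: "\<And>t. AE \<omega> in M. X t \<omega> = \<xi> (A (L2_indicator (unit_clamp t))) \<omega>"
    and "finite J"
  shows "AE \<omega> in M. (\<Sum>j\<in>J. path_phase X n (y j) \<omega>) = \<xi> (A (\<Sum>j\<in>J. path_vec n (y j))) \<omega>"
proof -
  let ?e = "\<lambda>t. L2_indicator (unit_clamp t)"
  have one: "AE \<omega> in M. u * (X s \<omega> - X t \<omega>) = \<xi> (A (u *\<^sub>R (?e s - ?e t))) \<omega>" for u s t
    using X[of s] X[of t] white_noise_diff[OF w, of "A (?e s)" "A (?e t)"]
      white_noise_scaleR[OF w, of u "A (?e s) - A (?e t)"]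
    by eventually_elim (simp add: linear_diff[OF A] linear_scale[OF A])
  have path: "AE \<omega> in M. path_phase X n y \<omega> = \<xi> (A (path_vec n y)) \<omega>" for y
  proof -
    have "AE \<omega> in M. \<forall>i\<in>{1..n}. snd y i * (X (fst y (Suc i)) \<omega> - X (fst y i) \<omega>)
        = \<xi> (A (snd y i *\<^sub>R (?e (fst y (Suc i)) - ?e (fst y i)))) \<omega>"
      by (intro AE_finite_allI one) simp
    moreover have "AE \<omega> in M. \<xi> (\<Sum>i\<in>{1..n}. A (snd y i *\<^sub>R (?e (fst y (Suc i)) - ?e (fst y i)))) \<omega>
       = (\<Sum>i\<in>{1..n}. \<xi> (A (snd y i *\<^sub>R (?e (fst y (Suc i)) - ?e (fst y i)))) \<omega>)"
      by (rule white_noise_sum[OF w]) simp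
    ultimately show ?thesis
      by eventually_elim (simp add: path_phase_def path_vec_def linear_sum[OF A])
  qed
  have "AE \<omega> in M. \<forall>j\<in>J. path_phase X n (y j) \<omega> = \<xi> (A (path_vec n (y j))) \<omega>"
    by (intro AE_finite_allI path assms)
  moreover have "AE \<omega> in M. \<xi> (\<Sum>j\<in>J. A (path_vec n (y j))) \<omega> = (\<Sum>j\<in>J. \<xi> (A (path_vec n (y j))) \<omega>)"
    by (rule white_noise_sum[OF w assms(4)])
  ultimately show ?thesis
    by eventually_elim (simp add: linear_sum[OF A])
qed

lemma phase_sum_char:
  fixes A :: "L2_unit \<Rightarrow> L2_unit"
  assumes A: "linear A" and w: "white_noise M \<xi>"
    and X: "\<And>t. AE \<omega> in M. X t \<omega> = \<xi> (A (L2_indicator (unit_clamp t))) \<omega>"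
    and J: "finite J" and meas: "(\<lambda>\<omega>. \<Sum>j\<in>J. path_phase X n (y j) \<omega>) \<in> borel_measurable M"
  shows "(\<integral>\<omega>. cis (\<Sum>j\<in>J. path_phase X n (y j) \<omega>) \<partial>M)
     = complex_of_real (exp (- (norm (A (\<Sum>j\<in>J. path_vec n (y j))))\<^sup>2 / 2))"
proof -
  note [measurable] = white_noise_measurable[OF w] meas
  have "(\<integral>\<omega>. cis (\<Sum>j\<in>J. path_phase X n (y j) \<omega>) \<partial>M)
      = (\<integral>\<omega>. cis (\<xi> (A (\<Sum>j\<in>J. path_vec n (y j))) \<omega>) \<partial>M)"
    using phase_sum_eq[OF A w X J, of n y] by (intro integral_cong_AE) (auto elim!: eventually_mono)
  then show ?thesis by (simp add: white_noise_char[OF w])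
qed

text \<open>
  The \<open>p\<close>-th power of an integral is an integral over \<open>p\<close> independent copies of the variables. After Fubini the
  expectation acts on a single exponential, whose exponent is Gaussian.
\<close>

lemma moment_of_phase_integral:
  fixes A :: "L2_unit \<Rightarrow> L2_unit" and \<phi> :: "(nat \<Rightarrow> real) \<times> (nat \<Rightarrow> real) \<Rightarrow> real" and p :: nat
  assumes A: "linear A" and w: "white_noise M \<xi>"
    and Xm: "(\<lambda>(t, \<omega>). X t \<omega>) \<in> borel_measurable (borel \<Otimes>\<^sub>M M)"
    and X: "\<And>t. AE \<omega> in M. X t \<omega> = \<xi> (A (L2_indicator (unit_clamp t))) \<omega>"
    and \<phi>: "integrable (path_space n) \<phi>"
  shows "(\<integral>\<omega>. (\<integral>y. complex_of_real (\<phi> y) * cis (path_phase X n y \<omega>) \<partial>path_space n) ^ p \<partial>M)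
    = (\<integral>y. complex_of_real ((\<Prod>j\<in>{..<p}. \<phi> (y j)) *
        exp (- (norm (A (\<Sum>j\<in>{..<p}. path_vec n (y j))))\<^sup>2 / 2)) \<partial>(\<Pi>\<^sub>M j\<in>{..<p}. path_space n))"
proof -
  interpret prob_space M by (rule white_noise_prob_space[OF w])
  let ?Z = "\<Pi>\<^sub>M j\<in>{..<p}. path_space n"
  interpret Z: sigma_finite_measure ?Z by (rule path_index.sigma_finite) simp
  interpret ZM: pair_sigma_finite ?Z M ..
  note phase_m = path_phase_measurable[OF Xm]
  have comp: "(\<lambda>y. y j) \<in> measurable ?Z (path_space n)" if "j \<in> {..<p}" for j
    using that by (rule measurable_component_singleton)
  let ?f = "\<lambda>y \<omega>. complex_of_real (\<Prod>j\<in>{..<p}. \<phi> (y j)) * cis (\<Sum>j\<in>{..<p}. path_phase X n (y j) \<omega>)"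
  have prod_int: "integrable ?Z (\<lambda>y. \<Prod>j\<in>{..<p}. \<phi> (y j))"
    by (rule path_index.product_integrable_prod[where f = "\<lambda>_. \<phi>"]) (use \<phi> in auto)
  have sum_m: "(\<lambda>z. \<Sum>j\<in>{..<p}. path_phase X n (fst z j) (snd z)) \<in> borel_measurable (?Z \<Otimes>\<^sub>M M)"
    by (intro borel_measurable_sum phase_m measurable_snd measurable_compose[OF measurable_fst comp])
  have pow: "(\<integral>y. complex_of_real (\<phi> y) * cis (path_phase X n y \<omega>) \<partial>path_space n) ^ p = (\<integral>y. ?f y \<omega> \<partial>?Z)"
    if \<omega>: "\<omega> \<in> space M" for \<omega>
  proof -
    have m: "(\<lambda>y. path_phase X n y \<omega>) \<in> borel_measurable (path_space n)"
      using \<omega> by (intro phase_m) auto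
    have "(\<integral>y. complex_of_real (\<phi> y) * cis (path_phase X n y \<omega>) \<partial>path_space n) ^ p
       = (\<Prod>j\<in>{..<p}. \<integral>y. complex_of_real (\<phi> y) * cis (path_phase X n y \<omega>) \<partial>path_space n)" by simp
    also have "\<dots> = (\<integral>y. (\<Prod>j\<in>{..<p}. complex_of_real (\<phi> (y j)) * cis (path_phase X n (y j) \<omega>)) \<partial>?Z)"
      by (rule path_index.product_integral_prod[symmetric, where f = "\<lambda>_ y. complex_of_real (\<phi> y) * cis (path_phase X n y \<omega>)"])
        (use integrable_weight_cis[OF \<phi> m] in auto)
    also have "\<dots> = (\<integral>y. ?f y \<omega> \<partial>?Z)"
      by (simp add: prod.distrib cis_conv_exp exp_sum sum_distrib_left of_real_prod)
    finally show ?thesis .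
  qed
  have int: "integrable (?Z \<Otimes>\<^sub>M M) (\<lambda>(y, \<omega>). ?f y \<omega>)"
  proof (rule ZM.Fubini_integrable)
    show "(\<lambda>(y, \<omega>). ?f y \<omega>) \<in> borel_measurable (?Z \<Otimes>\<^sub>M M)"
    proof -
      note [measurable] = sum_m borel_measurable_integrable[OF prod_int]
      show ?thesis unfolding case_prod_unfold by measurable
    qed
    show "integrable ?Z (\<lambda>y. \<integral>\<omega>. norm (case (y, \<omega>) of (y, \<omega>) \<Rightarrow> ?f y \<omega>) \<partial>M)"
      using integrable_norm[OF prod_int] by (simp add: norm_mult prob_space del: of_real_prod)
    have "integrable M (\<lambda>\<omega>. ?f y \<omega>)" if y: "y \<in> space ?Z" for y
    proof (intro integrable_weight_cis integrable_const borel_measurable_sum phase_m measurable_const measurable_ident_sets refl)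
      show "y j \<in> space (path_space n)" if "j \<in> {..<p}" for j
        using y that by (auto simp: space_PiM PiE_iff)
    qed
    then show "AE y in ?Z. integrable M (\<lambda>\<omega>. case (y, \<omega>) of (y, \<omega>) \<Rightarrow> ?f y \<omega>)"
      by (intro AE_I2) auto
  qed
  have "(\<integral>\<omega>. (\<integral>y. complex_of_real (\<phi> y) * cis (path_phase X n y \<omega>) \<partial>path_space n) ^ p \<partial>M)
      = (\<integral>\<omega>. \<integral>y. ?f y \<omega> \<partial>?Z \<partial>M)"
    by (rule Bochner_Integration.integral_cong[OF refl pow])
  also have "\<dots> = (\<integral>y. \<integral>\<omega>. ?f y \<omega> \<partial>M \<partial>?Z)" by (rule ZM.Fubini_integral[OF int])
  also have "\<dots> = (\<integral>y. complex_of_real ((\<Prod>j\<in>{..<p}. \<phi> (y j)) *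
        exp (- (norm (A (\<Sum>j\<in>{..<p}. path_vec n (y j))))\<^sup>2 / 2)) \<partial>?Z)"
  proof (rule Bochner_Integration.integral_cong[OF refl])
    fix y assume y: "y \<in> space ?Z"
    have "(\<lambda>\<omega>. \<Sum>j\<in>{..<p}. path_phase X n (y j) \<omega>) \<in> borel_measurable M"
    proof (intro borel_measurable_sum phase_m measurable_const measurable_ident_sets refl)
      show "y j \<in> space (path_space n)" if "j \<in> {..<p}" for j
        using y that by (auto simp: space_PiM PiE_iff)
    qed
    then show "(\<integral>\<omega>. ?f y \<omega> \<partial>M) = complex_of_real ((\<Prod>j\<in>{..<p}. \<phi> (y j)) *
        exp (- (norm (A (\<Sum>j\<in>{..<p}. path_vec n (y j))))\<^sup>2 / 2))"
      by (simp only: integral_mult_right_zero phase_sum_char[OF A w X finite_lessThan] of_real_mult)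
  qed
  finally show ?thesis .
qed

text \<open>
  A majorant of the integrand of the moments of \<open>T\<^sub>\<epsilon> - T\<^sub>\<delta>\<close>, valid simultaneously for all \<open>\<epsilon>, \<delta> \<le> \<eta>\<close>.
\<close>

definition tail_bound :: "(L2_unit \<Rightarrow> L2_unit) \<Rightarrow> nat \<Rightarrow> nat \<Rightarrow> real \<Rightarrow> (nat \<Rightarrow> (nat \<Rightarrow> real) \<times> (nat \<Rightarrow> real)) \<Rightarrow> real" where
  "tail_bound A n p \<eta> y = (\<Prod>j\<in>{..<p}. enn2real (unit_box (Suc n) (fst (y j))) * (1 - gauss_weight n \<eta> (snd (y j)))) *
     exp (- (norm (A (\<Sum>j\<in>{..<p}. path_vec n (y j))))\<^sup>2 / 2)"

lemma exp_norm_paths_measurable: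
  fixes A :: "L2_unit \<Rightarrow> L2_unit" and p :: nat
  assumes A: "bounded_linear A"
  shows "(\<lambda>y. exp (- (norm (A (\<Sum>j\<in>{..<p}. path_vec n (y j))))\<^sup>2 / 2)) \<in> borel_measurable (\<Pi>\<^sub>M j\<in>{..<p}. path_space n)"
proof (rule strongly_measurable_continuous[where h = "\<lambda>v. exp (- (norm (A v))\<^sup>2 / 2)"])
  show "strongly_measurable (\<Pi>\<^sub>M j\<in>{..<p}. path_space n) (\<lambda>y. \<Sum>j\<in>{..<p}. path_vec n (y j))"
    by (intro strongly_measurable_sum strongly_measurable_path_vec measurable_component_singleton)
  show "continuous_on UNIV (\<lambda>v. exp (- (norm (A v))\<^sup>2 / 2))"
    by (intro continuous_intros linear_continuous_on A) auto
qed

lemma integrable_box_gaussian: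
  fixes A :: "L2_unit \<Rightarrow> L2_unit" and p :: nat
  assumes A: "bounded_linear A" "finite_dimensional_subspace (op_kernel A)"
    "continuously_invertible_on (orthogonal_comp (op_kernel A)) A"
  shows "integrable (\<Pi>\<^sub>M j\<in>{..<p}. path_space n) (\<lambda>y. (\<Prod>j\<in>{..<p}. enn2real (unit_box (Suc n) (fst (y j)))) *
     exp (- (norm (A (\<Sum>j\<in>{..<p}. path_vec n (y j))))\<^sup>2 / 2))" (is "integrable ?Z ?g")
proof (rule integrableI_nonneg)
  have box: "ennreal (enn2real (unit_box k t)) = unit_box k t" for k t
    by (simp add: unit_box_eq)
  have "(\<lambda>y. enn2real (unit_box (Suc n) (fst (y j)))) \<in> borel_measurable ?Z" if "j \<in> {..<p}" for j
    using unit_box_fst_measurable[OF measurable_component_singleton[OF that]] by measurable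
  then show "?g \<in> borel_measurable ?Z"
    by (intro borel_measurable_times borel_measurable_prod exp_norm_paths_measurable A)
  show "AE y in ?Z. 0 \<le> ?g y" by (intro AE_I2 mult_nonneg_nonneg prod_nonneg) auto
  have "(\<integral>\<^sup>+y. ennreal (?g y) \<partial>?Z) = (\<integral>\<^sup>+y. (\<Prod>j\<in>{..<p}. unit_box (Suc n) (fst (y j))) *
        ennreal (exp (- (norm (A (\<Sum>j\<in>{..<p}. path_vec n (y j))))\<^sup>2 / 2)) \<partial>?Z)"
    by (intro nn_integral_cong)
      (simp add: ennreal_mult prod_nonneg prod_ennreal[symmetric] box)
  then show "(\<integral>\<^sup>+y. ennreal (?g y) \<partial>?Z) < \<infinity>"
    using nn_integral_operator_paths_finite[OF bounded_linear.linear[OF A(1)] A(2,3), of p n] by simp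
qed

text \<open>
  As \<open>\<eta>\<close> tends to \<open>0\<close> each factor \<open>1 - gauss_weight n \<eta> u\<close> tends to \<open>0\<close> and stays below \<open>1\<close>, so that dominated convergence
  applies. At least one factor is needed, whence \<open>p > 0\<close>.
\<close>

lemma tail_bound_props:
  fixes A :: "L2_unit \<Rightarrow> L2_unit" and p :: nat
  assumes A: "bounded_linear A" "finite_dimensional_subspace (op_kernel A)"
    "continuously_invertible_on (orthogonal_comp (op_kernel A)) A"
  shows integrable_tail_bound: "\<eta> \<ge> 0 \<Longrightarrow> integrable (\<Pi>\<^sub>M j\<in>{..<p}. path_space n) (tail_bound A n p \<eta>)"
    and tail_bound_tendsto: "p > 0 \<Longrightarrow> e > 0 \<Longrightarrow>
      \<exists>\<eta>>0. (\<integral>y. tail_bound A n p \<eta> y \<partial>(\<Pi>\<^sub>M j\<in>{..<p}. path_space n)) < e"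
proof -
  let ?Z = "\<Pi>\<^sub>M j\<in>{..<p}. path_space n"
  let ?g = "\<lambda>y. (\<Prod>j\<in>{..<p}. enn2real (unit_box (Suc n) (fst (y j)))) *
     exp (- (norm (A (\<Sum>j\<in>{..<p}. path_vec n (y j))))\<^sup>2 / 2)"
  have g: "integrable ?Z ?g" by (rule integrable_box_gaussian[OF A])
  have meas: "tail_bound A n p \<eta> \<in> borel_measurable ?Z" for \<eta>
  proof -
    have "(\<lambda>y. enn2real (unit_box (Suc n) (fst (y j))) * (1 - gauss_weight n \<eta> (snd (y j)))) \<in> borel_measurable ?Z"
      if j: "j \<in> {..<p}" for j
    proof -
      note c = measurable_component_singleton[OF j, of "\<lambda>_. path_space n"]
      have "(\<lambda>y. unit_box (Suc n) (fst (y j))) \<in> borel_measurable ?Z"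
        by (rule unit_box_fst_measurable[OF c])
      moreover have "(\<lambda>y. gauss_weight n \<eta> (snd (y j))) \<in> borel_measurable ?Z"
        by (rule measurable_compose[OF c measurable_compose[OF measurable_snd gauss_weight_measurable]])
      ultimately show ?thesis by measurable
    qed
    then show ?thesis unfolding tail_bound_def
      by (intro borel_measurable_times[OF borel_measurable_prod exp_norm_paths_measurable[OF A(1)]])
  qed
  have le: "norm (tail_bound A n p \<eta> y) \<le> ?g y" if "\<eta> \<ge> 0" for \<eta> y
  proof -
    have "0 \<le> enn2real b * (1 - gauss_weight n \<eta> u) \<and> enn2real b * (1 - gauss_weight n \<eta> u) \<le> enn2real b" for b u
      using gauss_weight_bounds[OF that, of n u] by (auto intro!: mult_nonneg_nonneg mult_left_le)
    then have "(\<Prod>j\<in>{..<p}. enn2real (unit_box (Suc n) (fst (y j))) * (1 - gauss_weight n \<eta> (snd (y j))))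
        \<le> (\<Prod>j\<in>{..<p}. enn2real (unit_box (Suc n) (fst (y j))))"
      "0 \<le> (\<Prod>j\<in>{..<p}. enn2real (unit_box (Suc n) (fst (y j))) * (1 - gauss_weight n \<eta> (snd (y j))))"
      by (auto intro!: prod_mono prod_nonneg)
    then show ?thesis unfolding tail_bound_def by (simp add: mult_right_mono)
  qed
  show "\<eta> \<ge> 0 \<Longrightarrow> integrable ?Z (tail_bound A n p \<eta>)"
    by (rule Bochner_Integration.integrable_bound[OF g meas])
      (intro AE_I2 order_trans[OF le], auto)
  assume p: "p > 0" and e: "e > 0"
  define s where "s m = 1 / real (Suc m)" for m
  have s: "s m > 0" for m by (simp add: s_def)
  have s0: "s \<longlonglongrightarrow> 0" unfolding s_def by (rule LIMSEQ_Suc[OF lim_1_over_n])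
  have "(\<lambda>m. \<integral>y. tail_bound A n p (s m) y \<partial>?Z) \<longlonglongrightarrow> (\<integral>y. 0 \<partial>?Z)"
  proof (rule integral_dominated_convergence[OF _ meas g])
    show "AE y in ?Z. (\<lambda>m. tail_bound A n p (s m) y) \<longlonglongrightarrow> 0"
    proof (rule AE_I2)
      fix y
      have "(\<lambda>m. tail_bound A n p (s m) y) \<longlonglongrightarrow>
        (\<Prod>j\<in>{..<p}. enn2real (unit_box (Suc n) (fst (y j))) * (1 - 1)) *
           exp (- (norm (A (\<Sum>j\<in>{..<p}. path_vec n (y j))))\<^sup>2 / 2)"
        unfolding tail_bound_def by (intro tendsto_intros gauss_weight_tendsto s0)
      then show "(\<lambda>m. tail_bound A n p (s m) y) \<longlonglongrightarrow> 0" using p by (simp add: zero_power)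
    qed
    show "AE y in ?Z. norm (tail_bound A n p (s m) y) \<le> ?g y" for m
      by (intro AE_I2 le less_imp_le s)
  qed simp
  then have "(\<lambda>m. \<integral>y. tail_bound A n p (s m) y \<partial>?Z) \<longlonglongrightarrow> 0" by simp
  then have "\<forall>\<^sub>F m in sequentially. (\<integral>y. tail_bound A n p (s m) y \<partial>?Z) < e"
    using e by (rule order_tendstoD(2))
  then show "\<exists>\<eta>>0. (\<integral>y. tail_bound A n p \<eta> y \<partial>?Z) < e"
    using s by (auto simp: eventually_sequentially)
qed

text \<open>
  The constant \<open>(2 \<pi>)\<^sup>-\<^sup>n\<close> in front of the Fourier integral is at most \<open>1\<close> and is dropped.
\<close>

lemma moment_difference_le:
  fixes A :: "L2_unit \<Rightarrow> L2_unit" and q :: nat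
  assumes A: "bounded_linear A" "finite_dimensional_subspace (op_kernel A)"
    "continuously_invertible_on (orthogonal_comp (op_kernel A)) A"
    and w: "white_noise M \<xi>"
    and Xm: "(\<lambda>(t, \<omega>). X t \<omega>) \<in> borel_measurable (borel \<Otimes>\<^sub>M M)"
    and X: "\<And>t. AE \<omega> in M. X t \<omega> = \<xi> (A (L2_indicator (unit_clamp t))) \<omega>"
    and x: "\<And>t \<omega>. t \<in> {0..1} \<Longrightarrow> X t \<omega> = x t \<omega>"
    and ed: "0 < \<epsilon>" "\<epsilon> \<le> \<eta>" "0 < \<delta>" "\<delta> \<le> \<eta>"
  shows "(\<integral>\<omega>. (approx_self_intersection_local_time x (Suc n) \<epsilon> \<omega>
       - approx_self_intersection_local_time x (Suc n) \<delta> \<omega>) ^ (2 * q) \<partial>M)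
     \<le> (\<integral>y. tail_bound A n (2 * q) \<eta> y \<partial>(\<Pi>\<^sub>M j\<in>{..<2 * q}. path_space n))"
proof -
  let ?T = "approx_self_intersection_local_time x (Suc n)"
  let ?Z = "\<Pi>\<^sub>M j\<in>{..<2 * q}. path_space n"
  define \<phi> where "\<phi> y = fourier_weight n \<epsilon> y - fourier_weight n \<delta> y" for y
  let ?I = "\<lambda>\<omega>. \<integral>y. complex_of_real (\<phi> y) * cis (path_phase X n y \<omega>) \<partial>path_space n"
  let ?h = "\<lambda>y. (\<Prod>j\<in>{..<2 * q}. \<phi> (y j)) * exp (- (norm (A (\<Sum>j\<in>{..<2 * q}. path_vec n (y j))))\<^sup>2 / 2)"
  define c where "c = (1 / (2 * pi)) ^ n"
  have c: "0 \<le> c" "c \<le> 1" unfolding c_def using pi_gt3 by (auto intro!: power_le_one)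
  have \<phi>: "integrable (path_space n) \<phi>"
    unfolding \<phi>_def using ed by (intro Bochner_Integration.integrable_diff integrable_fourier_weight)
  have T: "complex_of_real (?T \<epsilon> \<omega> - ?T \<delta> \<omega>) = complex_of_real c * ?I \<omega>" if \<omega>: "\<omega> \<in> space M" for \<omega>
  proof -
    have m: "(\<lambda>y. path_phase X n y \<omega>) \<in> borel_measurable (path_space n)"
      using \<omega> by (intro path_phase_measurable[OF Xm]) auto
    have i: "integrable (path_space n) (\<lambda>y. complex_of_real (fourier_weight n a y) * cis (path_phase X n y \<omega>))"
      if "a > 0" for a by (rule integrable_weight_cis[OF integrable_fourier_weight[OF that] m])
    have "?I \<omega> = (\<integral>y. complex_of_real (fourier_weight n \<epsilon> y) * cis (path_phase X n y \<omega>) \<partial>path_space n)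
       - (\<integral>y. complex_of_real (fourier_weight n \<delta> y) * cis (path_phase X n y \<omega>) \<partial>path_space n)"
      unfolding Bochner_Integration.integral_diff[OF i[OF ed(1)] i[OF ed(3)], symmetric]
      by (simp add: \<phi>_def left_diff_distrib)
    then show ?thesis
      using approx_fourier[where X = X and x = x and \<omega> = \<omega> and n = n, OF Xm x ed(1) \<omega>]
        approx_fourier[where X = X and x = x and \<omega> = \<omega> and n = n, OF Xm x ed(3) \<omega>]
      by (simp add: c_def right_diff_distrib)
  qed
  have "complex_of_real (\<integral>\<omega>. (?T \<epsilon> \<omega> - ?T \<delta> \<omega>) ^ (2 * q) \<partial>M) = (\<integral>\<omega>. complex_of_real (?T \<epsilon> \<omega> - ?T \<delta> \<omega>) ^ (2 * q) \<partial>M)"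
    by (simp only: integral_complex_of_real[symmetric] of_real_power)
  also have "\<dots> = (\<integral>\<omega>. complex_of_real (c ^ (2 * q)) * ?I \<omega> ^ (2 * q) \<partial>M)"
    by (rule Bochner_Integration.integral_cong[OF refl]) (simp only: T power_mult_distrib of_real_power)
  also have "\<dots> = complex_of_real (c ^ (2 * q)) * (\<integral>\<omega>. ?I \<omega> ^ (2 * q) \<partial>M)"
    by (rule integral_mult_right_zero)
  also have "(\<integral>\<omega>. ?I \<omega> ^ (2 * q) \<partial>M) = (\<integral>y. complex_of_real (?h y) \<partial>?Z)"
    by (rule moment_of_phase_integral[OF bounded_linear.linear[OF A(1)] w Xm X \<phi>])
  also have "\<dots> = complex_of_real (\<integral>y. ?h y \<partial>?Z)" by (rule integral_complex_of_real)
  finally have eq: "(\<integral>\<omega>. (?T \<epsilon> \<omega> - ?T \<delta> \<omega>) ^ (2 * q) \<partial>M) = c ^ (2 * q) * (\<integral>y. ?h y \<partial>?Z)"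
    by (simp only: of_real_mult[symmetric] of_real_eq_iff)
  have \<eta>: "\<eta> \<ge> 0" using ed by simp
  have le: "norm (?h y) \<le> tail_bound A n (2 * q) \<eta> y" for y
  proof -
    have "\<bar>\<phi> z\<bar> \<le> enn2real (unit_box (Suc n) (fst z)) * (1 - gauss_weight n \<eta> (snd z))" for z
    proof -
      have "\<bar>gauss_weight n \<epsilon> (snd z) - gauss_weight n \<delta> (snd z)\<bar> \<le> 1 - gauss_weight n \<eta> (snd z)"
        using gauss_weight_antimono[OF ed(2), of n "snd z"] gauss_weight_antimono[OF ed(4), of n "snd z"]
          gauss_weight_bounds(2)[of \<epsilon> n "snd z"] gauss_weight_bounds(2)[of \<delta> n "snd z"] ed by linarith
      moreover have "\<bar>\<phi> z\<bar> = indicator (time_simplex (Suc n)) (fst z) * \<bar>gauss_weight n \<epsilon> (snd z) - gauss_weight n \<delta> (snd z)\<bar>"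
        by (simp add: \<phi>_def fourier_weight_def right_diff_distrib[symmetric] abs_mult)
      ultimately show ?thesis
        using indicator_time_simplex_le[of "Suc n" "fst z"] by (auto intro!: mult_mono)
    qed
    then have "(\<Prod>j\<in>{..<2 * q}. \<bar>\<phi> (y j)\<bar>) \<le> (\<Prod>j\<in>{..<2 * q}. enn2real (unit_box (Suc n) (fst (y j))) * (1 - gauss_weight n \<eta> (snd (y j))))"
      by (intro prod_mono) auto
    then show ?thesis
      unfolding tail_bound_def by (simp add: abs_mult abs_prod mult_right_mono)
  qed
  have h_le: "norm (\<integral>y. ?h y \<partial>?Z) \<le> (\<integral>y. tail_bound A n (2 * q) \<eta> y \<partial>?Z)"
  proof (rule order_trans[OF integral_norm_bound integral_mono'])
    show "integrable ?Z (tail_bound A n (2 * q) \<eta>)" by (rule integrable_tail_bound[OF A \<eta>])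
  qed (use le order_trans[OF norm_ge_zero le] in auto)
  have shrink: "a * b \<le> d" if "0 \<le> a" "a \<le> 1" "\<bar>b\<bar> \<le> d" for a b d :: real
  proof -
    have "a * b \<le> a * \<bar>b\<bar>" using that by (intro mult_left_mono) auto
    also have "\<dots> \<le> 1 * \<bar>b\<bar>" using that by (intro mult_right_mono) auto
    finally show ?thesis using that by simp
  qed
  show ?thesis
    unfolding eq by (rule shrink) (use h_le c in \<open>simp_all add: power_le_one\<close>)
qed

theorem theorem2:
  fixes A :: "L2_unit \<Rightarrow> L2_unit"
    and M :: "'w measure"
    and \<xi> :: "L2_unit \<Rightarrow> 'w \<Rightarrow> real"
  assumes "bounded_linear A"
    and "finite_dimensional_subspace (op_kernel A)"
    and "continuously_invertible_on (orthogonal_comp (op_kernel A)) A"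
    and "white_noise M \<xi>"
  shows "(\<exists>x. measurable_version M (\<lambda>t. \<xi> (A (L2_indicator t))) x) \<and>
    (\<forall>x. measurable_version M (\<lambda>t. \<xi> (A (L2_indicator t))) x \<longrightarrow>
      (\<forall>p\<ge>1. \<forall>k\<ge>2. \<exists>T. is_self_intersection_local_time M p x k T))"
proof (intro conjI allI impI)
  show "\<exists>x. measurable_version M (\<lambda>t. \<xi> (A (L2_indicator t))) x"
    by (rule measurable_version_exists[OF assms(1,4)])
  fix x and p k :: nat
  assume x: "measurable_version M (\<lambda>t. \<xi> (A (L2_indicator t))) x" and p: "1 \<le> p" and k: "2 \<le> k"
  then obtain n where n: "k = Suc n" by (cases k) auto
  interpret prob_space M by (rule white_noise_prob_space[OF assms(4)])
  \<comment> \<open>Extends the version to all real times in a jointly measurable way.\<close>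
  define X where "X t \<omega> = x (unit_clamp t) \<omega>" for t \<omega>
  have xm: "(\<lambda>(t, \<omega>). x t \<omega>) \<in> borel_measurable (restrict_space borel {0..1} \<Otimes>\<^sub>M M)"
    and xv: "\<And>t. t \<in> {0..1} \<Longrightarrow> AE \<omega> in M. x t \<omega> = \<xi> (A (L2_indicator t)) \<omega>"
    using x unfolding measurable_version_def by auto
  have Xm: "(\<lambda>(t, \<omega>). X t \<omega>) \<in> borel_measurable (borel \<Otimes>\<^sub>M M)"
  proof -
    have "unit_clamp \<in> measurable borel (restrict_space borel {0..1})"
      by (rule measurable_restrict_space2) auto
    then have "(\<lambda>z. (unit_clamp (fst z), snd z)) \<in> measurable (borel \<Otimes>\<^sub>M M) (restrict_space borel {0..1} \<Otimes>\<^sub>M M)"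
      by (intro measurable_Pair measurable_snd measurable_compose[OF measurable_fst])
    from measurable_compose[OF this xm] show ?thesis by (simp add: X_def case_prod_unfold)
  qed
  have X: "AE \<omega> in M. X t \<omega> = \<xi> (A (L2_indicator (unit_clamp t))) \<omega>" for t
    unfolding X_def by (rule xv) simp
  have Xx: "X t \<omega> = x t \<omega>" if "t \<in> {0..1}" for t \<omega>
    using that by (simp add: X_def unit_clamp_id)
  let ?T = "approx_self_intersection_local_time x (Suc n)"
  let ?F = "\<lambda>\<epsilon> \<omega>. (\<integral>y. complex_of_real (fourier_weight n \<epsilon> y) * cis (path_phase X n y \<omega>) \<partial>path_space n)"
  have "\<exists>L. \<forall>p\<ge>1. Lp_limit M p ?T L (at_right 0)"
  proof (rule Lp_limit_of_cauchy_moments)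
    fix \<epsilon> :: real assume e: "\<epsilon> > 0"
    have T: "?T \<epsilon> \<omega> = Re (complex_of_real ((1 / (2 * pi)) ^ n) * ?F \<epsilon> \<omega>)" if "\<omega> \<in> space M" for \<omega>
      using approx_fourier[where X = X and x = x and \<omega> = \<omega> and n = n, OF Xm Xx e that] by (metis Re_complex_of_real)
    have F: "(\<lambda>\<omega>. ?F \<epsilon> \<omega>) \<in> borel_measurable M"
    proof (rule sigma_finite_measure.borel_measurable_lebesgue_integral[OF sigma_finite_path_space])
      note [measurable] = path_phase_measurable[OF Xm measurable_snd measurable_fst, of n]
        measurable_compose[OF measurable_snd borel_measurable_integrable[OF integrable_fourier_weight[OF e]]]
      show "(\<lambda>(\<omega>, y). complex_of_real (fourier_weight n \<epsilon> y) * cis (path_phase X n y \<omega>))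
          \<in> borel_measurable (M \<Otimes>\<^sub>M path_space n)"
        unfolding case_prod_unfold by measurable
    qed
    have "(\<lambda>z. Re (complex_of_real ((1 / (2 * pi)) ^ n) * z)) \<in> borel_measurable borel" by measurable
    from measurable_compose[OF F this] show "?T \<epsilon> \<in> borel_measurable M"
      by (simp only: measurable_cong[OF T])
    show "\<exists>C. \<forall>\<omega>\<in>space M. \<bar>?T \<epsilon> \<omega>\<bar> \<le> C"
    proof (intro exI ballI)
      fix \<omega> assume \<omega>: "\<omega> \<in> space M"
      have "\<bar>?T \<epsilon> \<omega>\<bar> \<le> norm (complex_of_real ((1 / (2 * pi)) ^ n) * ?F \<epsilon> \<omega>)"
        unfolding T[OF \<omega>] by (rule abs_Re_le_cmod)
      also have "\<dots> = (1 / (2 * pi)) ^ n * norm (?F \<epsilon> \<omega>)"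
        by (simp add: norm_mult norm_power norm_divide)
      also have "\<dots> \<le> (1 / (2 * pi)) ^ n * (\<integral>y. norm (fourier_weight n \<epsilon> y) \<partial>path_space n)"
      proof (rule mult_left_mono)
        have "norm (?F \<epsilon> \<omega>) \<le> (\<integral>y. norm (complex_of_real (fourier_weight n \<epsilon> y) * cis (path_phase X n y \<omega>)) \<partial>path_space n)"
          by (rule integral_norm_bound)
        then show "norm (?F \<epsilon> \<omega>) \<le> (\<integral>y. norm (fourier_weight n \<epsilon> y) \<partial>path_space n)"
          by (simp add: norm_mult)
      qed simp
      finally show "\<bar>?T \<epsilon> \<omega>\<bar> \<le> (1 / (2 * pi)) ^ n * (\<integral>y. norm (fourier_weight n \<epsilon> y) \<partial>path_space n)" .
    qed
  next
    fix q :: nat and e :: real assume q: "q \<ge> 1" and e: "e > 0"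
    then obtain \<eta> where \<eta>: "\<eta> > 0" "(\<integral>y. tail_bound A n (2 * q) \<eta> y \<partial>(\<Pi>\<^sub>M j\<in>{..<2 * q}. path_space n)) < e"
      using tail_bound_tendsto[OF assms(1-3), of "2 * q" e n] by auto
    have "(\<integral>\<omega>. (?T \<epsilon> \<omega> - ?T \<delta> \<omega>) ^ (2 * q) \<partial>M) \<le> e"
      if "0 < \<epsilon>" "\<epsilon> \<le> \<eta>" "0 < \<delta>" "\<delta> \<le> \<eta>" for \<epsilon> \<delta>
      using moment_difference_le[OF assms Xm X Xx that, of n q] \<eta>(2) by linarith
    then show "\<exists>\<eta>>0. \<forall>\<epsilon> \<delta>. 0 < \<epsilon> \<longrightarrow> \<epsilon> \<le> \<eta> \<longrightarrow> 0 < \<delta> \<longrightarrow> \<delta> \<le> \<eta> \<longrightarrow>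
        (\<integral>\<omega>. (?T \<epsilon> \<omega> - ?T \<delta> \<omega>) ^ (2 * q) \<partial>M) \<le> e"
      using \<eta>(1) by blast
  qed
  then show "\<exists>T. is_self_intersection_local_time M p x k T"
    using p unfolding n is_self_intersection_local_time_def by blast
qed

end
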